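(* Let $\Theta$ be a nowhere vanishing $n$-form on a smooth manifold $M$ and let $\tau:\widetilde M\to M$, with $(\widetilde M,-d\Upsilon)$, be a (pre-)multisymplectization of $(M,\Theta)$ with conformal factor $\phi\in C^\infty(\widetilde M)$. Then for every infinitesimal conformal transformation $X\in\mathfrak{X}^p(M)$ of $\Theta$ there exists a multivector field $\widetilde X\in\mathfrak{X}^p(\widetilde M)$, unique up to $\ker_p d\Upsilon$, such that $$\mathcal{L}_{\widetilde X}\Upsilon=0\qquad\text{and}\qquad \tau_*\widetilde X=X.$$ (Unique up to $\ker_p d\Upsilon$ means that the difference of any two such multivector fields takes values in $\ker_p d\Upsilon$.)
   Context: $\mathfrak{X}^p(M)=\Gamma(\bigwedge^p TM)$; $\iota_{U\wedge V}=\iota_V\iota_U$; for $U\in\mathfrak{X}^p$, $\mathcal{L}_U\alpha=d\iota_U\alpha-(-1)^p\iota_U d\alpha$; $\ker_p\omega=\{u\in\bigwedge^p T\widetilde M:\iota_u\omega=0\}$. $\tau_*\widetilde X=X$ means that $\widetilde X$ is $\tau$-related to $X$, i.e. $(\bigwedge^p d\tau)(\widetilde X_y)=X_{\tau(y)}$ for all $y$. For $1\le p\le n$, $X\in\mathfrak{X}^p(M)$ is an infinitesimal conformal transformation of $\Theta$ if $\mathcal{L}_X\Theta=\iota_V\Theta$ for some $V\in\mathfrak{X}^{p-1}(M)$. A closed $(n+1)$-form is pre-multisymplectic; it is multisymplectic if moreover $v\mapsto\iota_v\Omega$ is injective on tangent vectors. A homogeneous (pre-)multisymplectic manifold is a pair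 $(\widetilde M,\Upsilon)$, $\Upsilon\in\Omega^n(\widetilde M)$, such that $\Omega=-d\Upsilon$ is (pre-)multisymplectic and there is a Liouville vector field $\Delta$, i.e. one with $\iota_\Delta\Omega=-\Upsilon$. A locally trivial fiber bundle $\tau:\widetilde M\to M$, with $\widetilde M$ homogeneous (pre-)multisymplectic, $\Omega=-d\Upsilon$, is a (pre-)multisymplectization of $(M,\Theta)$ if it admits a Liouville vector field $\Delta$ that is vertical with respect to $\tau$, and $\Upsilon=\phi\cdot\tau^*\Theta$ for some nowhere vanishing $\phi\in C^\infty(\widetilde M)$, called the conformal factor. *)

theory Defs
  imports "HOL-Analysis.Analysis" "HOL-Library.Function_Algebras"
begin

text \<open>Tangent vectors, forms and multivectors are all functions, so we give functions into a
  vector space the pointwise vector space structure.\<close>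

instantiation "fun" :: (type, real_vector) real_vector
begin

definition scaleR_fun :: "real \<Rightarrow> ('a \<Rightarrow> 'b) \<Rightarrow> 'a \<Rightarrow> 'b"
  where "scaleR_fun r f = (\<lambda>x. r *\<^sub>R f x)"

instance
  by standard (auto simp: scaleR_fun_def fun_eq_iff scaleR_add_right scaleR_add_left)

end


section \<open>Exterior algebra of a vector space\<close>

definition tuples :: "'v set \<Rightarrow> nat \<Rightarrow> 'v list set"
  where "tuples V k = {vs. set vs \<subseteq> V \<and> length vs = k}"

text \<open>Alternating \<open>k\<close>-linear forms on a subspace \<open>V\<close>. They vanish by convention on lists that are
  not \<open>k\<close>-tuples of elements of \<open>V\<close>, so that equality of forms is equality of functions.\<close>

definition alt_forms :: "'v::real_vector set \<Rightarrow> nat \<Rightarrow> ('v list \<Rightarrow> real) set"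
  where "alt_forms V k = {\<alpha>.
    (\<forall>vs. vs \<notin> tuples V k \<longrightarrow> \<alpha> vs = 0) \<and>
    (\<forall>vs\<in>tuples V k. \<forall>i<k. \<forall>v\<in>V. \<forall>w\<in>V. \<forall>r.
        \<alpha> (vs[i := r *\<^sub>R v + w]) = r * \<alpha> (vs[i := v]) + \<alpha> (vs[i := w])) \<and>
    (\<forall>vs\<in>tuples V k. \<not> distinct vs \<longrightarrow> \<alpha> vs = 0)}"

type_synonym 'v multivec = "('v list \<Rightarrow> real) \<Rightarrow> real"

text \<open>The decomposable multivector \<open>v\<^sub>1 \<and> \<dots> \<and> v\<^sub>p\<close> is realised through its pairing with alternating
  \<open>p\<close>-forms, and \<open>\<Lambda>\<^sup>p V\<close> is the linear span of the decomposables inside the space of functionals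
  on alternating \<open>p\<close>-forms. (Since alternating forms are exactly the linear forms on \<open>\<Lambda>\<^sup>p V\<close>,
  they separate its points, so this is the exterior power.) Functionals are \<open>0\<close> by convention
  outside \<open>alt_forms V p\<close>. For \<open>p = 0\<close> one obtains the scalars, spanned by the empty wedge.\<close>

definition wedge :: "'v::real_vector set \<Rightarrow> 'v list \<Rightarrow> 'v multivec"
  where "wedge V vs = (\<lambda>\<alpha>. if \<alpha> \<in> alt_forms V (length vs) then \<alpha> vs else 0)"

definition ext_power :: "'v::real_vector set \<Rightarrow> nat \<Rightarrow> 'v multivec set"
  where "ext_power V p = span (wedge V ` tuples V p)"

definition pull_form ::
    "'v set \<Rightarrow> ('v \<Rightarrow> 'w) \<Rightarrow> ('w list \<Rightarrow> real) \<Rightarrow> 'v list \<Rightarrow> real"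
  where "pull_form V L \<beta> = (\<lambda>vs. if set vs \<subseteq> V then \<beta> (map L vs) else 0)"

text \<open>\<open>\<Lambda>\<^sup>p L : \<Lambda>\<^sup>p V \<rightarrow> \<Lambda>\<^sup>p W\<close> for a linear map \<open>L : V \<rightarrow> W\<close>;
  it sends \<open>v\<^sub>1 \<and> \<dots> \<and> v\<^sub>p\<close> to \<open>L v\<^sub>1 \<and> \<dots> \<and> L v\<^sub>p\<close>.\<close>

definition ext_map :: "'v set \<Rightarrow> 'w::real_vector set \<Rightarrow> nat \<Rightarrow> ('v \<Rightarrow> 'w) \<Rightarrow> 'v multivec \<Rightarrow> 'w multivec"
  where "ext_map V W p L U = (\<lambda>\<beta>. if \<beta> \<in> alt_forms W p then U (pull_form V L \<beta>) else 0)"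

text \<open>Interior product. On decomposables it is
  \<open>\<iota>(v\<^sub>1 \<and> \<dots> \<and> v\<^sub>p) \<alpha> = \<alpha>(v\<^sub>1, \<dots>, v\<^sub>p, \<cdot>, \<dots>, \<cdot>)\<close>, see \<open>contract_wedge\<close>, which is the convention
  \<open>\<iota>(U \<and> V) = \<iota>(V) \<circ> \<iota>(U)\<close>, see \<open>contract_append\<close>.\<close>

definition contract :: "'v multivec \<Rightarrow> ('v list \<Rightarrow> real) \<Rightarrow> 'v list \<Rightarrow> real"
  where "contract U \<alpha> = (\<lambda>ws. U (\<lambda>vs. \<alpha> (vs @ ws)))"


section \<open>Smooth manifolds\<close>

text \<open>Both notions are meant for open \<open>S\<close> and finite-dimensional spaces.\<close>

primrec Ck_on :: "nat \<Rightarrow> 'a::real_normed_vector set \<Rightarrow> ('a \<Rightarrow> 'b::real_normed_vector) \<Rightarrow> bool"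
  where
    "Ck_on 0 S f \<longleftrightarrow> continuous_on S f"
  | "Ck_on (Suc k) S f \<longleftrightarrow> (\<forall>x\<in>S. f differentiable at x) \<and>
       (\<forall>v. Ck_on k S (\<lambda>x. frechet_derivative f (at x) v))"

definition smooth_on :: "'a::real_normed_vector set \<Rightarrow> ('a \<Rightarrow> 'b::real_normed_vector) \<Rightarrow> bool"
  where "smooth_on S f \<longleftrightarrow> (\<forall>k. Ck_on k S f)"

text \<open>A chart is a domain together with a coordinate map, whose values outside the domain are
  irrelevant. A manifold is a type of points that is Hausdorff and second countable, equipped with
  a smooth atlas; the atlas need not be maximal: atlases generating the same smooth structure give
  canonically isomorphic tangent spaces.\<close>

type_synonym ('m, 'e) chart = "'m set \<times> ('m \<Rightarrow> 'e)"
type_synonym ('m, 'e) atlas = "('m, 'e) chart set"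

abbreviation cdom :: "('m, 'e) chart \<Rightarrow> 'm set" where "cdom \<equiv> fst"
abbreviation cmap :: "('m, 'e) chart \<Rightarrow> 'm \<Rightarrow> 'e" where "cmap \<equiv> snd"
abbreviation cinv :: "('m, 'e) chart \<Rightarrow> 'e \<Rightarrow> 'm" where "cinv c \<equiv> inv_into (cdom c) (cmap c)"
abbreviation crange :: "('m, 'e) chart \<Rightarrow> 'e set" where "crange c \<equiv> cmap c ` cdom c"

definition smooth_manifold ::
    "('m::{t2_space, second_countable_topology}, 'e::euclidean_space) atlas \<Rightarrow> bool"
  where "smooth_manifold A \<longleftrightarrow>
    (\<forall>c\<in>A. open (cdom c) \<and> open (crange c) \<and> (\<exists>g. homeomorphism (cdom c) (crange c) (cmap c) g)) \<and>
    (\<Union>c\<in>A. cdom c) = UNIV \<and>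
    (\<forall>c\<in>A. \<forall>c'\<in>A. smooth_on (cmap c ` (cdom c \<inter> cdom c')) (cmap c' \<circ> cinv c))"

definition smooth_map_on ::
    "('m::topological_space, 'e::real_normed_vector) atlas \<Rightarrow> 'm set \<Rightarrow>
     ('k::topological_space, 'd::real_normed_vector) atlas \<Rightarrow> ('m \<Rightarrow> 'k) \<Rightarrow> bool"
  where "smooth_map_on A S B f \<longleftrightarrow> continuous_on S f \<and>
    (\<forall>c\<in>A. \<forall>c'\<in>B. smooth_on (cmap c ` (cdom c \<inter> S \<inter> f -` cdom c')) (cmap c' \<circ> f \<circ> cinv c))"

definition smooth_fun :: "('m, 'e::real_normed_vector) atlas \<Rightarrow> ('m \<Rightarrow> real) \<Rightarrow> bool"
  where "smooth_fun A f \<longleftrightarrow> (\<forall>c\<in>A. smooth_on (crange c) (f \<circ> cinv c))"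

definition diffeo_on ::
    "('m::topological_space, 'e::real_normed_vector) atlas \<Rightarrow> 'm set \<Rightarrow>
     ('k::topological_space, 'd::real_normed_vector) atlas \<Rightarrow> 'k set \<Rightarrow> ('m \<Rightarrow> 'k) \<Rightarrow> bool"
  where "diffeo_on A S B T h \<longleftrightarrow>
    bij_betw h S T \<and> smooth_map_on A S B h \<and> smooth_map_on B T A (inv_into S h)"

definition prod_atlas :: "('m, 'e) atlas \<Rightarrow> ('f, 'g) atlas \<Rightarrow> ('m \<times> 'f, 'e \<times> 'g) atlas"
  where "prod_atlas A B = (\<lambda>(c, c'). (cdom c \<times> cdom c', map_prod (cmap c) (cmap c'))) ` (A \<times> B)"

definition fiber_bundle ::
    "('t::topological_space, 'k::real_normed_vector) atlas \<Rightarrow>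
     ('m::topological_space, 'e::real_normed_vector) atlas \<Rightarrow>
     ('f::topological_space, 'g::real_normed_vector) atlas \<Rightarrow> ('t \<Rightarrow> 'm) \<Rightarrow> bool"
  where "fiber_bundle At A F \<tau> \<longleftrightarrow> smooth_map_on At UNIV A \<tau> \<and>
    (\<forall>x. \<exists>W h. open W \<and> x \<in> W \<and> diffeo_on At (\<tau> -` W) (prod_atlas A F) (W \<times> UNIV) h \<and>
       (\<forall>y\<in>\<tau> -` W. fst (h y) = \<tau> y))"


section \<open>Tangent spaces\<close>

text \<open>A tangent vector at \<open>x\<close> is the family of its coordinate vectors in all charts around \<open>x\<close>,
  related by the derivatives of the transition maps; it is \<open>0\<close> by convention at other charts.\<close>

type_synonym ('m, 'e) tvec = "('m, 'e) chart \<Rightarrow> 'e"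

definition charts_at :: "('m, 'e) atlas \<Rightarrow> 'm \<Rightarrow> ('m, 'e) chart set"
  where "charts_at A x = {c \<in> A. x \<in> cdom c}"

definition chart_at :: "('m, 'e) atlas \<Rightarrow> 'm \<Rightarrow> ('m, 'e) chart"
  where "chart_at A x = (SOME c. c \<in> charts_at A x)"

definition tangent_space ::
    "('m, 'e::real_normed_vector) atlas \<Rightarrow> 'm \<Rightarrow> ('m, 'e) tvec set"
  where "tangent_space A x = {v.
    (\<forall>c. c \<notin> charts_at A x \<longrightarrow> v c = 0) \<and>
    (\<forall>c\<in>charts_at A x. \<forall>c'\<in>charts_at A x.
       v c' = frechet_derivative (cmap c' \<circ> cinv c) (at (cmap c x)) (v c))}"

text \<open>The tangent vector at \<open>x\<close> whose coordinate vector in the chart \<open>c\<close> is \<open>w\<close>.\<close>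

definition coord_tvec ::
    "('m, 'e::real_normed_vector) atlas \<Rightarrow> ('m, 'e) chart \<Rightarrow> 'm \<Rightarrow> 'e \<Rightarrow> ('m, 'e) tvec"
  where "coord_tvec A c x w = (\<lambda>c'. if c' \<in> charts_at A x
    then frechet_derivative (cmap c' \<circ> cinv c) (at (cmap c x)) w else 0)"

definition tangent_map ::
    "('t, 'k::real_normed_vector) atlas \<Rightarrow> ('m, 'e::real_normed_vector) atlas \<Rightarrow>
     ('t \<Rightarrow> 'm) \<Rightarrow> 't \<Rightarrow> ('t, 'k) tvec \<Rightarrow> ('m, 'e) tvec"
  where "tangent_map At A f y v = (\<lambda>c'. if c' \<in> charts_at A (f y)
    then let c = chart_at At y in
      frechet_derivative (cmap c' \<circ> f \<circ> cinv c) (at (cmap c y)) (v c)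
    else 0)"


section \<open>Differential forms and multivector fields\<close>

type_synonym ('m, 'e) form_field = "'m \<Rightarrow> ('m, 'e) tvec list \<Rightarrow> real"
type_synonym ('m, 'e) mv_field = "'m \<Rightarrow> ('m, 'e) tvec multivec"

text \<open>Smoothness means smoothness of the components with respect to the coordinate frames.\<close>

definition diff_forms :: "('m, 'e::real_normed_vector) atlas \<Rightarrow> nat \<Rightarrow> ('m, 'e) form_field set"
  where "diff_forms A k = {\<alpha>.
    (\<forall>x. \<alpha> x \<in> alt_forms (tangent_space A x) k) \<and>
    (\<forall>c\<in>A. \<forall>ws. smooth_on (crange c) (\<lambda>u. \<alpha> (cinv c u) (map (coord_tvec A c (cinv c u)) ws)))}"

definition mv_fields :: "('m, 'e::real_normed_vector) atlas \<Rightarrow> nat \<Rightarrow> ('m, 'e) mv_field set"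
  where "mv_fields A p = {X.
    (\<forall>x. X x \<in> ext_power (tangent_space A x) p) \<and>
    (\<forall>c\<in>A. \<forall>\<beta>\<in>alt_forms UNIV p. smooth_on (crange c)
       (\<lambda>u. X (cinv c u) (pull_form (tangent_space A (cinv c u)) (\<lambda>v. v c) \<beta>)))}"

text \<open>Exterior derivative, computed in a chart \<open>c\<close> around the point by
  \<open>d\<alpha>(v\<^sub>0, \<dots>, v\<^sub>k) = \<Sum>\<^sub>i (-1)\<^sup>i \<partial>\<^bsub>v\<^sub>i\<^esub> (\<alpha>(v\<^sub>0, \<dots>, v\<^sub>i\<^sub>-\<^sub>1, v\<^sub>i\<^sub>+\<^sub>1, \<dots>, v\<^sub>k))\<close>, where the \<open>v\<^sub>j\<close> are extended to vector
  fields with constant coordinates.\<close>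

definition ext_d :: "('m, 'e::real_normed_vector) atlas \<Rightarrow> ('m, 'e) form_field \<Rightarrow> ('m, 'e) form_field"
  where "ext_d A \<alpha> x vs = (if set vs \<subseteq> tangent_space A x then
    let c = chart_at A x; ws = map (\<lambda>v. v c) vs in
      (\<Sum>i<length vs. (-1) ^ i *
         frechet_derivative
           (\<lambda>u. \<alpha> (cinv c u) (map (coord_tvec A c (cinv c u)) (take i ws @ drop (Suc i) ws)))
           (at (cmap c x)) (ws ! i))
    else 0)"

definition pullback ::
    "('t, 'k::real_normed_vector) atlas \<Rightarrow> ('m, 'e::real_normed_vector) atlas \<Rightarrow>
     ('t \<Rightarrow> 'm) \<Rightarrow> ('m, 'e) form_field \<Rightarrow> ('t, 'k) form_field"
  where "pullback At A f \<alpha> y = pull_form (tangent_space At y) (tangent_map At A f y) (\<alpha> (f y))"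

definition related ::
    "('t, 'k::real_normed_vector) atlas \<Rightarrow> ('m, 'e::real_normed_vector) atlas \<Rightarrow>
     ('t \<Rightarrow> 'm) \<Rightarrow> nat \<Rightarrow> ('t, 'k) mv_field \<Rightarrow> ('m, 'e) mv_field \<Rightarrow> bool"
  where "related At A f p Y X \<longleftrightarrow>
    (\<forall>y. ext_map (tangent_space At y) (tangent_space A (f y)) p (tangent_map At A f y) (Y y) = X (f y))"

definition iota :: "('m, 'e) mv_field \<Rightarrow> ('m, 'e) form_field \<Rightarrow> ('m, 'e) form_field"
  where "iota U \<alpha> = (\<lambda>x. contract (U x) (\<alpha> x))"

definition lie_derivative ::
    "('m, 'e::real_normed_vector) atlas \<Rightarrow> nat \<Rightarrow> ('m, 'e) mv_field \<Rightarrow>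
     ('m, 'e) form_field \<Rightarrow> ('m, 'e) form_field"
  where "lie_derivative A p U \<alpha> = ext_d A (iota U \<alpha>) - (-1) ^ p *\<^sub>R iota U (ext_d A \<alpha>)"

definition kernel_at ::
    "('m, 'e::real_normed_vector) atlas \<Rightarrow> nat \<Rightarrow> ('m, 'e) form_field \<Rightarrow> 'm \<Rightarrow> ('m, 'e) tvec multivec set"
  where "kernel_at A p \<omega> x = {u \<in> ext_power (tangent_space A x) p. contract u (\<omega> x) = 0}"

definition inf_conformal ::
    "('m, 'e::real_normed_vector) atlas \<Rightarrow> nat \<Rightarrow> ('m, 'e) form_field \<Rightarrow> ('m, 'e) mv_field \<Rightarrow> bool"
  where "inf_conformal A p \<Theta> X \<longleftrightarrow>
    X \<in> mv_fields A p \<and> (\<exists>V\<in>mv_fields A (p - 1). lie_derivative A p X \<Theta> = iota V \<Theta>)"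


section \<open>Multisymplectization\<close>

definition pre_multisymplectic ::
    "('m, 'e::real_normed_vector) atlas \<Rightarrow> nat \<Rightarrow> ('m, 'e) form_field \<Rightarrow> bool"
  where "pre_multisymplectic A n \<Omega> \<longleftrightarrow> \<Omega> \<in> diff_forms A (n + 1) \<and> ext_d A \<Omega> = 0"

definition multisymplectic ::
    "('m, 'e::real_normed_vector) atlas \<Rightarrow> nat \<Rightarrow> ('m, 'e) form_field \<Rightarrow> bool"
  where "multisymplectic A n \<Omega> \<longleftrightarrow> pre_multisymplectic A n \<Omega> \<and>
    (\<forall>x. inj_on (\<lambda>v. contract (wedge (tangent_space A x) [v]) (\<Omega> x)) (tangent_space A x))"

definition liouville ::
    "('m, 'e::real_normed_vector) atlas \<Rightarrow> ('m, 'e) form_field \<Rightarrow> ('m, 'e) mv_field \<Rightarrow> bool"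
  where "liouville A \<Upsilon> \<Delta> \<longleftrightarrow> \<Delta> \<in> mv_fields A 1 \<and> iota \<Delta> (- ext_d A \<Upsilon>) = - \<Upsilon>"

definition homogeneous_pre_multisymplectic ::
    "('m, 'e::real_normed_vector) atlas \<Rightarrow> nat \<Rightarrow> ('m, 'e) form_field \<Rightarrow> bool"
  where "homogeneous_pre_multisymplectic A n \<Upsilon> \<longleftrightarrow> \<Upsilon> \<in> diff_forms A n \<and>
    pre_multisymplectic A n (- ext_d A \<Upsilon>) \<and> (\<exists>\<Delta>. liouville A \<Upsilon> \<Delta>)"

definition homogeneous_multisymplectic ::
    "('m, 'e::real_normed_vector) atlas \<Rightarrow> nat \<Rightarrow> ('m, 'e) form_field \<Rightarrow> bool"
  where "homogeneous_multisymplectic A n \<Upsilon> \<longleftrightarrow> \<Upsilon> \<in> diff_forms A n \<and>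
    multisymplectic A n (- ext_d A \<Upsilon>) \<and> (\<exists>\<Delta>. liouville A \<Upsilon> \<Delta>)"

text \<open>The part of the definition shared by multisymplectizations and pre-multisymplectizations.
  A vector field is vertical iff it is related to the zero field.\<close>

definition conformal_bundle ::
    "('t::topological_space, 'k::real_normed_vector) atlas \<Rightarrow>
     ('m::topological_space, 'e::real_normed_vector) atlas \<Rightarrow>
     ('f::topological_space, 'g::real_normed_vector) atlas \<Rightarrow>
     ('m, 'e) form_field \<Rightarrow> ('t \<Rightarrow> 'm) \<Rightarrow> ('t, 'k) form_field \<Rightarrow> ('t \<Rightarrow> real) \<Rightarrow> bool"
  where "conformal_bundle At A F \<Theta> \<tau> \<Upsilon> \<phi> \<longleftrightarrow>
    fiber_bundle At A F \<tau> \<and>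
    (\<exists>\<Delta>. liouville At \<Upsilon> \<Delta> \<and> related At A \<tau> 1 \<Delta> 0) \<and>
    smooth_fun At \<phi> \<and> (\<forall>y. \<phi> y \<noteq> 0) \<and>
    \<Upsilon> = (\<lambda>y. \<phi> y *\<^sub>R pullback At A \<tau> \<Theta> y)"

definition pre_multisymplectization ::
    "nat \<Rightarrow> ('t::topological_space, 'k::real_normed_vector) atlas \<Rightarrow>
     ('m::topological_space, 'e::real_normed_vector) atlas \<Rightarrow>
     ('f::topological_space, 'g::real_normed_vector) atlas \<Rightarrow>
     ('m, 'e) form_field \<Rightarrow> ('t \<Rightarrow> 'm) \<Rightarrow> ('t, 'k) form_field \<Rightarrow> ('t \<Rightarrow> real) \<Rightarrow> bool"
  where "pre_multisymplectization n At A F \<Theta> \<tau> \<Upsilon> \<phi> \<longleftrightarrow>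
    homogeneous_pre_multisymplectic At n \<Upsilon> \<and> conformal_bundle At A F \<Theta> \<tau> \<Upsilon> \<phi>"

definition multisymplectization ::
    "nat \<Rightarrow> ('t::topological_space, 'k::real_normed_vector) atlas \<Rightarrow>
     ('m::topological_space, 'e::real_normed_vector) atlas \<Rightarrow>
     ('f::topological_space, 'g::real_normed_vector) atlas \<Rightarrow>
     ('m, 'e) form_field \<Rightarrow> ('t \<Rightarrow> 'm) \<Rightarrow> ('t, 'k) form_field \<Rightarrow> ('t \<Rightarrow> real) \<Rightarrow> bool"
  where "multisymplectization n At A F \<Theta> \<tau> \<Upsilon> \<phi> \<longleftrightarrow>
    homogeneous_multisymplectic At n \<Upsilon> \<and> conformal_bundle At A F \<Theta> \<tau> \<Upsilon> \<phi>"


section \<open>The conventions for the interior product\<close>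

lemma alt_forms_append:
  assumes "\<alpha> \<in> alt_forms V (p + k)" and "ws \<in> tuples V k"
  shows "(\<lambda>vs. \<alpha> (vs @ ws)) \<in> alt_forms V p"
proof -
  have t: "vs @ ws \<in> tuples V (p + k) \<longleftrightarrow> vs \<in> tuples V p" for vs
    using assms(2) by (auto simp: tuples_def)
  have u: "(vs @ ws)[i := x] = vs[i := x] @ ws" if "vs \<in> tuples V p" "i < p" for vs i x
    using that by (auto simp: tuples_def list_update_append)
  have lin: "\<alpha> (us[i := r *\<^sub>R v + w]) = r * \<alpha> (us[i := v]) + \<alpha> (us[i := w])"
    if "us \<in> tuples V (p + k)" "i < p + k" "v \<in> V" "w \<in> V" for us i r v w
    using assms(1) that unfolding alt_forms_def by blast
  show ?thesis
    unfolding alt_forms_def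
  proof (intro CollectI conjI allI ballI impI)
    fix vs assume "vs \<notin> tuples V p"
    then show "\<alpha> (vs @ ws) = 0" using assms(1) t by (auto simp: alt_forms_def)
  next
    fix vs i v w r assume "vs \<in> tuples V p" "i < p" "v \<in> V" "w \<in> V"
    then show "\<alpha> (vs[i := r *\<^sub>R v + w] @ ws) = r * \<alpha> (vs[i := v] @ ws) + \<alpha> (vs[i := w] @ ws)"
      using lin[of "vs @ ws" i v w r] t u by simp
  next
    fix vs :: "'a list" assume "vs \<in> tuples V p" "\<not> distinct vs"
    then show "\<alpha> (vs @ ws) = 0" using assms(1) t by (auto simp: alt_forms_def)
  qed
qed

lemma contract_wedge:
  assumes "\<alpha> \<in> alt_forms V (p + k)" and "vs \<in> tuples V p" and "ws \<in> tuples V k"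
  shows "contract (wedge V vs) \<alpha> ws = \<alpha> (vs @ ws)"
  using alt_forms_append[OF assms(1,3)] assms(2) by (auto simp: contract_def wedge_def tuples_def)

lemma contract_append:
  assumes "\<alpha> \<in> alt_forms V (p + q + k)"
    and "us \<in> tuples V p" and "vs \<in> tuples V q" and "ws \<in> tuples V k"
  shows "contract (wedge V (us @ vs)) \<alpha> ws = contract (wedge V vs) (contract (wedge V us) \<alpha>) ws"
proof -
  have a: "contract (wedge V us) \<alpha> (xs @ ws) = \<alpha> (us @ xs @ ws)" if "xs \<in> tuples V q" for xs
    using contract_wedge[of \<alpha> V p "q + k" us "xs @ ws"] assms that
    by (auto simp: tuples_def add.assoc)
  have z: "contract (wedge V us) \<alpha> (xs @ ws) = 0 \<and> \<alpha> (us @ xs @ ws) = 0"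
    if "xs \<notin> tuples V q" for xs
  proof -
    have "ys @ xs @ ws \<notin> tuples V (p + q + k)" if "length ys = p" for ys
      using that \<open>xs \<notin> tuples V q\<close> assms(4) by (auto simp: tuples_def)
    then have n: "\<alpha> (ys @ xs @ ws) = 0" if "length ys = p" for ys
      using assms(1) that by (auto simp: alt_forms_def)
    have "(wedge V us) (\<lambda>ys. \<alpha> (ys @ xs @ ws)) = 0"
      using n[of us] assms(2) by (auto simp: wedge_def tuples_def)
    then show ?thesis using n[of us] assms(2) by (auto simp: contract_def tuples_def)
  qed
  have "(\<lambda>xs. \<alpha> (us @ xs @ ws)) = (\<lambda>xs. contract (wedge V us) \<alpha> (xs @ ws))"
    using a z by metis
  then have eq: "contract (wedge V vs) (contract (wedge V us) \<alpha>) ws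
      = wedge V vs (\<lambda>xs. \<alpha> (us @ xs @ ws))"
    by (simp add: contract_def)
  have "(\<lambda>xs. \<alpha> (us @ xs @ ws)) \<in> alt_forms V q"
  proof -
    have t: "us @ xs @ ws \<in> tuples V (p + q + k) \<longleftrightarrow> xs \<in> tuples V q" for xs
      using assms(2,4) by (auto simp: tuples_def)
    have lin: "\<alpha> (zs[i := r *\<^sub>R v + w]) = r * \<alpha> (zs[i := v]) + \<alpha> (zs[i := w])"
      if "zs \<in> tuples V (p + q + k)" "i < p + q + k" "v \<in> V" "w \<in> V" for zs i r v w
      using assms(1) that unfolding alt_forms_def by blast
    have u: "(us @ xs @ ws)[p + i := x] = us @ xs[i := x] @ ws" if "xs \<in> tuples V q" "i < q" for xs i x
      using that assms(2) by (auto simp: tuples_def list_update_append)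
    show ?thesis
      unfolding alt_forms_def
    proof (intro CollectI conjI allI ballI impI)
      fix xs assume "xs \<notin> tuples V q"
      then show "\<alpha> (us @ xs @ ws) = 0" using z by blast
    next
      fix xs i v w r assume "xs \<in> tuples V q" "i < q" "v \<in> V" "w \<in> V"
      then show "\<alpha> (us @ xs[i := r *\<^sub>R v + w] @ ws)
          = r * \<alpha> (us @ xs[i := v] @ ws) + \<alpha> (us @ xs[i := w] @ ws)"
        using lin[of "us @ xs @ ws" "p + i" v w r] t u by simp
    next
      fix xs :: "'a list" assume "xs \<in> tuples V q" "\<not> distinct xs"
      then show "\<alpha> (us @ xs @ ws) = 0" using assms(1) t by (auto simp: alt_forms_def)
    qed
  qed
  moreover have "contract (wedge V (us @ vs)) \<alpha> ws = \<alpha> ((us @ vs) @ ws)"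
    using contract_wedge[of \<alpha> V "p + q" k "us @ vs" ws] assms by (auto simp: tuples_def)
  ultimately show ?thesis
    using eq assms(3) by (simp add: wedge_def tuples_def)
qed

end

theory Submission
  imports Defs
begin

text \<open>
  Why the lift exists and is unique modulo the kernel. Pullback commutes with the exterior derivative,
  so every form \<open>\<alpha>\<close> on \<open>M\<close> satisfies \<open>d(\<phi> \<tau>\<^sup>*\<alpha>) = d\<phi> \<and> \<tau>\<^sup>*\<alpha> + \<phi> \<tau>\<^sup>*d\<alpha>\<close> (\<open>ext_d_scaled_pullback\<close>).
  If \<open>X'\<close> is \<open>\<tau>\<close>-related to \<open>X\<close>, then \<open>\<iota>\<^bsub>X'\<^esub>\<Upsilon> = \<phi> \<tau>\<^sup>*(\<iota>\<^bsub>X\<^esub>\<Theta>)\<close> depends on \<open>X\<close> alone, and \<open>\<L>\<^bsub>X'\<^esub>\<Upsilon> = 0\<close>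
  becomes \<open>\<iota>\<^bsub>X'\<^esub>d\<Upsilon> = (-1)\<^sup>p d(\<phi> \<tau>\<^sup>*(\<iota>\<^bsub>X\<^esub>\<Theta>))\<close> with a right-hand side that does not involve \<open>X'\<close>. Uniqueness is
  immediate. Moreover the two conditions on \<open>X'\<close> involve no derivative of \<open>X'\<close> any more: at each point
  they cut out an affine set of multivectors, so solutions that exist locally can be averaged with a
  partition of unity (\<open>glue_mv_fields\<close>).

  For a local solution, contract \<open>d\<Upsilon> = d\<phi> \<and> \<tau>\<^sup>*\<Theta> + \<phi> \<tau>\<^sup>*d\<Theta>\<close> with the vertical Liouville field
  \<open>\<Delta>\<close>: only \<open>d\<phi>(\<Delta>) \<tau>\<^sup>*\<Theta>\<close> survives and it equals \<open>\<Upsilon>\<close>, so \<open>d\<phi>(\<Delta>) = \<phi>\<close> because \<open>\<Theta>\<close> vanishes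
  nowhere (\<open>liouville_vector\<close>). A bundle chart provides a smooth right inverse \<open>R\<close> of \<open>d\<tau>\<close>, and
  \<open>H w = R w - (d\<phi>(R w)/\<phi>) \<Delta>\<close> is then a right inverse of \<open>d\<tau>\<close> with values in the kernel of \<open>d\<phi>\<close>.
  If \<open>\<L>\<^bsub>X\<^esub>\<Theta> = \<iota>\<^bsub>Q\<^esub>\<Theta>\<close>, the solution is
  \<open>\<Lambda>\<^sup>p H(X) + (-1)\<^sup>p \<Delta> \<and> \<Lambda>\<^sup>p\<^sup>-\<^sup>1 H(Q)\<close>: since \<open>d\<phi>\<close> vanishes on the image of \<open>H\<close>, the first summand contracts \<open>d\<Upsilon>\<close>
  to \<open>(-1)\<^sup>p d\<phi> \<and> \<tau>\<^sup>*(\<iota>\<^bsub>X\<^esub>\<Theta>) + \<phi> \<tau>\<^sup>*(\<iota>\<^bsub>X\<^esub>d\<Theta>)\<close>, the second to \<open>(-1)\<^sup>p \<phi> \<tau>\<^sup>*(\<iota>\<^bsub>Q\<^esub>\<Theta>)\<close>, and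
  \<open>d(\<iota>\<^bsub>X\<^esub>\<Theta>) = (-1)\<^sup>p \<iota>\<^bsub>X\<^esub>d\<Theta> + \<iota>\<^bsub>Q\<^esub>\<Theta>\<close> turns their sum into the required form (\<open>contract_lift\<close>).
\<close>

section \<open>Smooth functions between normed spaces\<close>

lemma Ck_on_cong:
  assumes "open S" "\<And>x. x \<in> S \<Longrightarrow> f x = g x" "Ck_on k S f"
  shows "Ck_on k S g"
  using assms(2,3)
proof (induction k arbitrary: f g)
  case 0
  then show ?case using continuous_on_cong[of S S f g] by simp
next
  case (Suc k)
  have fd: "f differentiable at x" if "x \<in> S" for x using Suc.prems that by simp
  have e: "frechet_derivative f (at x) = frechet_derivative g (at x)" if "x \<in> S" for x
    using frechet_derivative_transform_within_open[OF fd assms(1)] that Suc.prems(1) by blast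
  have d: "g differentiable at x" if "x \<in> S" for x
    using fd[OF that] Suc.prems(1) assms(1) that
    by (meson differentiable_def has_derivative_transform_within_open)
  have "Ck_on k S (\<lambda>x. frechet_derivative g (at x) v)" for v
    by (rule Suc.IH[of "\<lambda>x. frechet_derivative f (at x) v"]) (use e Suc.prems in auto)
  with d show ?case by simp
qed

lemma Ck_on_subset: "Ck_on k S f \<Longrightarrow> T \<subseteq> S \<Longrightarrow> Ck_on k T f"
  by (induction k arbitrary: f) (auto intro: continuous_on_subset)

text \<open>For concrete functions a derivative is found with the usual rules; uniqueness identifies it with
  \<open>frechet_derivative\<close>.\<close>

lemma Ck_on_SucI:
  assumes "open S" "\<And>x. x \<in> S \<Longrightarrow> (f has_derivative f' x) (at x)"
    and "\<And>v. Ck_on k S (\<lambda>x. f' x v)"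
  shows "Ck_on (Suc k) S f"
proof -
  have "Ck_on k S (\<lambda>x. frechet_derivative f (at x) v)" for v
    by (rule Ck_on_cong[OF assms(1) _ assms(3)[of v]])
      (use frechet_derivative_at[OF assms(2)] in auto)
  then show ?thesis using assms(2) by (auto simp: differentiable_def)
qed

lemma Ck_on_SucD:
  assumes "Ck_on (Suc k) S f"
  shows "x \<in> S \<Longrightarrow> (f has_derivative frechet_derivative f (at x)) (at x)"
    and "Ck_on k S (\<lambda>x. frechet_derivative f (at x) v)"
  using assms frechet_derivative_works by auto

lemma Ck_on_continuous:
  assumes "Ck_on k S f"
  shows "continuous_on S f"
proof (cases k)
  case 0
  with assms show ?thesis by simp
next
  case (Suc j)
  then have "f differentiable at x" if "x \<in> S" for x using assms that by simp
  then show ?thesis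
    by (intro differentiable_imp_continuous_on differentiable_at_imp_differentiable_on)
qed

lemma Ck_on_SucD_lower: "Ck_on (Suc k) S f \<Longrightarrow> Ck_on k S f"
proof (induction k arbitrary: f)
  case 0
  show ?case using Ck_on_continuous[OF 0] by simp
next
  case (Suc k)
  then show ?case by (metis Ck_on.simps(2))
qed

lemma Ck_on_local:
  assumes "\<And>x. x \<in> S \<Longrightarrow> \<exists>U. open U \<and> x \<in> U \<and> Ck_on k (U \<inter> S) f"
    and "open S"
  shows "Ck_on k S f"
  using assms(1)
proof (induction k arbitrary: f)
  case 0
  show ?case
  proof (simp, rule continuous_at_imp_continuous_on, rule ballI)
    fix x assume "x \<in> S"
    then obtain U where "open U" "x \<in> U" "continuous_on (U \<inter> S) f" using 0 by force
    then show "continuous (at x) f"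
      using \<open>open S\<close> \<open>x \<in> S\<close> by (simp add: continuous_on_eq_continuous_at open_Int)
  qed
next
  case (Suc k)
  have "f differentiable at x" if "x \<in> S" for x
    using Suc.prems[OF that] that by auto
  moreover have "Ck_on k S (\<lambda>x. frechet_derivative f (at x) v)" for v
    by (rule Suc.IH) (use Suc.prems in fastforce)
  ultimately show ?case by simp
qed

lemma Ck_on_const: "Ck_on k S (\<lambda>x. c)"
  by (induction k arbitrary: c) auto

lemma Ck_on_bounded_linear_compose:
  assumes "open S" "bounded_linear L" "Ck_on k S f"
  shows "Ck_on k S (\<lambda>x. L (f x))"
  using assms(3)
proof (induction k arbitrary: f)
  case 0
  then show ?case using bounded_linear.continuous_on[OF assms(2)] by simp
next
  case (Suc k)
  show ?case
    by (rule Ck_on_SucI[OF assms(1)],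
        rule bounded_linear.has_derivative[OF assms(2) Ck_on_SucD(1)[OF Suc.prems]], assumption,
        rule Suc.IH[OF Ck_on_SucD(2)[OF Suc.prems]])
qed

lemma Ck_on_bounded_linear:
  assumes "bounded_linear L" "open S"
  shows "Ck_on k S L"
proof (cases k)
  case 0
  then show ?thesis using bounded_linear.continuous_on[OF assms(1) continuous_on_id] by simp
next
  case (Suc j)
  then show ?thesis
    using Ck_on_SucI[OF assms(2), of L "\<lambda>x. L"] bounded_linear_imp_has_derivative[OF assms(1)]
      Ck_on_const by blast
qed

lemma Ck_on_add:
  assumes "open S" "Ck_on k S f" "Ck_on k S g"
  shows "Ck_on k S (\<lambda>x. f x + g x)"
  using assms(2,3)
proof (induction k arbitrary: f g)
  case 0
  then show ?case by (simp add: continuous_on_add)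
next
  case (Suc k)
  show ?case
    by (rule Ck_on_SucI[OF assms(1)],
        rule has_derivative_add[OF Ck_on_SucD(1)[OF Suc.prems(1)] Ck_on_SucD(1)[OF Suc.prems(2)]],
        assumption, assumption,
        rule Suc.IH[OF Ck_on_SucD(2)[OF Suc.prems(1)] Ck_on_SucD(2)[OF Suc.prems(2)]])
qed

lemma Ck_on_bilinear:
  assumes "open S" "bounded_bilinear B" "Ck_on k S f" "Ck_on k S g"
  shows "Ck_on k S (\<lambda>x. B (f x) (g x))"
  using assms(3,4)
proof (induction k arbitrary: f g)
  case 0
  then show ?case using bounded_bilinear.continuous_on[OF assms(2)] by simp
next
  case (Suc k)
  show ?case
    by (rule Ck_on_SucI[OF assms(1)],
        rule bounded_bilinear.FDERIV[OF assms(2) Ck_on_SucD(1)[OF Suc.prems(1)] Ck_on_SucD(1)[OF Suc.prems(2)]],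
        assumption, assumption, rule Ck_on_add[OF assms(1)
          Suc.IH[OF Ck_on_SucD_lower[OF Suc.prems(1)] Ck_on_SucD(2)[OF Suc.prems(2)]]
          Suc.IH[OF Ck_on_SucD(2)[OF Suc.prems(1)] Ck_on_SucD_lower[OF Suc.prems(2)]]])
qed

lemma Ck_on_sum:
  assumes "open S" "\<And>i. i \<in> I \<Longrightarrow> Ck_on k S (f i)"
  shows "Ck_on k S (\<lambda>x. \<Sum>i\<in>I. f i x)"
  using assms(2)
  by (induction I rule: infinite_finite_induct) (auto intro: Ck_on_const Ck_on_add[OF assms(1)])

lemma linear_basis_expansion:
  fixes L :: "'a::euclidean_space \<Rightarrow> 'b::real_vector"
  assumes "linear L"
  shows "(\<Sum>e\<in>Basis. (v \<bullet> e) *\<^sub>R L e) = L v"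
proof -
  have "L v = L (\<Sum>e\<in>Basis. (v \<bullet> e) *\<^sub>R e)" by (simp add: euclidean_representation)
  also have "\<dots> = (\<Sum>e\<in>Basis. (v \<bullet> e) *\<^sub>R L e)"
    by (simp add: linear_sum[OF assms] linear_scale[OF assms])
  finally show ?thesis by simp
qed

lemma Ck_on_compose:
  fixes g :: "'b::euclidean_space \<Rightarrow> 'c::real_normed_vector"
  assumes "open S" "open T" "Ck_on k T g" "Ck_on k S f" "f ` S \<subseteq> T"
  shows "Ck_on k S (\<lambda>x. g (f x))"
  using assms(3,4)
proof (induction k arbitrary: g)
  case 0
  then show ?case using continuous_on_compose2[of T g S f] assms(5) by simp
next
  case (Suc k)
  let ?g = "\<lambda>x. frechet_derivative g (at x)" and ?f = "\<lambda>x. frechet_derivative f (at x)"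
  have d: "((\<lambda>x. g (f x)) has_derivative (\<lambda>v. ?g (f x) (?f x v))) (at x)" if "x \<in> S" for x
    using has_derivative_compose[OF Ck_on_SucD(1)[OF Suc.prems(2) that]
        Ck_on_SucD(1)[OF Suc.prems(1)]] that assms(5) by auto
  (* The direction of the outer derivative varies with x, but the induction hypothesis speaks of fixed
     directions; hence the expansion in the basis. *)
  have "Ck_on k S (\<lambda>x. \<Sum>e\<in>Basis. (?f x v \<bullet> e) *\<^sub>R ?g (f x) e)" for v
  proof (rule Ck_on_sum[OF assms(1)])
    fix e :: 'b
    show "Ck_on k S (\<lambda>x. (?f x v \<bullet> e) *\<^sub>R ?g (f x) e)"
      by (rule Ck_on_bilinear[OF assms(1) bounded_bilinear_scaleR
            Ck_on_bounded_linear_compose[OF assms(1) bounded_linear_inner_left Ck_on_SucD(2)[OF Suc.prems(2)]]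
            Suc.IH[OF Ck_on_SucD(2)[OF Suc.prems(1)] Ck_on_SucD_lower[OF Suc.prems(2)]]])
  qed
  then have "Ck_on k S (\<lambda>x. ?g (f x) (?f x v))" for v
  proof (rule Ck_on_cong[OF assms(1), rotated])
    fix x assume "x \<in> S"
    then have "linear (?g (f x))"
      using Suc.prems(1) assms(5) by (intro linear_frechet_derivative) auto
    then show "(\<Sum>e\<in>Basis. (?f x v \<bullet> e) *\<^sub>R ?g (f x) e) = ?g (f x) (?f x v)"
      by (rule linear_basis_expansion)
  qed
  with d show ?case by (rule Ck_on_SucI[OF assms(1)])
qed

lemma Ck_on_inverse:
  fixes f :: "'a::real_normed_vector \<Rightarrow> real"
  assumes "open S" "Ck_on k S f" "\<And>x. x \<in> S \<Longrightarrow> f x \<noteq> 0"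
  shows "Ck_on k S (\<lambda>x. inverse (f x))"
  using assms(2)
proof (induction k)
  case 0
  then show ?case using assms(3) by (auto intro: continuous_on_inverse)
next
  case (Suc k)
  note mult = Ck_on_bilinear[OF assms(1) bounded_bilinear_mult]
  have inv: "Ck_on k S (\<lambda>x. inverse (f x))" by (rule Suc.IH[OF Ck_on_SucD_lower[OF Suc.prems]])
  show ?case
  proof (rule Ck_on_SucI[OF assms(1)])
    show "((\<lambda>x. inverse (f x)) has_derivative
        (\<lambda>h. - (inverse (f x) * frechet_derivative f (at x) h * inverse (f x)))) (at x)"
      if "x \<in> S" for x
      by (rule Deriv.has_derivative_inverse[OF assms(3)[OF that] Ck_on_SucD(1)[OF Suc.prems that]])
    show "Ck_on k S (\<lambda>x. - (inverse (f x) * frechet_derivative f (at x) v * inverse (f x)))" for v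
      by (rule Ck_on_bounded_linear_compose[OF assms(1) bounded_linear_minus[OF bounded_linear_ident]
          mult[OF mult[OF inv Ck_on_SucD(2)[OF Suc.prems]] inv]])
  qed
qed

lemma smooth_on_cong:
  "open S \<Longrightarrow> (\<And>x. x \<in> S \<Longrightarrow> f x = g x) \<Longrightarrow> smooth_on S f \<Longrightarrow> smooth_on S g"
  unfolding smooth_on_def using Ck_on_cong by blast

lemma smooth_on_subset: "smooth_on S f \<Longrightarrow> T \<subseteq> S \<Longrightarrow> smooth_on T f"
  unfolding smooth_on_def using Ck_on_subset by blast

lemma smooth_on_local:
  assumes "open S" "\<And>x. x \<in> S \<Longrightarrow> \<exists>U. open U \<and> x \<in> U \<and> smooth_on (U \<inter> S) f"
  shows "smooth_on S f"
  using assms(2) unfolding smooth_on_def by (intro allI Ck_on_local[OF _ assms(1)]) blast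

lemma smooth_on_continuous: "smooth_on S f \<Longrightarrow> continuous_on S f"
  unfolding smooth_on_def using Ck_on_continuous by blast

lemma smooth_on_const: "smooth_on S (\<lambda>x. c)"
  unfolding smooth_on_def using Ck_on_const by blast

lemma smooth_on_bounded_linear: "open S \<Longrightarrow> bounded_linear L \<Longrightarrow> smooth_on S L"
  unfolding smooth_on_def using Ck_on_bounded_linear by blast

lemma smooth_on_bounded_linear_compose:
  "open S \<Longrightarrow> bounded_linear L \<Longrightarrow> smooth_on S f \<Longrightarrow> smooth_on S (\<lambda>x. L (f x))"
  unfolding smooth_on_def using Ck_on_bounded_linear_compose by blast

lemma smooth_on_add: "open S \<Longrightarrow> smooth_on S f \<Longrightarrow> smooth_on S g \<Longrightarrow> smooth_on S (\<lambda>x. f x + g x)"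
  unfolding smooth_on_def using Ck_on_add by blast

lemma smooth_on_mult:
  fixes f g :: "'a::real_normed_vector \<Rightarrow> real"
  shows "open S \<Longrightarrow> smooth_on S f \<Longrightarrow> smooth_on S g \<Longrightarrow> smooth_on S (\<lambda>x. f x * g x)"
  unfolding smooth_on_def using Ck_on_bilinear[OF _ bounded_bilinear_mult] by blast

lemma smooth_on_scaleR:
  "open S \<Longrightarrow> smooth_on S f \<Longrightarrow> smooth_on S g \<Longrightarrow> smooth_on S (\<lambda>x. f x *\<^sub>R g x)"
  unfolding smooth_on_def using Ck_on_bilinear[OF _ bounded_bilinear_scaleR] by blast

lemma smooth_on_inner:
  "open S \<Longrightarrow> smooth_on S f \<Longrightarrow> smooth_on S g \<Longrightarrow> smooth_on S (\<lambda>x. f x \<bullet> g x)"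
  unfolding smooth_on_def using Ck_on_bilinear[OF _ bounded_bilinear_inner] by blast

lemma smooth_on_diff:
  "open S \<Longrightarrow> smooth_on S f \<Longrightarrow> smooth_on S g \<Longrightarrow> smooth_on S (\<lambda>x. f x - g x)"
  using smooth_on_add[of S f "\<lambda>x. - g x"]
    smooth_on_bounded_linear_compose[OF _ bounded_linear_minus[OF bounded_linear_ident], of S g] by simp

lemma smooth_on_sum:
  "open S \<Longrightarrow> (\<And>i. i \<in> I \<Longrightarrow> smooth_on S (f i)) \<Longrightarrow> smooth_on S (\<lambda>x. \<Sum>i\<in>I. f i x)"
  unfolding smooth_on_def using Ck_on_sum[of S I _ f] by blast

lemma smooth_on_prod:
  fixes f :: "'i \<Rightarrow> 'a::real_normed_vector \<Rightarrow> real"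
  shows "open S \<Longrightarrow> (\<And>i. i \<in> I \<Longrightarrow> smooth_on S (f i)) \<Longrightarrow> smooth_on S (\<lambda>x. \<Prod>i\<in>I. f i x)"
  by (induction I rule: infinite_finite_induct) (auto intro: smooth_on_const smooth_on_mult)

lemma smooth_on_inverse:
  fixes f :: "'a::real_normed_vector \<Rightarrow> real"
  shows "open S \<Longrightarrow> smooth_on S f \<Longrightarrow> (\<And>x. x \<in> S \<Longrightarrow> f x \<noteq> 0) \<Longrightarrow> smooth_on S (\<lambda>x. inverse (f x))"
  unfolding smooth_on_def using Ck_on_inverse by blast

lemma smooth_on_compose:
  fixes g :: "'b::euclidean_space \<Rightarrow> 'c::real_normed_vector"
  shows "open S \<Longrightarrow> open T \<Longrightarrow> smooth_on T g \<Longrightarrow> smooth_on S f \<Longrightarrow> f ` S \<subseteq> T \<Longrightarrow>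
    smooth_on S (\<lambda>x. g (f x))"
  unfolding smooth_on_def using Ck_on_compose by blast

lemma smooth_on_differentiable: "smooth_on S f \<Longrightarrow> x \<in> S \<Longrightarrow> f differentiable at x"
  unfolding smooth_on_def by (metis Ck_on.simps(2))

lemma smooth_on_has_derivative:
  "smooth_on S f \<Longrightarrow> x \<in> S \<Longrightarrow> (f has_derivative frechet_derivative f (at x)) (at x)"
  using smooth_on_differentiable frechet_derivative_works by blast

lemma smooth_on_frechet_derivative:
  "smooth_on S f \<Longrightarrow> smooth_on S (\<lambda>x. frechet_derivative f (at x) v)"
  unfolding smooth_on_def by (metis Ck_on.simps(2))

lemma smooth_on_frechet_derivative_field:
  fixes f :: "'a::euclidean_space \<Rightarrow> 'b::real_normed_vector"
  assumes "open S" "smooth_on S f" "smooth_on S v"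
  shows "smooth_on S (\<lambda>x. frechet_derivative f (at x) (v x))"
proof (rule smooth_on_cong[OF assms(1)])
  show "smooth_on S (\<lambda>x. \<Sum>e\<in>Basis. (v x \<bullet> e) *\<^sub>R frechet_derivative f (at x) e)"
    by (intro smooth_on_sum smooth_on_scaleR smooth_on_inner smooth_on_const
        smooth_on_frechet_derivative assms)
  fix x assume "x \<in> S"
  then have "linear (frechet_derivative f (at x))"
    using assms(2) smooth_on_differentiable linear_frechet_derivative by blast
  then show "(\<Sum>e\<in>Basis. (v x \<bullet> e) *\<^sub>R frechet_derivative f (at x) e) = frechet_derivative f (at x) (v x)"
    by (rule linear_basis_expansion)
qed

lemma smooth_on_components:
  fixes f :: "'a::real_normed_vector \<Rightarrow> 'b::euclidean_space"
  assumes "open S" "\<And>e. e \<in> Basis \<Longrightarrow> smooth_on S (\<lambda>x. f x \<bullet> e)"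
  shows "smooth_on S f"
proof -
  have "smooth_on S (\<lambda>x. \<Sum>e\<in>Basis. (f x \<bullet> e) *\<^sub>R e)"
    by (intro smooth_on_sum smooth_on_scaleR smooth_on_const assms)
  then show ?thesis by (simp add: euclidean_representation)
qed

section \<open>Symmetry of the second derivative\<close>

text \<open>Apply the mean value theorem to the second difference over the parallelogram with sides \<open>s v\<close> and
  \<open>s w\<close>, first in the direction \<open>v\<close>, then in the direction \<open>w\<close>.\<close>

lemma second_difference_mvt:
  fixes f :: "'a::real_normed_vector \<Rightarrow> real"
  assumes "open S" "smooth_on S f" "0 < s"
    and "\<And>a b. 0 \<le> a \<Longrightarrow> a \<le> s \<Longrightarrow> 0 \<le> b \<Longrightarrow> b \<le> s \<Longrightarrow> u + a *\<^sub>R v + b *\<^sub>R w \<in> S"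
  obtains a b where "0 < a" "a < s" "0 < b" "b < s"
    and "f (u + s *\<^sub>R v + s *\<^sub>R w) - f (u + s *\<^sub>R v) - f (u + s *\<^sub>R w) + f u =
      s * s * frechet_derivative (\<lambda>x. frechet_derivative f (at x) v) (at (u + a *\<^sub>R v + b *\<^sub>R w)) w"
proof -
  let ?D = "\<lambda>x. frechet_derivative f (at x)"
  let ?p = "\<lambda>r. f (u + r *\<^sub>R v + s *\<^sub>R w) - f (u + r *\<^sub>R v + 0 *\<^sub>R w)"
  have 1: "((\<lambda>r. f (u + r *\<^sub>R v + c *\<^sub>R w)) has_real_derivative ?D (u + a *\<^sub>R v + c *\<^sub>R w) v) (at a)"
    if "0 \<le> a" "a \<le> s" "0 \<le> c" "c \<le> s" for a c
  proof -
    have mem: "u + a *\<^sub>R v + c *\<^sub>R w \<in> S" using assms(4) that by simp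
    have "(f has_derivative ?D (u + a *\<^sub>R v + c *\<^sub>R w)) (at (u + a *\<^sub>R v + c *\<^sub>R w))"
      using smooth_on_has_derivative[OF assms(2) mem] .
    then
    have "((\<lambda>r. f (u + r *\<^sub>R v + c *\<^sub>R w)) has_derivative (\<lambda>h. ?D (u + a *\<^sub>R v + c *\<^sub>R w) (h *\<^sub>R v))) (at a)"
      by (rule has_derivative_compose[of "\<lambda>r. u + r *\<^sub>R v + c *\<^sub>R w" "\<lambda>h. h *\<^sub>R v" a UNIV f, rotated])
        (auto intro!: derivative_eq_intros)
    moreover have "linear (?D (u + a *\<^sub>R v + c *\<^sub>R w))"
      using smooth_on_differentiable[OF assms(2) mem] linear_frechet_derivative by blast
    ultimately show ?thesis
      by (simp add: has_field_derivative_def linear_scale mult_commute_abs)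
  qed
  have 1: "(?p has_real_derivative ?D (u + a *\<^sub>R v + s *\<^sub>R w) v - ?D (u + a *\<^sub>R v + 0 *\<^sub>R w) v) (at a)"
    if "0 \<le> a" "a \<le> s" for a
    by (rule DERIV_diff[OF 1 1]) (use assms(3) that in auto)
  obtain a where a: "0 < a" "a < s" "?p s - ?p 0 = (s - 0) * (?D (u + a *\<^sub>R v + s *\<^sub>R w) v - ?D (u + a *\<^sub>R v + 0 *\<^sub>R w) v)"
    using MVT2[OF assms(3) 1] by blast
  let ?E = "\<lambda>x. frechet_derivative (\<lambda>x. ?D x v) (at x)"
  have sm: "smooth_on S (\<lambda>x. ?D x v)" using smooth_on_frechet_derivative[OF assms(2)] .
  have 2: "((\<lambda>r. ?D (u + a *\<^sub>R v + r *\<^sub>R w) v) has_real_derivative ?E (u + a *\<^sub>R v + b *\<^sub>R w) w) (at b)"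
    if "0 \<le> b" "b \<le> s" for b
  proof -
    have mem: "u + a *\<^sub>R v + b *\<^sub>R w \<in> S" using assms(4) that a by simp
    have "((\<lambda>x. ?D x v) has_derivative ?E (u + a *\<^sub>R v + b *\<^sub>R w)) (at (u + a *\<^sub>R v + b *\<^sub>R w))"
      using smooth_on_has_derivative[OF sm mem] .
    then
    have "((\<lambda>r. ?D (u + a *\<^sub>R v + r *\<^sub>R w) v) has_derivative (\<lambda>h. ?E (u + a *\<^sub>R v + b *\<^sub>R w) (h *\<^sub>R w))) (at b)"
      by (rule has_derivative_compose[of "\<lambda>r. u + a *\<^sub>R v + r *\<^sub>R w" "\<lambda>h. h *\<^sub>R w" b UNIV "\<lambda>x. ?D x v", rotated])
        (auto intro!: derivative_eq_intros)
    moreover have "linear (?E (u + a *\<^sub>R v + b *\<^sub>R w))"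
      using smooth_on_differentiable[OF sm mem] linear_frechet_derivative by blast
    ultimately show ?thesis
      by (simp add: has_field_derivative_def linear_scale mult_commute_abs)
  qed
  obtain b where b: "0 < b" "b < s" "?D (u + a *\<^sub>R v + s *\<^sub>R w) v - ?D (u + a *\<^sub>R v + 0 *\<^sub>R w) v
     = (s - 0) * ?E (u + a *\<^sub>R v + b *\<^sub>R w) w"
    using MVT2[OF assms(3) 2] by blast
  show ?thesis
    by (rule that[OF a(1,2) b(1,2)]) (use a(3)[unfolded b(3)] in \<open>simp add: algebra_simps\<close>)
qed

text \<open>The second difference is symmetric in \<open>v\<close> and \<open>w\<close>, so both mixed derivatives agree at points
  arbitrarily close to \<open>u\<close>, and they are continuous.\<close>

lemma second_derivative_symmetric_real:
  fixes f :: "'a::real_normed_vector \<Rightarrow> real"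
  assumes "open S" "smooth_on S f" "u \<in> S"
  shows "frechet_derivative (\<lambda>x. frechet_derivative f (at x) v) (at u) w
    = frechet_derivative (\<lambda>x. frechet_derivative f (at x) w) (at u) v"
proof (rule ccontr)
  let ?E = "\<lambda>v w x. frechet_derivative (\<lambda>x. frechet_derivative f (at x) v) (at x) w"
  assume ne: "\<not> ?thesis"
  define \<epsilon> where "\<epsilon> = \<bar>?E v w u - ?E w v u\<bar> / 2"
  have "\<epsilon> > 0" using ne by (simp add: \<epsilon>_def)
  have c: "continuous (at u) (?E v w)" for v w
    using smooth_on_continuous[OF smooth_on_frechet_derivative[OF smooth_on_frechet_derivative[OF assms(2)]]]
      assms(1,3) continuous_on_eq_continuous_at by blast
  have ex: "\<exists>d>0. \<forall>x. dist x u < d \<longrightarrow> \<bar>?E v w x - ?E v w u\<bar> < \<epsilon>" for v w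
    using c[of v w] \<open>\<epsilon> > 0\<close> unfolding continuous_at_eps_delta dist_real_def by blast
  obtain d1 where d1: "d1 > 0" "\<And>x. dist x u < d1 \<Longrightarrow> \<bar>?E v w x - ?E v w u\<bar> < \<epsilon>" using ex by blast
  obtain d2 where d2: "d2 > 0" "\<And>x. dist x u < d2 \<Longrightarrow> \<bar>?E w v x - ?E w v u\<bar> < \<epsilon>" using ex by blast
  obtain d3 where d3: "d3 > 0" "\<And>x. dist x u < d3 \<Longrightarrow> x \<in> S"
    using assms(1,3) by (metis open_dist)
  define d where "d = min d1 (min d2 d3)"
  (* With this s the whole parallelogram stays within distance d of u; the 1 guards against v = w = 0.
     *)
  define s where "s = d / 2 / (1 + norm v + norm w)"
  have "d > 0" using d1 d2 d3 by (simp add: d_def)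
  have n: "1 + norm v + norm w > 0" using norm_ge_zero[of v] norm_ge_zero[of w] by linarith
  have "s > 0" using \<open>d > 0\<close> n by (simp add: s_def)
  have near: "dist (u + a *\<^sub>R v + b *\<^sub>R w) u < d" if "0 \<le> a" "a \<le> s" "0 \<le> b" "b \<le> s" for a b
  proof -
    have "dist (u + a *\<^sub>R v + b *\<^sub>R w) u = norm (a *\<^sub>R v + b *\<^sub>R w)" by (simp add: dist_norm)
    also have "\<dots> \<le> a * norm v + b * norm w" using that norm_triangle_ineq[of "a *\<^sub>R v" "b *\<^sub>R w"] by simp
    also have "\<dots> \<le> s * norm v + s * norm w" using that by (intro add_mono mult_right_mono) auto
    also have "\<dots> \<le> s * (1 + norm v + norm w)" using \<open>s > 0\<close> by (simp add: algebra_simps)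
    also have "\<dots> = d / 2" unfolding s_def using n by (intro nonzero_eq_divide_eq[THEN iffD1]) auto
    also have "\<dots> < d" using \<open>d > 0\<close> by simp
    finally show ?thesis .
  qed
  have nS: "u + a *\<^sub>R v + b *\<^sub>R w \<in> S" if "0 \<le> a" "a \<le> s" "0 \<le> b" "b \<le> s" for a b
    using near[OF that] d3 by (simp add: d_def)
  have nS': "u + a *\<^sub>R w + b *\<^sub>R v \<in> S" if "0 \<le> a" "a \<le> s" "0 \<le> b" "b \<le> s" for a b
    using nS[of b a] that by (simp add: add_ac)
  obtain a b where ab: "0 < a" "a < s" "0 < b" "b < s"
    "f (u + s *\<^sub>R v + s *\<^sub>R w) - f (u + s *\<^sub>R v) - f (u + s *\<^sub>R w) + f u = s * s * ?E v w (u + a *\<^sub>R v + b *\<^sub>R w)"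
    using second_difference_mvt[OF assms(1,2) \<open>s > 0\<close> nS] by blast
  obtain a' b' where ab': "0 < a'" "a' < s" "0 < b'" "b' < s"
    "f (u + s *\<^sub>R w + s *\<^sub>R v) - f (u + s *\<^sub>R w) - f (u + s *\<^sub>R v) + f u = s * s * ?E w v (u + a' *\<^sub>R w + b' *\<^sub>R v)"
    using second_difference_mvt[OF assms(1,2) \<open>s > 0\<close> nS'] by blast
  have "s * s * ?E v w (u + a *\<^sub>R v + b *\<^sub>R w) = s * s * ?E w v (u + a' *\<^sub>R w + b' *\<^sub>R v)"
    unfolding ab(5)[symmetric] ab'(5)[symmetric] by (simp add: algebra_simps)
  then have eq: "?E v w (u + a *\<^sub>R v + b *\<^sub>R w) = ?E w v (u + b' *\<^sub>R v + a' *\<^sub>R w)"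
    using \<open>s > 0\<close> by (simp add: add_ac)
  have "\<bar>?E v w (u + a *\<^sub>R v + b *\<^sub>R w) - ?E v w u\<bar> < \<epsilon>" "\<bar>?E w v (u + b' *\<^sub>R v + a' *\<^sub>R w) - ?E w v u\<bar> < \<epsilon>"
    using d1(2) d2(2) near[of a b] near[of b' a'] ab ab' by (auto simp: d_def)
  then show False using eq unfolding \<epsilon>_def by argo
qed

lemma second_derivative_symmetric:
  fixes f :: "'a::real_normed_vector \<Rightarrow> 'b::euclidean_space"
  assumes "open S" "smooth_on S f" "u \<in> S"
  shows "frechet_derivative (\<lambda>x. frechet_derivative f (at x) v) (at u) w
    = frechet_derivative (\<lambda>x. frechet_derivative f (at x) w) (at u) v"
proof (rule euclidean_eqI)
  fix e :: 'b assume "e \<in> Basis"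
  have bl: "bounded_linear (\<lambda>x::'b. x \<bullet> e)" by (rule bounded_linear_inner_left)
  have c: "frechet_derivative (\<lambda>x. g x \<bullet> e) (at x) h = frechet_derivative g (at x) h \<bullet> e"
    if "smooth_on S g" "x \<in> S" for g :: "'a \<Rightarrow> 'b" and x h
    using frechet_derivative_at[OF bounded_linear.has_derivative[OF bl smooth_on_has_derivative[OF that]]]
    by metis
  have 2: "frechet_derivative (\<lambda>x. frechet_derivative f (at x) v) (at u) w \<bullet> e
      = frechet_derivative (\<lambda>x. frechet_derivative (\<lambda>x. f x \<bullet> e) (at x) v) (at u) w" for v w
  proof -
    have s: "smooth_on S (\<lambda>x. frechet_derivative f (at x) v)" by (rule smooth_on_frechet_derivative[OF assms(2)])
    have "(\<lambda>x. frechet_derivative f (at x) v \<bullet> e) differentiable at u"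
      using smooth_on_differentiable[OF smooth_on_bounded_linear_compose[OF assms(1) bl s] assms(3)] .
    then show ?thesis
      using c[OF s assms(3)] c[OF assms(2)]
        frechet_derivative_transform_within_open[OF _ assms(1,3), of "\<lambda>x. frechet_derivative f (at x) v \<bullet> e"
         "\<lambda>x. frechet_derivative (\<lambda>x. f x \<bullet> e) (at x) v"] by simp
  qed
  show "frechet_derivative (\<lambda>x. frechet_derivative f (at x) v) (at u) w \<bullet> e
    = frechet_derivative (\<lambda>x. frechet_derivative f (at x) w) (at u) v \<bullet> e"
    unfolding 2
    by (rule second_derivative_symmetric_real[OF assms(1) smooth_on_bounded_linear_compose[OF assms(1) bl assms(2)] assms(3)])
qed

section \<open>Alternating forms\<close>

lemma alt_forms_off: "\<alpha> \<in> alt_forms V k \<Longrightarrow> vs \<notin> tuples V k \<Longrightarrow> \<alpha> vs = 0"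
  unfolding alt_forms_def by blast

lemma alt_forms_repeat: "\<alpha> \<in> alt_forms V k \<Longrightarrow> \<not> distinct vs \<Longrightarrow> \<alpha> vs = 0"
  unfolding alt_forms_def by blast

lemma alt_forms_update:
  "\<alpha> \<in> alt_forms V k \<Longrightarrow> vs \<in> tuples V k \<Longrightarrow> i < k \<Longrightarrow> v \<in> V \<Longrightarrow> w \<in> V \<Longrightarrow>
    \<alpha> (vs[i := r *\<^sub>R v + w]) = r * \<alpha> (vs[i := v]) + \<alpha> (vs[i := w])"
  unfolding alt_forms_def by blast

lemma alt_forms_lin:
  assumes "\<alpha> \<in> alt_forms V k" "us @ v # zs \<in> tuples V k" "w \<in> V"
  shows "\<alpha> (us @ (r *\<^sub>R v + w) # zs) = r * \<alpha> (us @ v # zs) + \<alpha> (us @ w # zs)"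
  using alt_forms_update[OF assms(1,2), of "length us" v w r] assms(2,3)
  by (auto simp: tuples_def list_update_append)

lemma alt_forms_add:
  assumes "\<alpha> \<in> alt_forms V k" "us @ v # zs \<in> tuples V k" "w \<in> V"
  shows "\<alpha> (us @ (v + w) # zs) = \<alpha> (us @ v # zs) + \<alpha> (us @ w # zs)"
  using alt_forms_lin[OF assms, of 1] by simp

lemma alt_forms_zero:
  assumes "\<alpha> \<in> alt_forms V k" "0 \<in> V"
  shows "\<alpha> (us @ 0 # zs) = 0"
proof (cases "us @ 0 # zs \<in> tuples V k")
  case True
  then show ?thesis using alt_forms_add[OF assms(1) True assms(2)] by simp
qed (use alt_forms_off assms in blast)



lemma alt_forms_sum:
  assumes "\<alpha> \<in> alt_forms V k" "subspace V" "finite I" "\<And>i. i \<in> I \<Longrightarrow> f i \<in> V"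
    and "set us \<subseteq> V" "set zs \<subseteq> V" "length us + length zs + 1 = k"
  shows "\<alpha> (us @ (\<Sum>i\<in>I. c i *\<^sub>R f i) # zs) = (\<Sum>i\<in>I. c i * \<alpha> (us @ f i # zs))"
  using assms(3,4)
proof (induction I)
  case empty
  show ?case using alt_forms_zero[OF assms(1)] subspace_0[OF assms(2)] by simp
next
  case (insert x F)
  have "(\<Sum>i\<in>F. c i *\<^sub>R f i) \<in> V"
    using insert by (intro subspace_sum[OF assms(2)] subspace_scale[OF assms(2)]) auto
  moreover have "us @ f x # zs \<in> tuples V k" using insert assms by (auto simp: tuples_def)
  ultimately show ?case using insert alt_forms_lin[OF assms(1)] by simp
qed

text \<open>Expand the form on the list in which both entries are \<open>v + w\<close>, where it vanishes.\<close>

lemma alt_forms_swap: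
  assumes "\<alpha> \<in> alt_forms V k" "subspace V" "us @ v # w # zs \<in> tuples V k"
  shows "\<alpha> (us @ v # w # zs) = - \<alpha> (us @ w # v # zs)"
proof -
  have mem: "v \<in> V" "w \<in> V" "v + w \<in> V"
    using assms(3) subspace_add[OF assms(2)] by (auto simp: tuples_def)
  have t: "us @ a # b # zs \<in> tuples V k" if "a \<in> V" "b \<in> V" for a b
    using assms(3) that by (auto simp: tuples_def)
  have 1: "\<alpha> (us @ (v + w) # b # zs) = \<alpha> (us @ v # b # zs) + \<alpha> (us @ w # b # zs)" if "b \<in> V" for b
    using alt_forms_add[OF assms(1) t[OF mem(1) that] mem(2)] .
  have 2: "\<alpha> (us @ a # (v + w) # zs) = \<alpha> (us @ a # v # zs) + \<alpha> (us @ a # w # zs)" if "a \<in> V" for a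
    using alt_forms_add[OF assms(1), of "us @ [a]" v zs w] t[OF that mem(1)] mem(2) by simp
  have 0: "\<alpha> (us @ a # a # zs) = 0" for a
    using alt_forms_repeat[OF assms(1)] by simp
  show ?thesis using 1[OF mem(3)] 2[OF mem(1)] 2[OF mem(2)] 0[of "v + w"] 0[of v] 0[of w] by simp
qed

lemma alt_forms_move:
  assumes "\<alpha> \<in> alt_forms V k" "subspace V" "us @ v # zs \<in> tuples V k"
  shows "\<alpha> (us @ v # zs) = (-1) ^ length us * \<alpha> (v # us @ zs)"
  using assms(3)
proof (induction us arbitrary: zs rule: rev_induct)
  case (snoc x us)
  have "\<alpha> ((us @ [x]) @ v # zs) = - \<alpha> (us @ v # x # zs)"
    using alt_forms_swap[OF assms(1,2), of us x v zs] snoc.prems by simp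
  also have "\<alpha> (us @ v # x # zs) = (-1) ^ length us * \<alpha> (v # us @ x # zs)"
    using snoc by (auto simp: tuples_def)
  finally show ?case by simp
qed simp

lemma alt_forms_Cons:
  assumes "\<alpha> \<in> alt_forms V (Suc k)" "e \<in> V"
  shows "(\<lambda>vs. \<alpha> (e # vs)) \<in> alt_forms V k"
proof -
  have t: "e # vs \<in> tuples V (Suc k) \<longleftrightarrow> vs \<in> tuples V k" for vs
    using assms(2) by (auto simp: tuples_def)
  show ?thesis
    unfolding alt_forms_def
  proof (intro CollectI conjI allI ballI impI)
    fix vs assume "vs \<notin> tuples V k"
    then show "\<alpha> (e # vs) = 0" using alt_forms_off[OF assms(1)] t by blast
  next
    fix vs i v w r assume "vs \<in> tuples V k" "i < k" "v \<in> V" "w \<in> V"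
    then show "\<alpha> (e # vs[i := r *\<^sub>R v + w]) = r * \<alpha> (e # vs[i := v]) + \<alpha> (e # vs[i := w])"
      using alt_forms_update[OF assms(1), of "e # vs" "Suc i" v w r] t by simp
  next
    fix vs :: "'a list" assume "vs \<in> tuples V k" "\<not> distinct vs"
    then show "\<alpha> (e # vs) = 0" using alt_forms_repeat[OF assms(1)] by simp
  qed
qed

lemma sum_fun_apply: "(\<Sum>i\<in>I. f i) x = (\<Sum>i\<in>I. f i x :: 'b::comm_monoid_add)"
  by (induction I rule: infinite_finite_induct) auto

lemma subspace_alt_forms: "subspace (alt_forms V k)"
  unfolding subspace_def alt_forms_def by (auto simp: scaleR_fun_def algebra_simps)

lemma alt_forms_lincomb:
  assumes "\<And>i. i \<in> I \<Longrightarrow> \<alpha> i \<in> alt_forms V k"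
  shows "(\<lambda>vs. \<Sum>i\<in>I. c i * \<alpha> i vs) \<in> alt_forms V k"
proof -
  have "(\<Sum>i\<in>I. c i *\<^sub>R \<alpha> i) \<in> alt_forms V k"
    by (intro subspace_sum subspace_scale subspace_alt_forms assms)
  also have "(\<Sum>i\<in>I. c i *\<^sub>R \<alpha> i) = (\<lambda>vs. \<Sum>i\<in>I. c i * \<alpha> i vs)"
    by (simp add: fun_eq_iff sum_fun_apply scaleR_fun_def)
  finally show ?thesis .
qed

lemma alt_forms_cmult: "\<alpha> \<in> alt_forms V k \<Longrightarrow> (\<lambda>vs. c * \<alpha> vs) \<in> alt_forms V k"
  using alt_forms_lincomb[of "{()}" "\<lambda>_. \<alpha>" V k "\<lambda>_. c"] by simp

lemma alt_forms_eqI: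
  assumes "\<alpha> \<in> alt_forms V k" "\<beta> \<in> alt_forms V k" "\<And>vs. vs \<in> tuples V k \<Longrightarrow> \<alpha> vs = \<beta> vs"
  shows "\<alpha> = \<beta>"
  using assms alt_forms_off by (metis ext)

section \<open>Alternating sums over the removal of one entry\<close>

definition remove_nth :: "nat \<Rightarrow> 'a list \<Rightarrow> 'a list"
  where "remove_nth i vs = take i vs @ drop (Suc i) vs"

text \<open>The increasing enumeration of the indices different from \<open>i\<close>: entry \<open>j\<close> of \<open>remove_nth i vs\<close> is
  entry \<open>skip i j\<close> of \<open>vs\<close>.\<close>

definition skip :: "nat \<Rightarrow> nat \<Rightarrow> nat"
  where "skip i j = (if j < i then j else Suc j)"

lemma length_remove_nth [simp]: "i < length vs \<Longrightarrow> length (remove_nth i vs) = length vs - 1"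
  by (auto simp: remove_nth_def)

lemma set_remove_nth: "set (remove_nth i vs) \<subseteq> set vs"
  using set_take_subset[of i vs] set_drop_subset[of "Suc i" vs] by (auto simp: remove_nth_def)

lemma remove_nth_tuples: "vs \<in> tuples V (Suc k) \<Longrightarrow> i < Suc k \<Longrightarrow> remove_nth i vs \<in> tuples V k"
  using set_remove_nth[of i vs] by (auto simp: tuples_def)

lemma nth_remove_nth:
  "j < length vs - 1 \<Longrightarrow> remove_nth i vs ! j = vs ! skip i j"
  by (auto simp: remove_nth_def skip_def nth_append min_def)

lemma map_remove_nth: "map f (remove_nth i vs) = remove_nth i (map f vs)"
  by (simp add: remove_nth_def take_map drop_map)

lemma remove_nth_update_same: "remove_nth i (vs[i := x]) = remove_nth i vs"
  by (simp add: remove_nth_def)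

lemma remove_nth_update:
  assumes "i < length vs" "j < length vs - 1"
  shows "remove_nth i (vs[skip i j := x]) = (remove_nth i vs)[j := x]"
proof (rule nth_equalityI)
  show "length (remove_nth i (vs[skip i j := x])) = length ((remove_nth i vs)[j := x])"
    using assms by simp
  fix l assume "l < length (remove_nth i (vs[skip i j := x]))"
  then show "remove_nth i (vs[skip i j := x]) ! l = (remove_nth i vs)[j := x] ! l"
    using assms by (auto simp: nth_remove_nth nth_list_update skip_def split: if_splits)
qed

lemma bij_betw_skip: "i < Suc k \<Longrightarrow> bij_betw (skip i) {..<k} ({..<Suc k} - {i})"
proof (rule bij_betw_byWitness[where f' = "\<lambda>l. if l < i then l else l - 1"])
qed (auto simp: skip_def split: if_splits)

lemma skip_cases:
  assumes "l \<noteq> i" "l < Suc k" "i < Suc k"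
  shows "\<exists>j<k. l = skip i j"
  using bij_betw_imp_surj_on[OF bij_betw_skip[OF assms(3)]] assms by blast

text \<open>For \<open>g v = a v \<cdot> \<alpha>\<close> with a linear form \<open>a\<close> this is \<open>a \<and> \<alpha>\<close>; for \<open>g v = \<partial>\<^sub>v \<alpha>\<close> it is \<open>d\<alpha>\<close>.\<close>

definition altsum :: "('v \<Rightarrow> 'v list \<Rightarrow> real) \<Rightarrow> 'v list \<Rightarrow> real"
  where "altsum g vs = (\<Sum>i<length vs. (-1) ^ i * g (vs ! i) (remove_nth i vs))"

lemma split_two_positions:
  assumes "a < b" "b < length vs"
  shows "\<exists>us ms zs. vs = us @ vs ! a # ms @ vs ! b # zs \<and> length us = a \<and> b = a + length ms + 1"
proof (intro exI conjI)
  let ?ms = "take (b - a - 1) (drop (Suc a) vs)"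
  show "vs = take a vs @ vs ! a # ?ms @ vs ! b # drop (Suc b) vs"
    using assms id_take_nth_drop[of a vs] id_take_nth_drop[of "b - a - 1" "drop (Suc a) vs"] by simp
  show "length (take a vs) = a" "b = a + length ?ms + 1" using assms by auto
qed

text \<open>The cancellation behind both \<open>d\<alpha>\<close> being alternating and the naturality of \<open>d\<close>: of the lists that
  arise from \<open>us @ x # ms @ y # zs\<close> by dropping one of \<open>x\<close>, \<open>y\<close> and putting \<open>s\<close> for the other, one
  is turned into the other by moving \<open>s\<close> past \<open>ms\<close>, and the positional signs differ by one more
  factor \<open>-1\<close>.\<close>

lemma alt_forms_move_two:
  assumes "\<alpha> \<in> alt_forms V k" "subspace V" "set us \<subseteq> V" "set ms \<subseteq> V" "set zs \<subseteq> V" "s \<in> V"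
    and "k = Suc (length us + length ms + length zs)"
  shows "(-1) ^ length us * \<alpha> (us @ ms @ s # zs) + (-1) ^ (length us + length ms + 1) * \<alpha> (us @ s # ms @ zs) = 0"
proof -
  have "\<alpha> ((us @ ms) @ s # zs) = (-1) ^ length (us @ ms) * \<alpha> (s # (us @ ms) @ zs)"
    by (rule alt_forms_move[OF assms(1,2)]) (use assms in \<open>auto simp: tuples_def\<close>)
  moreover have "\<alpha> (us @ s # ms @ zs) = (-1) ^ length us * \<alpha> (s # us @ ms @ zs)"
    by (rule alt_forms_move[OF assms(1,2)]) (use assms in \<open>auto simp: tuples_def\<close>)
  ultimately show ?thesis by (simp add: power_add)
qed

lemma altsum_alt_forms:
  assumes "subspace V" "\<And>v. v \<in> V \<Longrightarrow> g v \<in> alt_forms V k"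
    and "\<And>v w r us. v \<in> V \<Longrightarrow> w \<in> V \<Longrightarrow> us \<in> tuples V k \<Longrightarrow> g (r *\<^sub>R v + w) us = r * g v us + g w us"
  shows "(\<lambda>vs. if vs \<in> tuples V (Suc k) then altsum g vs else 0) \<in> alt_forms V (Suc k)"
  unfolding alt_forms_def
proof (intro CollectI conjI allI ballI impI)
  fix vs l v w r assume vs: "vs \<in> tuples V (Suc k)" and l: "l < Suc k" and v: "v \<in> V" and w: "w \<in> V"
  have len: "length vs = Suc k" and sub: "set vs \<subseteq> V" using vs by (auto simp: tuples_def)
  have u: "r *\<^sub>R v + w \<in> V" using v w assms(1) by (simp add: subspace_add subspace_scale)
  have mem: "vs[l := x] \<in> tuples V (Suc k)" if "x \<in> V" for x
    using that sub len set_update_subset_insert[of vs l x] by (auto simp: tuples_def)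
  have "g (vs[l := r *\<^sub>R v + w] ! i) (remove_nth i (vs[l := r *\<^sub>R v + w])) =
      r * g (vs[l := v] ! i) (remove_nth i (vs[l := v])) + g (vs[l := w] ! i) (remove_nth i (vs[l := w]))"
    if i: "i < Suc k" for i
  proof (cases "i = l")
    case True
    then show ?thesis
      using assms(3)[OF v w remove_nth_tuples[OF vs l]] l len by (simp add: remove_nth_update_same)
  next
    case False
    then obtain j where j: "j < k" "l = skip i j" using skip_cases[of l i k] l i by blast
    have "vs ! i \<in> V" using sub len i by auto
    from alt_forms_update[OF assms(2)[OF this] remove_nth_tuples[OF vs i] j(1) v w]
    show ?thesis using False remove_nth_update[of i vs j] i j len by simp
  qed
  then have "altsum g (vs[l := r *\<^sub>R v + w]) = r * altsum g (vs[l := v]) + altsum g (vs[l := w])"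
    by (simp add: altsum_def len sum_distrib_left sum.distrib[symmetric] algebra_simps)
  then show "(if vs[l := r *\<^sub>R v + w] \<in> tuples V (Suc k) then altsum g (vs[l := r *\<^sub>R v + w]) else 0) =
     r * (if vs[l := v] \<in> tuples V (Suc k) then altsum g (vs[l := v]) else 0) +
     (if vs[l := w] \<in> tuples V (Suc k) then altsum g (vs[l := w]) else 0)"
    using mem u v w by simp
next
  fix vs :: "'a list" assume vs: "vs \<in> tuples V (Suc k)" and "\<not> distinct vs"
  then obtain a b where "a \<noteq> b" "a < length vs" "b < length vs" "vs ! a = vs ! b"
    by (auto simp: distinct_conv_nth)
  then have "\<exists>a b. a < b \<and> b < length vs \<and> vs ! a = vs ! b"
    by (metis linorder_neqE_nat)
  then obtain a b where ab: "a < b" "b < length vs" "vs ! a = vs ! b" by blast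
  have len: "length vs = Suc k" and sub: "set vs \<subseteq> V" using vs by (auto simp: tuples_def)
  let ?t = "\<lambda>i. (-1) ^ i * g (vs ! i) (remove_nth i vs)"
  (* Removing any entry other than the two equal ones leaves a repetition. *)
  have z: "?t i = 0" if i: "i < Suc k" "i \<noteq> a" "i \<noteq> b" for i
  proof -
    have "a < Suc k" "b < Suc k" using ab len by auto
    then obtain a' b' where a': "a' < k" "a = skip i a'" and b': "b' < k" "b = skip i b'"
      using skip_cases[of a i k] skip_cases[of b i k] i by blast
    have "remove_nth i vs ! a' = remove_nth i vs ! b'" "a' \<noteq> b'"
      using nth_remove_nth[of _ vs i] a' b' ab len by auto
    then have "\<not> distinct (remove_nth i vs)"
      using a' b' i len nth_eq_iff_index_eq[of "remove_nth i vs" a' b'] by auto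
    moreover have "vs ! i \<in> V" using sub len i by auto
    ultimately show ?thesis using alt_forms_repeat[OF assms(2)] by simp
  qed
  obtain us ms zs where s: "vs = us @ vs ! a # ms @ vs ! b # zs" "length us = a" "b = a + length ms + 1"
    using split_two_positions[OF ab(1,2)] by blast
  define x where "x = vs ! a"
  have s': "vs = us @ x # ms @ x # zs" using s(1) ab(3) x_def by simp
  have ra: "remove_nth a vs = us @ ms @ x # zs" using s(2) by (subst s') (simp add: remove_nth_def)
  have rb: "remove_nth b vs = us @ x # ms @ zs" using s(2,3) by (subst s') (simp add: remove_nth_def)
  have memV: "set us \<subseteq> V" "set ms \<subseteq> V" "set zs \<subseteq> V" "x \<in> V" using sub s' by auto
  have "length vs = Suc (Suc (length us + length ms + length zs))" by (subst s') simp
  then have "?t a + ?t b = 0"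
    using alt_forms_move_two[OF assms(2)[OF memV(4)] assms(1) memV] len ra rb s x_def ab(3) by simp
  moreover have "altsum g vs = (\<Sum>i\<in>{a, b}. ?t i)"
    unfolding altsum_def len
    by (rule sum.mono_neutral_right) (use z ab len in auto)
  ultimately show "(if vs \<in> tuples V (Suc k) then altsum g vs else 0) = 0"
    using ab(1) by simp
qed auto

text \<open>The second derivatives of a map enter the exterior derivative of a pullback in this form. The term
  for \<open>(i, l)\<close>, with entry \<open>i\<close> removed and entry \<open>l\<close> replaced, cancels the term for \<open>(l, i)\<close>, since
  \<open>S\<close> is symmetric.\<close>

lemma altsum_symmetric_cancel:
  assumes "subspace V" "\<beta> \<in> alt_forms V k" "ls \<in> tuples V (Suc k)"
    and "\<And>i j. i < Suc k \<Longrightarrow> j < Suc k \<Longrightarrow> S i j \<in> V \<and> S i j = S j i"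
  shows "(\<Sum>i<Suc k. (-1) ^ i * (\<Sum>j<k. \<beta> ((remove_nth i ls)[j := S i (skip i j)]))) = (0::real)"
proof -
  define T where "T i l = (-1) ^ i * \<beta> (remove_nth i (ls[l := S i l]))" for i l
  have len: "length ls = Suc k" and sub: "set ls \<subseteq> V" using assms(3) by (auto simp: tuples_def)
  have anti: "T a b + T b a = 0" if ab: "a < b" "b < Suc k" for a b
  proof -
    obtain us ms zs where s: "ls = us @ ls ! a # ms @ ls ! b # zs" "length us = a" "b = a + length ms + 1"
      using split_two_positions[of a b ls, unfolded len, OF ab] by blast
    let ?x = "S a b"
    have x: "?x \<in> V" "S b a = ?x" using assms(4) ab by auto
    have ra: "remove_nth a (ls[b := ?x]) = us @ ms @ ?x # zs"
      using s(2,3) by (subst s(1)) (simp add: remove_nth_def list_update_append)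
    have rb: "remove_nth b (ls[a := ?x]) = us @ ?x # ms @ zs"
      using s(2,3) by (subst s(1)) (simp add: remove_nth_def list_update_append)
    have "length ls = Suc (Suc (length us + length ms + length zs))" by (subst s(1)) simp
    then have k: "k = Suc (length us + length ms + length zs)" using len by simp
    have "set us \<subseteq> V" "set ms \<subseteq> V" "set zs \<subseteq> V"
      using sub s(1) by (metis Un_subset_iff set_append set_simps(2) insert_subset)+
    from alt_forms_move_two[OF assms(2,1) this x(1) k]
    show ?thesis unfolding T_def x(2) ra rb using s(2,3) by simp
  qed
  then have anti: "T a b + T b a = 0" if "a \<noteq> b" "a < Suc k" "b < Suc k" for a b
    using that by (metis add.commute linorder_neqE_nat)
  have "(\<Sum>i<Suc k. (-1) ^ i * (\<Sum>j<k. \<beta> ((remove_nth i ls)[j := S i (skip i j)])))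
      = (\<Sum>i<Suc k. \<Sum>j<k. T i (skip i j))"
    unfolding T_def sum_distrib_left
    by (intro sum.cong refl) (use remove_nth_update[of _ ls] len in auto)
  also have "\<dots> = (\<Sum>i<Suc k. \<Sum>l\<in>{..<Suc k} - {i}. T i l)"
    by (intro sum.cong refl sum.reindex_bij_betw bij_betw_skip) auto
  also have "\<dots> = (\<Sum>i<Suc k. \<Sum>l<Suc k. if l = i then 0 else T i l)"
    by (intro sum.cong refl sum.mono_neutral_cong_left) auto
  finally have 1: "(\<Sum>i<Suc k. (-1) ^ i * (\<Sum>j<k. \<beta> ((remove_nth i ls)[j := S i (skip i j)])))
      = (\<Sum>i<Suc k. \<Sum>l<Suc k. if l = i then 0 else T i l)" (is "?L = ?R") .
  (* The double sum is invariant under exchanging i and l, yet changes sign: it is its own negative. *)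
  have 2: "?R = (\<Sum>i<Suc k. \<Sum>l<Suc k. if l = i then 0 else T l i)"
    by (subst sum.swap) (intro sum.cong refl, auto)
  have "?R + ?R = ?R + (\<Sum>i<Suc k. \<Sum>l<Suc k. if l = i then 0 else T l i)"
    using 2 by simp
  also have "\<dots> = (\<Sum>i<Suc k. \<Sum>l<Suc k. (if l = i then 0 else T i l) + (if l = i then 0 else T l i))"
    by (simp only: sum.distrib)
  also have "\<dots> = 0" by (intro sum.neutral ballI) (use anti in auto)
  finally show ?thesis using 1 by simp
qed

section \<open>A finite spanning family of alternating forms\<close>

text \<open>Moving the entry \<open>i\<close> to the front costs the sign \<open>(-1)\<^sup>i\<close>, so all \<open>k + 1\<close> summands agree.\<close>

lemma alt_forms_altsum_self:
  assumes "subspace V" "\<beta> \<in> alt_forms V (Suc k)" "vs \<in> tuples V (Suc k)"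
  shows "altsum (\<lambda>v ws. \<beta> (v # ws)) vs = real (Suc k) * \<beta> vs"
proof -
  have len: "length vs = Suc k" using assms(3) by (auto simp: tuples_def)
  have "(-1) ^ i * \<beta> (vs ! i # remove_nth i vs) = \<beta> vs" if "i < Suc k" for i
  proof -
    have d: "take i vs @ vs ! i # drop (Suc i) vs = vs" using that len by (simp add: id_take_nth_drop[symmetric])
    have "\<beta> (take i vs @ vs ! i # drop (Suc i) vs) = (-1) ^ length (take i vs) * \<beta> (vs ! i # take i vs @ drop (Suc i) vs)"
      by (rule alt_forms_move[OF assms(2,1)]) (use assms(3) d in simp)
    then show ?thesis using d that len by (simp add: remove_nth_def)
  qed
  then show ?thesis by (simp add: altsum_def len)
qed

text \<open>The forms \<open>\<epsilon> i\<close> are multiples of wedge products of dual basis vectors, found by induction from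
  \<open>(p + 1) \<beta> = \<Sum>\<^sub>e e\<^sup>* \<and> \<iota>\<^sub>e\<beta>\<close>. The coefficients are values of \<open>\<beta>\<close>, hence they depend smoothly on any
  parameter on which \<open>\<beta>\<close> depends smoothly.\<close>

lemma alt_forms_finite_expansion:
  "\<exists>I \<epsilon>. finite I \<and> (\<forall>i\<in>I. \<epsilon> i \<in> alt_forms (UNIV :: 'v::euclidean_space set) p) \<and>
     (\<forall>\<beta>\<in>alt_forms UNIV p. \<beta> = (\<lambda>vs. \<Sum>i\<in>I. \<beta> i * \<epsilon> i vs))"
proof (induction p)
  case 0
  let ?\<epsilon> = "\<lambda>_ vs. if vs = [] then 1 else (0::real)"
  have "?\<epsilon> [] \<in> alt_forms (UNIV :: 'v set) 0" by (auto simp: alt_forms_def tuples_def)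
  moreover have "\<beta> = (\<lambda>vs. \<Sum>i\<in>{[]}. \<beta> i * ?\<epsilon> i vs)" if "\<beta> \<in> alt_forms (UNIV :: 'v set) 0" for \<beta>
    using alt_forms_off[OF that] by (auto simp: tuples_def fun_eq_iff)
  ultimately show ?case by (intro exI[of _ "{[]}"] exI[of _ ?\<epsilon>]) blast
next
  case (Suc p)
  then obtain I :: "'v list set" and \<epsilon> where fin: "finite I" and \<epsilon>: "\<And>i. i \<in> I \<Longrightarrow> \<epsilon> i \<in> alt_forms (UNIV :: 'v set) p"
    and ex: "\<And>\<beta>. \<beta> \<in> alt_forms UNIV p \<Longrightarrow> \<beta> = (\<lambda>vs. \<Sum>i\<in>I. \<beta> i * \<epsilon> i vs)" by blast
  let ?J = "(\<lambda>(e, i). e # i) ` ((Basis :: 'v set) \<times> I)"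
  let ?g = "\<lambda>e i v ws. (v \<bullet> e) * \<epsilon> i ws"
  define \<delta> where "\<delta> j = (\<lambda>vs. (1 / real (Suc p)) * (if vs \<in> tuples UNIV (Suc p) then altsum (?g (hd j) (tl j)) vs else 0))" for j
  have "finite ?J" using fin by simp
  moreover have "\<delta> j \<in> alt_forms UNIV (Suc p)" if "j \<in> ?J" for j
  proof -
    have "tl j \<in> I" using that by auto
    then have "(\<lambda>vs. if vs \<in> tuples UNIV (Suc p) then altsum (?g (hd j) (tl j)) vs else 0) \<in> alt_forms UNIV (Suc p)"
      using \<epsilon> by (intro altsum_alt_forms alt_forms_cmult) (auto simp: algebra_simps inner_add_left)
    from alt_forms_cmult[OF this] show ?thesis unfolding \<delta>_def .
  qed
  moreover have "\<beta> = (\<lambda>vs. \<Sum>j\<in>?J. \<beta> j * \<delta> j vs)" if \<beta>: "\<beta> \<in> alt_forms UNIV (Suc p)" for \<beta>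
  proof
    fix vs :: "'v list"
    show "\<beta> vs = (\<Sum>j\<in>?J. \<beta> j * \<delta> j vs)"
    proof (cases "vs \<in> tuples UNIV (Suc p)")
      case False
      then show ?thesis using alt_forms_off[OF \<beta>] by (simp add: \<delta>_def)
    next
      case True
      have len: "length vs = Suc p" using True by (auto simp: tuples_def)
      have exp: "\<beta> (v # ws) = (\<Sum>e\<in>Basis. \<Sum>i\<in>I. \<beta> (e # i) * ?g e i v ws)"
        if "ws \<in> tuples UNIV p" for v ws
      proof -
        have "\<beta> ([] @ (\<Sum>e\<in>Basis. (v \<bullet> e) *\<^sub>R e) # ws) = (\<Sum>e\<in>Basis. (v \<bullet> e) * \<beta> ([] @ e # ws))"
          by (rule alt_forms_sum[OF \<beta>]) (use that in \<open>auto simp: tuples_def\<close>)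
        moreover have "\<beta> (e # ws) = (\<Sum>i\<in>I. \<beta> (e # i) * \<epsilon> i ws)" for e
          using fun_cong[OF ex[OF alt_forms_Cons[OF \<beta> UNIV_I]], of e ws] .
        ultimately show ?thesis
          by (simp add: euclidean_representation sum_distrib_left algebra_simps)
      qed
      have "real (Suc p) * \<beta> vs = altsum (\<lambda>v ws. \<beta> (v # ws)) vs"
        using alt_forms_altsum_self[OF subspace_UNIV \<beta> True] by simp
      also have "\<dots> = (\<Sum>l<Suc p. (-1) ^ l * (\<Sum>e\<in>Basis. \<Sum>i\<in>I. \<beta> (e # i) * ?g e i (vs ! l) (remove_nth l vs)))"
        unfolding altsum_def len
        by (intro sum.cong refl) (use exp remove_nth_tuples[OF True] in auto)
      also have "\<dots> = (\<Sum>e\<in>Basis. \<Sum>i\<in>I. \<beta> (e # i) * altsum (?g e i) vs)"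
        unfolding altsum_def len sum_distrib_left
        by (subst sum.swap, intro sum.cong refl, subst sum.swap) (simp add: algebra_simps)
      also have "\<dots> = (\<Sum>(e, i)\<in>Basis \<times> I. \<beta> (e # i) * altsum (?g e i) vs)"
        by (rule sum.cartesian_product)
      also have "\<dots> = real (Suc p) * (\<Sum>(e, i)\<in>Basis \<times> I. \<beta> (e # i) * \<delta> (e # i) vs)"
        unfolding sum_distrib_left by (intro sum.cong refl) (use True in \<open>auto simp: \<delta>_def\<close>)
      also have "(\<Sum>(e, i)\<in>Basis \<times> I. \<beta> (e # i) * \<delta> (e # i) vs) = (\<Sum>j\<in>?J. \<beta> j * \<delta> j vs)"
        by (subst sum.reindex) (auto simp: inj_on_def case_prod_beta intro!: sum.cong)
      finally show ?thesis by simp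
    qed
  qed
  ultimately show ?case by blast
qed

section \<open>Multivectors as linear functionals\<close>

lemma ext_power_induct [consumes 1, case_names wedge lincomb zero]:
  assumes "U \<in> ext_power V p"
    and "\<And>vs. vs \<in> tuples V p \<Longrightarrow> P (wedge V vs)"
    and "\<And>r U U'. P U \<Longrightarrow> P U' \<Longrightarrow> P (r *\<^sub>R U + U')" "P 0"
  shows "P U"
proof -
  have "subspace (Collect P)"
    unfolding subspace_def using assms(3)[of _ _ 1] assms(3)[OF _ assms(4)] assms(4) by simp
  then show ?thesis
    using assms(1,2) span_minimal[of "wedge V ` tuples V p" "Collect P"] unfolding ext_power_def by auto
qed

lemma subspace_lincomb: "subspace S \<Longrightarrow> x \<in> S \<Longrightarrow> y \<in> S \<Longrightarrow> r *\<^sub>R x + y \<in> S"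
  by (simp only: subspace_add subspace_scale)

lemma subspace_ext_power: "subspace (ext_power V p)"
  by (simp add: ext_power_def)

lemma wedge_in_ext_power: "vs \<in> tuples V p \<Longrightarrow> wedge V vs \<in> ext_power V p"
  unfolding ext_power_def by (intro span_base) auto

lemma multivec_off:
  assumes "U \<in> ext_power V p" "\<alpha> \<notin> alt_forms V p"
  shows "U \<alpha> = 0"
  using assms(1)
proof (induction rule: ext_power_induct)
  case (wedge vs)
  then show ?case using assms(2) by (auto simp: wedge_def tuples_def)
qed (auto simp: scaleR_fun_def)

lemma multivec_lincomb:
  assumes "U \<in> ext_power V p" "\<And>i. i \<in> I \<Longrightarrow> \<alpha> i \<in> alt_forms V p"
  shows "U (\<lambda>vs. \<Sum>i\<in>I. c i * \<alpha> i vs) = (\<Sum>i\<in>I. c i * U (\<alpha> i))"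
  using assms(1)
proof (induction rule: ext_power_induct)
  case (wedge vs)
  have "(\<lambda>vs. \<Sum>i\<in>I. c i * \<alpha> i vs) \<in> alt_forms V p" by (rule alt_forms_lincomb[OF assms(2)])
  then show ?case using assms(2) wedge by (simp add: wedge_def tuples_def)
qed (auto simp: scaleR_fun_def sum.distrib sum_distrib_left algebra_simps)

lemma multivec_cmult:
  assumes "U \<in> ext_power V p" "\<alpha> \<in> alt_forms V p"
  shows "U (\<lambda>vs. c * \<alpha> vs) = c * U \<alpha>"
  using multivec_lincomb[OF assms(1), of "{()}" "\<lambda>_. \<alpha>" "\<lambda>_. c"] assms(2) by simp

lemma multivec_add:
  assumes "U \<in> ext_power V p" "\<alpha> \<in> alt_forms V p" "\<beta> \<in> alt_forms V p"
  shows "U (\<lambda>vs. \<alpha> vs + \<beta> vs) = U \<alpha> + U \<beta>"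
  using multivec_lincomb[OF assms(1), of UNIV "\<lambda>b. if b then \<alpha> else \<beta>" "\<lambda>_. 1"] assms(2,3)
  by (simp add: UNIV_bool add.commute)

lemma multivec_zero: "U \<in> ext_power V p \<Longrightarrow> U (\<lambda>_. 0) = 0"
  using multivec_lincomb[of U V p "{}"] by simp

text \<open>Linearity is demanded on \<open>V\<close> only, because differentials of maps are meaningful only on tangent
  spaces, which are subspaces of a function space.\<close>

definition linear_between :: "'v::real_vector set \<Rightarrow> 'w::real_vector set \<Rightarrow> ('v \<Rightarrow> 'w) \<Rightarrow> bool"
  where "linear_between V W L \<longleftrightarrow> L ` V \<subseteq> W \<and> (\<forall>v\<in>V. \<forall>w\<in>V. \<forall>r. L (r *\<^sub>R v + w) = r *\<^sub>R L v + L w)"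

lemma linear_between_mem: "linear_between V W L \<Longrightarrow> v \<in> V \<Longrightarrow> L v \<in> W"
  by (auto simp: linear_between_def)

lemma linear_between_tuples: "linear_between V W L \<Longrightarrow> vs \<in> tuples V k \<Longrightarrow> map L vs \<in> tuples W k"
  by (fastforce simp: linear_between_def tuples_def)

lemma pull_form_alt_forms:
  assumes "linear_between V W L" "\<beta> \<in> alt_forms W k" "subspace V"
  shows "pull_form V L \<beta> \<in> alt_forms V k"
  unfolding alt_forms_def
proof (intro CollectI conjI allI ballI impI)
  fix vs assume "vs \<notin> tuples V k"
  then show "pull_form V L \<beta> vs = 0"
    using alt_forms_off[OF assms(2), of "map L vs"] by (auto simp: pull_form_def tuples_def)
next
  fix vs i v w r assume h: "vs \<in> tuples V k" "i < k" "v \<in> V" "w \<in> V"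
  have s: "set (vs[i := x]) \<subseteq> V" if "x \<in> V" for x
    using h that set_update_subset_insert[of vs i x] by (auto simp: tuples_def)
  have u: "r *\<^sub>R v + w \<in> V" using h assms(3) by (simp add: subspace_add subspace_scale)
  have "L (r *\<^sub>R v + w) = r *\<^sub>R L v + L w" using assms(1) h by (auto simp: linear_between_def)
  then show "pull_form V L \<beta> (vs[i := r *\<^sub>R v + w]) = r * pull_form V L \<beta> (vs[i := v]) + pull_form V L \<beta> (vs[i := w])"
    using s u h alt_forms_update[OF assms(2) linear_between_tuples[OF assms(1) h(1)] h(2)
        linear_between_mem[OF assms(1) h(3)] linear_between_mem[OF assms(1) h(4)], of r]
    by (simp add: pull_form_def map_update)
next
  fix vs :: "'a list" assume "vs \<in> tuples V k" "\<not> distinct vs"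
  then show "pull_form V L \<beta> vs = 0"
    using alt_forms_repeat[OF assms(2), of "map L vs"] by (auto simp: pull_form_def distinct_map)
qed



lemma ext_map_lincomb: "ext_map V W p L (r *\<^sub>R U + U') = r *\<^sub>R ext_map V W p L U + ext_map V W p L U'"
  by (auto simp: ext_map_def scaleR_fun_def)

lemma ext_map_zero: "ext_map V W p L 0 = 0"
  by (auto simp: ext_map_def)

lemma ext_map_wedge:
  assumes "linear_between V W L" "subspace V" "vs \<in> tuples V p"
  shows "ext_map V W p L (wedge V vs) = wedge W (map L vs)"
  using assms(3) pull_form_alt_forms[OF assms(1) _ assms(2)]
  by (auto simp: ext_map_def wedge_def tuples_def fun_eq_iff pull_form_def)

lemma ext_map_in_ext_power:
  assumes "U \<in> ext_power V p" "linear_between V W L" "subspace V"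
  shows "ext_map V W p L U \<in> ext_power W p"
  using assms(1)
proof (induction rule: ext_power_induct)
  case (wedge vs)
  then show ?case
    using ext_map_wedge[OF assms(2,3)] linear_between_tuples[OF assms(2)] wedge_in_ext_power by metis
next
  case (lincomb r U U')
  then show ?case
    unfolding ext_map_lincomb by (intro subspace_lincomb[OF subspace_ext_power])
qed (simp only: ext_map_zero subspace_0[OF subspace_ext_power])

text \<open>This makes \<open>\<iota>\<^bsub>X'\<^esub>\<Upsilon>\<close> the same for all lifts \<open>X'\<close> of \<open>X\<close>: the contraction with a pulled back form sees
  a multivector only through its push-forward.\<close>

lemma contract_pull_form:
  assumes "U \<in> ext_power V p" "linear_between V W L" "\<beta> \<in> alt_forms W (p + k)" "ws \<in> tuples V k"
  shows "contract U (pull_form V L \<beta>) ws = contract (ext_map V W p L U) \<beta> (map L ws)"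
proof -
  have "(\<lambda>vs. \<beta> (vs @ map L ws)) \<in> alt_forms W p"
    by (rule alt_forms_append[OF assms(3) linear_between_tuples[OF assms(2,4)]])
  moreover have "(\<lambda>vs. pull_form V L \<beta> (vs @ ws)) = pull_form V L (\<lambda>vs. \<beta> (vs @ map L ws))"
    using assms(4) by (auto simp: pull_form_def tuples_def fun_eq_iff)
  ultimately show ?thesis by (simp add: contract_def ext_map_def)
qed

lemma contract_off:
  assumes "U \<in> ext_power V p" "\<alpha> \<in> alt_forms V (p + k)" "ws \<notin> tuples V k"
  shows "contract U \<alpha> ws = 0"
proof (cases "(\<lambda>vs. \<alpha> (vs @ ws)) \<in> alt_forms V p")
  case True
  have "\<alpha> (vs @ ws) = 0" for vs
  proof (cases "vs \<in> tuples V p")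
    case True
    then have "vs @ ws \<notin> tuples V (p + k)" using assms(3) by (auto simp: tuples_def)
    then show ?thesis using alt_forms_off[OF assms(2)] by blast
  qed (use alt_forms_off[OF True] in blast)
  then show ?thesis using multivec_zero[OF assms(1)] by (simp add: contract_def)
qed (simp add: contract_def multivec_off[OF assms(1)])

lemma contract_alt_forms:
  assumes "U \<in> ext_power V p" "\<alpha> \<in> alt_forms V (p + k)" "subspace V"
  shows "contract U \<alpha> \<in> alt_forms V k"
  using assms(1)
proof (induction rule: ext_power_induct)
  case (wedge vs)
  have ap: "(\<lambda>us. \<alpha> (us @ ws)) \<in> alt_forms V p" if "ws \<in> tuples V k" for ws
    by (rule alt_forms_append[OF assms(2) that])
  have e: "contract (wedge V vs) \<alpha> ws = (if ws \<in> tuples V k then \<alpha> (vs @ ws) else 0)" for ws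
    using contract_wedge[OF assms(2) wedge] contract_off[OF wedge_in_ext_power[OF wedge] assms(2)] by simp
  have u: "vs @ ws[i := x] = (vs @ ws)[p + i := x]" for ws i x
    using wedge by (simp add: tuples_def list_update_append)
  have t: "ws \<in> tuples V k \<Longrightarrow> vs @ ws \<in> tuples V (p + k)" for ws
    using wedge by (auto simp: tuples_def)
  have tu: "ws \<in> tuples V k \<Longrightarrow> x \<in> V \<Longrightarrow> ws[i := x] \<in> tuples V k" for ws i x
    using set_update_subset_insert[of ws i x] by (auto simp: tuples_def)
  show ?case
    unfolding alt_forms_def
  proof (intro CollectI conjI allI ballI impI)
    fix ws i v w r assume "ws \<in> tuples V k" "i < k" "v \<in> V" "w \<in> V"
    then show "contract (wedge V vs) \<alpha> (ws[i := r *\<^sub>R v + w]) =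
        r * contract (wedge V vs) \<alpha> (ws[i := v]) + contract (wedge V vs) \<alpha> (ws[i := w])"
      using alt_forms_update[OF assms(2) t, of ws "p + i" v w r] tu assms(3)
      by (simp add: e u subspace_add subspace_scale)
  qed (use alt_forms_repeat[OF assms(2)] in \<open>auto simp: e\<close>)
next
  case (lincomb r U U')
  then have "r *\<^sub>R contract U \<alpha> + contract U' \<alpha> \<in> alt_forms V k"
    by (intro subspace_lincomb[OF subspace_alt_forms])
  moreover have "contract (r *\<^sub>R U + U') \<alpha> = r *\<^sub>R contract U \<alpha> + contract U' \<alpha>"
    by (auto simp: contract_def scaleR_fun_def)
  ultimately show ?case by metis
qed (auto simp: contract_def alt_forms_def)

text \<open>The multivector \<open>v \<and> Q\<close>, defined through its pairing because a representation of \<open>Q\<close> by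
  decomposables is not unique.\<close>

definition wedge_cons :: "'v::real_vector set \<Rightarrow> nat \<Rightarrow> 'v \<Rightarrow> 'v multivec \<Rightarrow> 'v multivec"
  where "wedge_cons V p v Q = (\<lambda>\<beta>. if \<beta> \<in> alt_forms V (Suc p) then Q (\<lambda>vs. \<beta> (v # vs)) else 0)"

lemma wedge_cons_in_ext_power:
  assumes "Q \<in> ext_power V p" "v \<in> V"
  shows "wedge_cons V p v Q \<in> ext_power V (Suc p)"
  using assms(1)
proof (induction rule: ext_power_induct)
  case (wedge vs)
  then have "wedge_cons V p v (wedge V vs) = wedge V (v # vs)"
    using alt_forms_Cons[OF _ assms(2)] by (auto simp: wedge_cons_def wedge_def tuples_def fun_eq_iff)
  moreover have "v # vs \<in> tuples V (Suc p)" using wedge assms(2) by (auto simp: tuples_def)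
  ultimately show ?case using wedge_in_ext_power by metis
next
  case (lincomb r U U')
  moreover have e: "wedge_cons V p v (r *\<^sub>R U + U') = r *\<^sub>R wedge_cons V p v U + wedge_cons V p v U'"
    by (auto simp: wedge_cons_def scaleR_fun_def)
  ultimately show ?case
    unfolding e by (intro subspace_lincomb[OF subspace_ext_power])
next
  case zero
  have "wedge_cons V p v 0 = 0" by (auto simp: wedge_cons_def)
  then show ?case using subspace_0[OF subspace_ext_power] by metis
qed

lemma ext_map_wedge_cons_zero:
  assumes "Q \<in> ext_power V p" "linear_between V W L" "subspace V" "0 \<in> W" "v \<in> V" "L v = 0"
  shows "ext_map V W (Suc p) L (wedge_cons V p v Q) = 0"
proof
  fix \<beta>
  have "pull_form V L \<beta> (v # vs) = 0" if "\<beta> \<in> alt_forms W (Suc p)" for vs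
    using alt_forms_zero[OF that assms(4), of "[]"] assms(5,6) by (simp add: pull_form_def)
  then show "ext_map V W (Suc p) L (wedge_cons V p v Q) \<beta> = (0 :: 'b multivec) \<beta>"
    using multivec_zero[OF assms(1)] by (simp add: ext_map_def wedge_cons_def)
qed

lemma contract_wedge_cons:
  assumes "Q \<in> ext_power V p" "\<omega> \<in> alt_forms V (Suc p + k)" "ws \<in> tuples V k"
  shows "contract (wedge_cons V p v Q) \<omega> ws = contract Q (\<lambda>vs. \<omega> (v # vs)) ws"
  using alt_forms_append[OF assms(2,3)] by (simp add: contract_def wedge_cons_def)

lemma ext_power_1:
  assumes "U \<in> ext_power V (Suc 0)" "subspace V"
  shows "\<exists>v\<in>V. U = wedge V [v]"
  using assms(1)
proof (induction rule: ext_power_induct)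
  case (wedge vs)
  then show ?case by (auto simp: tuples_def length_Suc_conv)
next
  case (lincomb r U U')
  then obtain v w where vw: "v \<in> V" "w \<in> V" "U = wedge V [v]" "U' = wedge V [w]" by blast
  have "\<alpha> [r *\<^sub>R v + w] = r * \<alpha> [v] + \<alpha> [w]" if "\<alpha> \<in> alt_forms V (Suc 0)" for \<alpha>
    using alt_forms_lin[OF that, of "[]" v "[]" w r] vw by (simp add: tuples_def)
  then have "r *\<^sub>R U + U' = wedge V [r *\<^sub>R v + w]"
    using vw by (auto simp: wedge_def scaleR_fun_def fun_eq_iff)
  then show ?case using vw assms(2) by (metis subspace_add subspace_scale)
next
  case zero
  have "wedge V [0] = 0"
    using alt_forms_zero[of _ V "Suc 0" "[]" "[]"] subspace_0[OF assms(2)] by (auto simp: wedge_def)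
  then show ?case using subspace_0[OF assms(2)] by metis
qed

section \<open>Calculus with families of alternating forms\<close>

lemma alt_forms_UNIV_expand:
  fixes v :: "'v::euclidean_space"
  assumes "b \<in> alt_forms UNIV (Suc k)" "length vs = k"
  shows "b (v # vs) = (\<Sum>e\<in>Basis. (v \<bullet> e) * b (e # vs))"
  using alt_forms_sum[OF assms(1) subspace_UNIV finite_Basis, of "\<lambda>e. e" "[]" vs "\<lambda>e. v \<bullet> e"] assms(2)
  by (simp add: euclidean_representation)

text \<open>Expanding the first argument in the basis reduces the number of varying arguments by one.\<close>

lemma alt_form_field_smooth:
  fixes b :: "'a::real_normed_vector \<Rightarrow> 'v::euclidean_space list \<Rightarrow> real"
  assumes "open S" "\<And>u. u \<in> S \<Longrightarrow> b u \<in> alt_forms UNIV (length gs)" "\<And>vs. smooth_on S (\<lambda>u. b u vs)"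
    and "\<And>g. g \<in> set gs \<Longrightarrow> smooth_on S g"
  shows "smooth_on S (\<lambda>u. b u (map (\<lambda>g. g u) gs))"
  using assms(2-)
proof (induction gs arbitrary: b)
  case (Cons g gs)
  have "smooth_on S (\<lambda>u. b u (e # map (\<lambda>g. g u) gs))" for e
  proof (rule Cons.IH)
    show "(\<lambda>vs. b u (e # vs)) \<in> alt_forms UNIV (length gs)" if "u \<in> S" for u
      by (rule alt_forms_Cons) (use Cons.prems(1)[OF that] in auto)
  qed (use Cons.prems in auto)
  then have s: "smooth_on S (\<lambda>u. \<Sum>e\<in>Basis. (g u \<bullet> e) * b u (e # map (\<lambda>g. g u) gs))"
    using Cons.prems(3)[of g] assms(1)
    by (intro smooth_on_sum smooth_on_mult smooth_on_inner smooth_on_const) auto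
  show ?case
  proof (rule smooth_on_cong[OF assms(1) _ s])
    fix u assume "u \<in> S"
    then show "(\<Sum>e\<in>Basis. (g u \<bullet> e) * b u (e # map (\<lambda>g. g u) gs)) = b u (map (\<lambda>g. g u) (g # gs))"
      using alt_forms_UNIV_expand[of "b u" "length gs" "map (\<lambda>g. g u) gs" "g u"] Cons.prems(1) by simp
  qed
qed simp

corollary alt_form_family_smooth:
  fixes b :: "'a::real_normed_vector \<Rightarrow> 'v::euclidean_space list \<Rightarrow> real"
  assumes "open S" "\<And>u. u \<in> S \<Longrightarrow> b u \<in> alt_forms UNIV (length ws)" "\<And>vs. smooth_on S (\<lambda>u. b u vs)"
    and "\<And>w. smooth_on S (\<lambda>u. H u w)"
  shows "smooth_on S (\<lambda>u. b u (map (H u) ws))"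
proof -
  have "smooth_on S (\<lambda>u. b u (map (\<lambda>g. g u) (map (\<lambda>w u. H u w) ws)))"
    by (rule alt_form_field_smooth[OF assms(1)]) (use assms(2-) in auto)
  then show ?thesis by (simp add: o_def)
qed

text \<open>The product rule: one term differentiates the form with its arguments held fixed, the others
  differentiate one argument each.\<close>

lemma alt_form_field_derivative:
  fixes b :: "'a::real_normed_vector \<Rightarrow> 'v::euclidean_space list \<Rightarrow> real"
  assumes "open S" "x \<in> S" "\<And>u. u \<in> S \<Longrightarrow> b u \<in> alt_forms UNIV (length gs)"
    and "\<And>vs. ((\<lambda>u. b u vs) has_derivative b' vs) (at x)"
    and "\<And>g. g \<in> set gs \<Longrightarrow> (g has_derivative D g) (at x)"
  shows "((\<lambda>u. b u (map (\<lambda>g. g u) gs)) has_derivative (\<lambda>h. b' (map (\<lambda>g. g x) gs) h +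
    (\<Sum>j<length gs. b x ((map (\<lambda>g. g x) gs)[j := D (gs ! j) h])))) (at x)"
  using assms(3-)
proof (induction gs arbitrary: b b')
  case (Cons g gs)
  let ?r = "\<lambda>u. map (\<lambda>g. g u) gs"
  have expand: "b u (v # vs) = (\<Sum>e\<in>Basis. (v \<bullet> e) * b u (e # vs))" if "u \<in> S" "length vs = length gs" for u v vs
    using alt_forms_UNIV_expand[of "b u" "length gs" vs v] Cons.prems(1)[OF that(1)] that(2) by simp
  (* The derivative inherits linearity in the first argument by uniqueness of derivatives. *)
  have b'_expand: "b' (v # vs) h = (\<Sum>e\<in>Basis. (v \<bullet> e) * b' (e # vs) h)" if "length vs = length gs" for v vs h
  proof -
    have "((\<lambda>u. \<Sum>e\<in>Basis. (v \<bullet> e) * b u (e # vs)) has_derivative (\<lambda>h. \<Sum>e\<in>Basis. (v \<bullet> e) * b' (e # vs) h)) (at x)"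
      by (intro has_derivative_sum has_derivative_mult_right Cons.prems(2))
    then have "((\<lambda>u. b u (v # vs)) has_derivative (\<lambda>h. \<Sum>e\<in>Basis. (v \<bullet> e) * b' (e # vs) h)) (at x)"
      by (rule has_derivative_transform_within_open[OF _ assms(1,2)]) (simp add: expand[OF _ that])
    from has_derivative_unique[OF this Cons.prems(2)] show ?thesis by metis
  qed
  have IH: "((\<lambda>u. b u (e # ?r u)) has_derivative (\<lambda>h. b' (e # ?r x) h +
      (\<Sum>j<length gs. b x (e # (?r x)[j := D (gs ! j) h])))) (at x)" for e
  proof (rule Cons.IH)
    show "(\<lambda>vs. b u (e # vs)) \<in> alt_forms UNIV (length gs)" if "u \<in> S" for u
      by (rule alt_forms_Cons) (use Cons.prems(1)[OF that] in auto)
  qed (use Cons.prems in auto)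
  have g: "((\<lambda>u. g u \<bullet> e) has_derivative (\<lambda>h. D g h \<bullet> e)) (at x)" for e
    using Cons.prems(3)[of g] by (intro has_derivative_inner_left) simp
  have "((\<lambda>u. \<Sum>e\<in>Basis. (g u \<bullet> e) * b u (e # ?r u)) has_derivative
      (\<lambda>h. \<Sum>e\<in>Basis. (g x \<bullet> e) * (b' (e # ?r x) h + (\<Sum>j<length gs. b x (e # (?r x)[j := D (gs ! j) h])))
        + (D g h \<bullet> e) * b x (e # ?r x))) (at x)"
    by (intro has_derivative_sum has_derivative_mult g IH)
  then have d: "((\<lambda>u. b u (g u # ?r u)) has_derivative
      (\<lambda>h. \<Sum>e\<in>Basis. (g x \<bullet> e) * (b' (e # ?r x) h + (\<Sum>j<length gs. b x (e # (?r x)[j := D (gs ! j) h])))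
        + (D g h \<bullet> e) * b x (e # ?r x))) (at x)"
    by (rule has_derivative_transform_within_open[OF _ assms(1,2)]) (simp add: expand)
  have "(\<Sum>e\<in>Basis. (g x \<bullet> e) * (b' (e # ?r x) h + (\<Sum>j<length gs. b x (e # (?r x)[j := D (gs ! j) h])))
        + (D g h \<bullet> e) * b x (e # ?r x)) =
      b' (g x # ?r x) h + (\<Sum>j<length gs. b x (g x # (?r x)[j := D (gs ! j) h])) + b x (D g h # ?r x)" for h
  proof -
    have "(\<Sum>j<length gs. b x (g x # (?r x)[j := D (gs ! j) h])) =
       (\<Sum>e\<in>Basis. (g x \<bullet> e) * (\<Sum>j<length gs. b x (e # (?r x)[j := D (gs ! j) h])))"
      unfolding sum_distrib_left by (subst sum.swap) (simp add: expand[OF assms(2), symmetric])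
    then show ?thesis
      by (simp add: expand[OF assms(2), of _ "D g h"] b'_expand[of _ "g x"] sum.distrib algebra_simps)
  qed
  then show ?case
    using d by (simp add: lessThan_Suc_eq_insert_0 sum.reindex add_ac)
qed (use assms(4)[of "[]"] in simp)

lemma pullback_derivative:
  fixes f :: "'a::euclidean_space \<Rightarrow> 'v::euclidean_space" and b :: "'v \<Rightarrow> 'v list \<Rightarrow> real"
  defines "D \<equiv> \<lambda>u. frechet_derivative f (at u)"
  assumes "open S" "smooth_on S f" "f ` S \<subseteq> T" "open T" "x \<in> S"
    and "\<And>u. u \<in> T \<Longrightarrow> b u \<in> alt_forms UNIV (length us)" "\<And>vs. smooth_on T (\<lambda>u. b u vs)"
  shows "((\<lambda>u. b (f u) (map (D u) us)) has_derivative (\<lambda>h.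
      frechet_derivative (\<lambda>u. b u (map (D x) us)) (at (f x)) (D x h) +
      (\<Sum>j<length us. b (f x) ((map (D x) us)[j := frechet_derivative (\<lambda>u. D u (us ! j)) (at x) h])))) (at x)"
proof -
  let ?gs = "map (\<lambda>w u. D u w) us"
  have "((\<lambda>u. b (f u) (map (\<lambda>g. g u) ?gs)) has_derivative
      (\<lambda>h. frechet_derivative (\<lambda>u. b u (map (\<lambda>g. g x) ?gs)) (at (f x)) (D x h) +
    (\<Sum>j<length ?gs. b (f x) ((map (\<lambda>g. g x) ?gs)[j := frechet_derivative (?gs ! j) (at x) h])))) (at x)"
  proof (rule alt_form_field_derivative[OF assms(2,6)])
    show "b (f u) \<in> alt_forms UNIV (length ?gs)" if "u \<in> S" for u using assms(4,7) that by auto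
    show "((\<lambda>u. b (f u) vs) has_derivative (\<lambda>h. frechet_derivative (\<lambda>u. b u vs) (at (f x)) (D x h))) (at x)" for vs
    proof -
      have "f x \<in> T" using assms(4,6) by auto
      from smooth_on_has_derivative[OF assms(8) this] smooth_on_has_derivative[OF assms(3,6)]
      show ?thesis unfolding D_def using has_derivative_compose by blast
    qed
    show "(g has_derivative frechet_derivative g (at x)) (at x)" if "g \<in> set ?gs" for g
      using that smooth_on_has_derivative[OF smooth_on_frechet_derivative[OF assms(3)] assms(6)]
      by (auto simp: D_def)
  qed
  then show ?thesis by (simp add: o_def cong: sum.cong_simp)
qed

text \<open>This is \<open>d(\<phi> f\<^sup>*b) = d\<phi> \<and> f\<^sup>*b + \<phi> f\<^sup>*db\<close> on open subsets of Euclidean spaces. Besides the terms of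
  the Leibniz rule, differentiation of \<open>Df\<close> produces second derivatives of \<open>f\<close>, which cancel by
  symmetry.\<close>

lemma pullback_altsum:
  fixes f :: "'a::euclidean_space \<Rightarrow> 'v::euclidean_space" and b :: "'v \<Rightarrow> 'v list \<Rightarrow> real"
    and \<phi> :: "'a \<Rightarrow> real"
  defines "D \<equiv> \<lambda>u. frechet_derivative f (at u)"
  assumes "open S" "smooth_on S f" "f ` S \<subseteq> T" "open T" "x \<in> S" "smooth_on S \<phi>"
    and "\<And>u. u \<in> T \<Longrightarrow> b u \<in> alt_forms UNIV k" "\<And>vs. smooth_on T (\<lambda>u. b u vs)" "length ws = Suc k"
  shows "altsum (\<lambda>w us. frechet_derivative (\<lambda>u. \<phi> u * b (f u) (map (D u) us)) (at x) w) ws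
    = altsum (\<lambda>w us. frechet_derivative \<phi> (at x) w * b (f x) (map (D x) us)) ws
      + \<phi> x * altsum (\<lambda>w us. frechet_derivative (\<lambda>u. b u us) (at (f x)) w) (map (D x) ws)"
proof -
  let ?S = "\<lambda>i l. frechet_derivative (\<lambda>u. D u (ws ! l)) (at x) (ws ! i)"
  have fx: "f x \<in> T" using assms(4,6) by auto
  have "frechet_derivative (\<lambda>u. \<phi> u * b (f u) (map (D u) (remove_nth i ws))) (at x) (ws ! i)
      = frechet_derivative \<phi> (at x) (ws ! i) * b (f x) (map (D x) (remove_nth i ws))
       + \<phi> x * frechet_derivative (\<lambda>u. b u (remove_nth i (map (D x) ws))) (at (f x)) (D x (ws ! i))
       + \<phi> x * (\<Sum>j<k. b (f x) ((remove_nth i (map (D x) ws))[j := ?S i (skip i j)]))"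
    if i: "i < Suc k" for i
  proof -
    let ?us = "remove_nth i ws"
    have len: "length ?us = k" using i assms(10) by simp
    have "((\<lambda>u. \<phi> u * b (f u) (map (D u) ?us)) has_derivative (\<lambda>h. \<phi> x *
       (frechet_derivative (\<lambda>u. b u (map (D x) ?us)) (at (f x)) (D x h) +
        (\<Sum>j<length ?us. b (f x) ((map (D x) ?us)[j := frechet_derivative (\<lambda>u. D u (?us ! j)) (at x) h])))
        + frechet_derivative \<phi> (at x) h * b (f x) (map (D x) ?us))) (at x)"
      unfolding D_def
      by (intro has_derivative_mult smooth_on_has_derivative[OF assms(7,6)] pullback_derivative[OF assms(2-6)])
        (use assms(8,9) len in auto)
    from frechet_derivative_at[OF this, symmetric]
    show ?thesis
      using assms(10) len by (simp add: nth_remove_nth map_remove_nth algebra_simps)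
  qed
  then have "altsum (\<lambda>w us. frechet_derivative (\<lambda>u. \<phi> u * b (f u) (map (D u) us)) (at x) w) ws =
    altsum (\<lambda>w us. frechet_derivative \<phi> (at x) w * b (f x) (map (D x) us)) ws
      + \<phi> x * altsum (\<lambda>w us. frechet_derivative (\<lambda>u. b u us) (at (f x)) w) (map (D x) ws)
      + \<phi> x * (\<Sum>i<Suc k. (-1) ^ i * (\<Sum>j<k. b (f x) ((remove_nth i (map (D x) ws))[j := ?S i (skip i j)])))"
    by (simp add: altsum_def assms(10) sum_distrib_left sum.distrib[symmetric] algebra_simps)
  also have "(\<Sum>i<Suc k. (-1) ^ i * (\<Sum>j<k. b (f x) ((remove_nth i (map (D x) ws))[j := ?S i (skip i j)]))) = 0"
    by (rule altsum_symmetric_cancel[OF subspace_UNIV assms(8)[OF fx]])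
      (use assms(10) second_derivative_symmetric[OF assms(2,3,6)] in \<open>auto simp: tuples_def D_def\<close>)
  finally show ?thesis by simp
qed

text \<open>The components of \<open>Y\<close> are only known to be smooth for constant forms, so \<open>b\<close> is expanded in a
  finite family of constant forms with smooth coefficients.\<close>

lemma pairing_smooth:
  fixes Y :: "'a::real_normed_vector \<Rightarrow> 'v::euclidean_space multivec"
  assumes "open S" "\<And>u. u \<in> S \<Longrightarrow> Y u \<in> ext_power UNIV p"
    and "\<And>\<beta>. \<beta> \<in> alt_forms UNIV p \<Longrightarrow> smooth_on S (\<lambda>u. Y u \<beta>)"
    and "\<And>u. u \<in> S \<Longrightarrow> b u \<in> alt_forms UNIV p" "\<And>vs. smooth_on S (\<lambda>u. b u vs)"
  shows "smooth_on S (\<lambda>u. Y u (b u))"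
proof -
  obtain I :: "'v list set" and \<epsilon> where fin: "finite I" and \<epsilon>: "\<And>i. i \<in> I \<Longrightarrow> \<epsilon> i \<in> alt_forms (UNIV :: 'v set) p"
    and ex: "\<And>\<beta>. \<beta> \<in> alt_forms UNIV p \<Longrightarrow> \<beta> = (\<lambda>vs. \<Sum>i\<in>I. \<beta> i * \<epsilon> i vs)"
    using alt_forms_finite_expansion[of p] by blast
  have "smooth_on S (\<lambda>u. \<Sum>i\<in>I. b u i * Y u (\<epsilon> i))"
    using assms(1,3,5) \<epsilon> by (intro smooth_on_sum smooth_on_mult) auto
  then show ?thesis
  proof (rule smooth_on_cong[OF assms(1), rotated])
    fix u assume u: "u \<in> S"
    have "Y u (b u) = Y u (\<lambda>vs. \<Sum>i\<in>I. b u i * \<epsilon> i vs)" using ex[OF assms(4)[OF u]] by simp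
    also have "\<dots> = (\<Sum>i\<in>I. b u i * Y u (\<epsilon> i))" by (rule multivec_lincomb[OF assms(2)[OF u] \<epsilon>])
    finally show "(\<Sum>i\<in>I. b u i * Y u (\<epsilon> i)) = Y u (b u)" by simp
  qed
qed

section \<open>Charts\<close>

lemma chart_open:
  assumes "smooth_manifold A" "c \<in> A"
  shows "open (cdom c)" "open (crange c)"
  using assms unfolding smooth_manifold_def by auto

lemma chart_inj: "smooth_manifold A \<Longrightarrow> c \<in> A \<Longrightarrow> inj_on (cmap c) (cdom c)"
  unfolding smooth_manifold_def homeomorphism_def inj_on_def by metis

lemma cinv_cmap: "smooth_manifold A \<Longrightarrow> c \<in> A \<Longrightarrow> x \<in> cdom c \<Longrightarrow> cinv c (cmap c x) = x"
  using chart_inj by (metis inv_into_f_f)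

lemma cmap_cinv: "u \<in> crange c \<Longrightarrow> cmap c (cinv c u) = u"
  by (rule f_inv_into_f)

lemma cinv_in_cdom: "u \<in> crange c \<Longrightarrow> cinv c u \<in> cdom c"
  by (rule inv_into_into)

lemma chart_continuous:
  assumes "smooth_manifold A" "c \<in> A"
  shows "continuous_on (cdom c) (cmap c)" "continuous_on (crange c) (cinv c)"
proof -
  obtain g where g: "homeomorphism (cdom c) (crange c) (cmap c) g"
    using assms unfolding smooth_manifold_def by blast
  then show "continuous_on (cdom c) (cmap c)" by (auto simp: homeomorphism_def)
  have "cinv c u = g u" if "u \<in> crange c" for u
    using g that cinv_cmap[OF assms] by (auto simp: homeomorphism_def)
  then show "continuous_on (crange c) (cinv c)"
    using g continuous_on_cong[of "crange c" "crange c" "cinv c" g] by (auto simp: homeomorphism_def)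
qed

lemma chart_image_eq:
  assumes "smooth_manifold A" "c \<in> A"
  shows "cmap c ` (cdom c \<inter> N) = crange c \<inter> cinv c -` N"
  using cinv_cmap[OF assms] by (force simp: image_iff)

lemma open_chart_image:
  assumes "smooth_manifold A" "c \<in> A" "open N"
  shows "open (cmap c ` (cdom c \<inter> N))"
  unfolding chart_image_eq[OF assms(1,2)]
  by (rule continuous_open_preimage[OF chart_continuous(2)[OF assms(1,2)] chart_open(2)[OF assms(1,2)] assms(3)])

lemma charts_atD: "c \<in> charts_at A x \<Longrightarrow> c \<in> A" "c \<in> charts_at A x \<Longrightarrow> x \<in> cdom c"
  by (auto simp: charts_at_def)

lemma chart_at_in: "smooth_manifold A \<Longrightarrow> chart_at A x \<in> charts_at A x"
  unfolding chart_at_def by (rule someI_ex) (unfold smooth_manifold_def charts_at_def, blast)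

lemma chart_at_dom:
  assumes "smooth_manifold A"
  shows "chart_at A x \<in> A" "x \<in> cdom (chart_at A x)"
  using chart_at_in[OF assms, of x] by (simp_all add: charts_at_def)

lemma charts_at_cinv: "c \<in> A \<Longrightarrow> u \<in> crange c \<Longrightarrow> c \<in> charts_at A (cinv c u)"
  by (simp add: charts_at_def cinv_in_cdom)

lemma open_preimage_on:
  assumes "open S" "continuous_on S f" "open T"
  shows "open (S \<inter> f -` T)"
  using continuous_open_preimage[OF assms(2,1,3)] .

section \<open>Derivatives in charts\<close>

definition chart_deriv ::
    "('t, 'k::real_normed_vector) chart \<Rightarrow> ('m, 'e::real_normed_vector) chart \<Rightarrow> ('t \<Rightarrow> 'm) \<Rightarrow> 't \<Rightarrow> 'k \<Rightarrow> 'e"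
  where "chart_deriv c c' f y = frechet_derivative (cmap c' \<circ> f \<circ> cinv c) (at (cmap c y))"

lemma smooth_map_rep:
  assumes "smooth_manifold At" "smooth_map_on At S A f" "open S" "c \<in> At" "c' \<in> A" "open (cdom c')"
  shows "open (cmap c ` (cdom c \<inter> (S \<inter> f -` cdom c')))"
    and "smooth_on (cmap c ` (cdom c \<inter> (S \<inter> f -` cdom c'))) (cmap c' \<circ> f \<circ> cinv c)"
  using assms open_chart_image[OF assms(1,4) open_preimage_on[OF assms(3) _ assms(6)]]
  unfolding smooth_map_on_def by (auto simp: Int_assoc)

lemma smooth_map_rep_has_derivative:
  assumes "smooth_manifold At" "smooth_map_on At S A f" "open S" "y \<in> S"
    and "c \<in> charts_at At y" "c' \<in> charts_at A (f y)" "smooth_manifold A"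
  shows "((cmap c' \<circ> f \<circ> cinv c) has_derivative chart_deriv c c' f y) (at (cmap c y))"
  unfolding chart_deriv_def
  by (rule smooth_on_has_derivative[OF smooth_map_rep(2)[OF assms(1-3) charts_atD(1)[OF assms(5)]
        charts_atD(1)[OF assms(6)] chart_open(1)[OF assms(7) charts_atD(1)[OF assms(6)]]]])
    (use assms in \<open>simp add: charts_at_def\<close>)

lemma chart_deriv_linear:
  assumes "smooth_manifold At" "smooth_map_on At S A f" "open S" "y \<in> S"
    and "c \<in> charts_at At y" "c' \<in> charts_at A (f y)" "smooth_manifold A"
  shows "linear (chart_deriv c c' f y)"
  using smooth_map_rep_has_derivative[OF assms] has_derivative_linear by blast

text \<open>The hypotheses speak of the two representatives instead of smooth maps between atlases, so that
  \<open>c''\<close> may also be a chart of the real line.\<close>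

lemma chart_deriv_chain:
  assumes "smooth_manifold At" "smooth_manifold A"
    and "c \<in> charts_at At y" "c' \<in> charts_at A (f y)" "open N" "y \<in> N" "continuous_on N f"
    and "((cmap c' \<circ> f \<circ> cinv c) has_derivative chart_deriv c c' f y) (at (cmap c y))"
    and "((cmap c'' \<circ> g \<circ> cinv c') has_derivative chart_deriv c' c'' g (f y)) (at (cmap c' (f y)))"
  shows "chart_deriv c c'' (g \<circ> f) y w = chart_deriv c' c'' g (f y) (chart_deriv c c' f y w)"
proof -
  let ?U = "cmap c ` (cdom c \<inter> (N \<inter> f -` cdom c'))"
  have cA: "c \<in> At" "y \<in> cdom c" "c' \<in> A" "f y \<in> cdom c'" using assms(3,4) by (simp_all add: charts_at_def)
  have cy: "(cmap c' \<circ> f \<circ> cinv c) (cmap c y) = cmap c' (f y)"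
    using cinv_cmap[OF assms(1) cA(1,2)] by simp
  have "open ?U"
    by (rule open_chart_image[OF assms(1) cA(1) open_preimage_on[OF assms(5,7) chart_open(1)[OF assms(2) cA(3)]]])
  moreover have "cmap c y \<in> ?U" using cA assms(6) by auto
  moreover have "((cmap c'' \<circ> g \<circ> cinv c') ((cmap c' \<circ> f \<circ> cinv c) u)) = (cmap c'' \<circ> (g \<circ> f) \<circ> cinv c) u"
    if "u \<in> ?U" for u
    using that cinv_cmap[OF assms(1) cA(1)] cinv_cmap[OF assms(2) cA(3)] by auto
  moreover have "((\<lambda>u. (cmap c'' \<circ> g \<circ> cinv c') ((cmap c' \<circ> f \<circ> cinv c) u)) has_derivative
      (\<lambda>w. chart_deriv c' c'' g (f y) (chart_deriv c c' f y w))) (at (cmap c y))"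
    by (rule has_derivative_compose[OF assms(8)], unfold cy, rule assms(9))
  ultimately have "((cmap c'' \<circ> (g \<circ> f) \<circ> cinv c) has_derivative
      (\<lambda>w. chart_deriv c' c'' g (f y) (chart_deriv c c' f y w))) (at (cmap c y))"
    using has_derivative_transform_within_open by blast
  from frechet_derivative_at[OF this] show ?thesis
    unfolding chart_deriv_def by metis
qed

lemma smooth_map_on_id: "smooth_manifold A \<Longrightarrow> smooth_map_on A UNIV A id"
  unfolding smooth_map_on_def smooth_manifold_def by auto

lemma chart_deriv_compose:
  assumes "smooth_manifold At" "smooth_manifold A" "smooth_manifold B"
    and "smooth_map_on At S A f" "open S" "y \<in> S" "smooth_map_on A S' B g" "open S'" "f y \<in> S'"
    and "c \<in> charts_at At y" "c' \<in> charts_at A (f y)" "c'' \<in> charts_at B (g (f y))"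
  shows "chart_deriv c c'' (g \<circ> f) y w = chart_deriv c' c'' g (f y) (chart_deriv c c' f y w)"
  by (rule chart_deriv_chain[OF assms(1,2,10,11,5,6) _
        smooth_map_rep_has_derivative[OF assms(1,4,5,6,10,11,2)]
        smooth_map_rep_has_derivative[OF assms(2,7,8,9,11,12,3)]])
    (use assms(4) in \<open>simp add: smooth_map_on_def\<close>)

lemma chart_deriv_id:
  assumes "smooth_manifold A" "c \<in> charts_at A x"
  shows "chart_deriv c c id x w = w"
proof -
  have c: "c \<in> A" "x \<in> cdom c" using assms by (simp_all add: charts_at_def)
  have "((\<lambda>u. u) has_derivative (\<lambda>w. w)) (at (cmap c x))" by simp
  then have "((cmap c \<circ> id \<circ> cinv c) has_derivative (\<lambda>w. w)) (at (cmap c x))"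
    by (rule has_derivative_transform_within_open[OF _ chart_open(2)[OF assms(1) c(1)]])
      (use c cmap_cinv[of _ c] in auto)
  from frechet_derivative_at[OF this] show ?thesis unfolding chart_deriv_def by metis
qed

lemma chart_deriv_cocycle:
  assumes "smooth_manifold A" "c \<in> charts_at A x" "c' \<in> charts_at A x" "c'' \<in> charts_at A x"
  shows "chart_deriv c' c'' id x (chart_deriv c c' id x w) = chart_deriv c c'' id x w"
  using chart_deriv_compose[OF assms(1,1,1) smooth_map_on_id[OF assms(1)] open_UNIV _
      smooth_map_on_id[OF assms(1)] open_UNIV, of x c c' c'' w] assms by simp

section \<open>Tangent spaces\<close>

lemma tangent_space_alt:
  "tangent_space A x = {v. (\<forall>c. c \<notin> charts_at A x \<longrightarrow> v c = 0) \<and>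
    (\<forall>c\<in>charts_at A x. \<forall>c'\<in>charts_at A x. v c' = chart_deriv c c' id x (v c))}"
  by (simp add: tangent_space_def chart_deriv_def)

lemma coord_tvec_alt:
  "coord_tvec A c x w = (\<lambda>c'. if c' \<in> charts_at A x then chart_deriv c c' id x w else 0)"
  by (auto simp: coord_tvec_def chart_deriv_def)

lemma tangent_spaceD:
  "v \<in> tangent_space A x \<Longrightarrow> c \<in> charts_at A x \<Longrightarrow> c' \<in> charts_at A x \<Longrightarrow> v c' = chart_deriv c c' id x (v c)"
  unfolding tangent_space_alt by blast

lemma tangent_space_off: "v \<in> tangent_space A x \<Longrightarrow> c \<notin> charts_at A x \<Longrightarrow> v c = 0"
  unfolding tangent_space_alt by blast

lemma transition_linear:
  "smooth_manifold A \<Longrightarrow> c \<in> charts_at A x \<Longrightarrow> c' \<in> charts_at A x \<Longrightarrow> linear (chart_deriv c c' id x)"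
  by (rule chart_deriv_linear[where f = id and S = UNIV and At = A and A = A])
    (simp_all add: smooth_map_on_id)

lemma subspace_tangent_space:
  assumes "smooth_manifold A"
  shows "subspace (tangent_space A x)"
proof (rule subspaceI)
  show "0 \<in> tangent_space A x"
    by (auto simp: tangent_space_alt linear_0[OF transition_linear[OF assms]])
  show "v + w \<in> tangent_space A x" if "v \<in> tangent_space A x" "w \<in> tangent_space A x" for v w
    unfolding tangent_space_alt
  proof (intro CollectI conjI ballI allI impI)
    show "(v + w) c = 0" if "c \<notin> charts_at A x" for c
      using tangent_space_off[OF \<open>v \<in> _\<close> that] tangent_space_off[OF \<open>w \<in> _\<close> that] by simp
    show "(v + w) c' = chart_deriv c c' id x ((v + w) c)" if "c \<in> charts_at A x" "c' \<in> charts_at A x" for c c'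
      using tangent_spaceD[OF \<open>v \<in> _\<close> that] tangent_spaceD[OF \<open>w \<in> _\<close> that]
        linear_add[OF transition_linear[OF assms that]] by (simp only: plus_fun_apply)
  qed
  show "r *\<^sub>R v \<in> tangent_space A x" if "v \<in> tangent_space A x" for r v
    unfolding tangent_space_alt
  proof (intro CollectI conjI ballI allI impI)
    show "(r *\<^sub>R v) c = 0" if "c \<notin> charts_at A x" for c
      using tangent_space_off[OF \<open>v \<in> _\<close> that] by (simp add: scaleR_fun_def)
    show "(r *\<^sub>R v) c' = chart_deriv c c' id x ((r *\<^sub>R v) c)" if "c \<in> charts_at A x" "c' \<in> charts_at A x" for c c'
      using tangent_spaceD[OF \<open>v \<in> _\<close> that] linear_scale[OF transition_linear[OF assms that]]
      by (simp only: scaleR_fun_def)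
  qed
qed

lemma coord_tvec_in:
  assumes "smooth_manifold A" "c \<in> charts_at A x"
  shows "coord_tvec A c x w \<in> tangent_space A x"
  unfolding tangent_space_alt
proof (intro CollectI conjI ballI allI impI)
  show "coord_tvec A c x w c'' = chart_deriv c' c'' id x (coord_tvec A c x w c')"
    if "c' \<in> charts_at A x" "c'' \<in> charts_at A x" for c' c''
    unfolding coord_tvec_alt if_P[OF that(1)] if_P[OF that(2)]
    by (rule chart_deriv_cocycle[OF assms that, symmetric])
qed (simp add: coord_tvec_def)

lemma coord_tvec_same:
  assumes "smooth_manifold A" "c \<in> charts_at A x"
  shows "coord_tvec A c x w c = w"
  using assms by (simp add: coord_tvec_alt chart_deriv_id)

lemma coord_tvec_of_tvec:
  assumes "c \<in> charts_at A x" "v \<in> tangent_space A x"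
  shows "coord_tvec A c x (v c) = v"
proof
  show "coord_tvec A c x (v c) c' = v c'" for c'
  proof (cases "c' \<in> charts_at A x")
    case True
    show ?thesis unfolding coord_tvec_alt if_P[OF True] by (rule tangent_spaceD[OF assms(2,1) True, symmetric])
  next
    case False
    show ?thesis unfolding coord_tvec_alt if_not_P[OF False] using tangent_space_off[OF assms(2) False] by simp
  qed
qed

lemma tvec_eqI:
  assumes "c \<in> charts_at A x" "v \<in> tangent_space A x" "w \<in> tangent_space A x" "v c = w c"
  shows "v = w"
  using coord_tvec_of_tvec[OF assms(1)] assms by metis

lemma coord_tvec_linear_between:
  assumes "smooth_manifold A" "c \<in> charts_at A x"
  shows "linear_between UNIV (tangent_space A x) (coord_tvec A c x)"
  unfolding linear_between_def
proof (intro conjI ballI allI)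
  show "coord_tvec A c x ` UNIV \<subseteq> tangent_space A x" using coord_tvec_in[OF assms] by auto
  fix v w r
  show "coord_tvec A c x (r *\<^sub>R v + w) = r *\<^sub>R coord_tvec A c x v + coord_tvec A c x w"
    using transition_linear[OF assms]
    by (auto simp: coord_tvec_alt fun_eq_iff scaleR_fun_def linear_add linear_scale)
qed

lemma tvec_coord_linear_between: "linear_between (tangent_space A x) UNIV (\<lambda>v. v c)"
  by (simp add: linear_between_def scaleR_fun_def)

text \<open>The definition of the tangent map singles out one chart at \<open>y\<close>; by the chain rule every chart at
  \<open>y\<close> gives the same result.\<close>

lemma tangent_map_apply:
  assumes "smooth_manifold At" "smooth_manifold A" "smooth_map_on At S A f" "open S" "y \<in> S"
    and "v \<in> tangent_space At y" "c \<in> charts_at At y" "c' \<in> charts_at A (f y)"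
  shows "tangent_map At A f y v c' = chart_deriv c c' f y (v c)"
proof -
  let ?d = "chart_at At y"
  have d: "?d \<in> charts_at At y" by (rule chart_at_in[OF assms(1)])
  have "chart_deriv c c' (f \<circ> id) y w = chart_deriv ?d c' f y (chart_deriv c ?d id y w)" for w
    using chart_deriv_compose[OF assms(1,1,2) smooth_map_on_id[OF assms(1)] open_UNIV UNIV_I assms(3,4),
      of y c ?d c' w] assms d by simp
  then show ?thesis
    using tangent_spaceD[OF assms(6,7) d] assms(8)
    by (simp add: tangent_map_def chart_deriv_def Let_def)
qed



lemma tangent_map_coord:
  assumes "smooth_manifold At" "smooth_manifold A" "smooth_map_on At S A f" "open S" "y \<in> S"
    and "c \<in> charts_at At y" "c' \<in> charts_at A (f y)"
  shows "tangent_map At A f y (coord_tvec At c y w) = coord_tvec A c' (f y) (chart_deriv c c' f y w)"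
proof
  fix c''
  show "tangent_map At A f y (coord_tvec At c y w) c'' = coord_tvec A c' (f y) (chart_deriv c c' f y w) c''"
  proof (cases "c'' \<in> charts_at A (f y)")
    case True
    have "chart_deriv c c'' (id \<circ> f) y w = chart_deriv c' c'' id (f y) (chart_deriv c c' f y w)"
      using chart_deriv_compose[OF assms(1,2,2,3,4,5) smooth_map_on_id[OF assms(2)] open_UNIV UNIV_I assms(6,7),
        of c'' w] True by simp
    then show ?thesis
      using tangent_map_apply[OF assms(1-5) coord_tvec_in[OF assms(1,6)] assms(6) True]
        coord_tvec_same[OF assms(1,6)] True by (simp add: coord_tvec_alt)
  qed (simp add: tangent_map_def coord_tvec_alt)
qed

lemma tangent_map_linear_between:
  assumes "smooth_manifold At" "smooth_manifold A" "smooth_map_on At S A f" "open S" "y \<in> S"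
  shows "linear_between (tangent_space At y) (tangent_space A (f y)) (tangent_map At A f y)"
  unfolding linear_between_def
proof (intro conjI ballI allI)
  let ?c = "chart_at At y" and ?c' = "chart_at A (f y)"
  have c: "?c \<in> charts_at At y" "?c' \<in> charts_at A (f y)" using chart_at_in assms by auto
  have e: "tangent_map At A f y v = coord_tvec A ?c' (f y) (chart_deriv ?c ?c' f y (v ?c))"
    if "v \<in> tangent_space At y" for v
    using tangent_map_coord[OF assms c, of "v ?c"] coord_tvec_of_tvec[OF c(1) that] by simp
  show "tangent_map At A f y ` tangent_space At y \<subseteq> tangent_space A (f y)"
    using e coord_tvec_in[OF assms(2) c(2)] by auto
  fix v w r assume v: "v \<in> tangent_space At y" and w: "w \<in> tangent_space At y"
  have "r *\<^sub>R v + w \<in> tangent_space At y" using subspace_tangent_space[OF assms(1)] v w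
    by (intro subspace_lincomb)
  then show "tangent_map At A f y (r *\<^sub>R v + w) = r *\<^sub>R tangent_map At A f y v + tangent_map At A f y w"
    using e v w chart_deriv_linear[OF assms(1,3,4,5) c assms(2)] coord_tvec_linear_between[OF assms(2) c(2)]
    by (simp only: plus_fun_apply scaleR_fun_def linear_add linear_scale linear_between_def UNIV_I ball_simps)
qed

section \<open>The exterior derivative of a scaled pullback\<close>

lemma form_coord_alt_forms:
  assumes "smooth_manifold A" "c \<in> charts_at A x" "\<beta> \<in> alt_forms (tangent_space A x) k"
  shows "(\<lambda>ws. \<beta> (map (coord_tvec A c x) ws)) \<in> alt_forms UNIV k"
  using pull_form_alt_forms[OF coord_tvec_linear_between[OF assms(1,2)] assms(3) subspace_UNIV]
  by (simp add: pull_form_def)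

lemma map_coord_tvec:
  assumes "c \<in> charts_at A x" "set vs \<subseteq> tangent_space A x"
  shows "map (coord_tvec A c x) (map (\<lambda>v. v c) vs) = vs"
  using coord_tvec_of_tvec[OF assms(1)] assms(2) by (induction vs) auto

lemma ext_d_altsum:
  assumes "set vs \<subseteq> tangent_space A x"
  shows "ext_d A \<alpha> x vs = altsum (\<lambda>w us. frechet_derivative
      (\<lambda>u. \<alpha> (cinv (chart_at A x) u) (map (coord_tvec A (chart_at A x) (cinv (chart_at A x) u)) us))
      (at (cmap (chart_at A x) x)) w) (map (\<lambda>v. v (chart_at A x)) vs)"
  using assms by (simp add: ext_d_def altsum_def remove_nth_def Let_def)

lemma diff_forms_alt: "\<alpha> \<in> diff_forms A k \<Longrightarrow> \<alpha> x \<in> alt_forms (tangent_space A x) k"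
  unfolding diff_forms_def by blast

lemma diff_forms_smooth:
  "\<alpha> \<in> diff_forms A k \<Longrightarrow> c \<in> A \<Longrightarrow>
    smooth_on (crange c) (\<lambda>u. \<alpha> (cinv c u) (map (coord_tvec A c (cinv c u)) ws))"
  unfolding diff_forms_def by blast

text \<open>In the chart, the directional derivative of the components is linear in the direction and
  alternating in the remaining arguments, because limits respect these identities.\<close>

lemma ext_d_alt_forms:
  assumes "smooth_manifold A" "\<alpha> \<in> diff_forms A k"
  shows "ext_d A \<alpha> x \<in> alt_forms (tangent_space A x) (Suc k)"
proof -
  let ?c = "chart_at A x"
  have c: "?c \<in> charts_at A x" "?c \<in> A" "x \<in> cdom ?c"
    using chart_at_in[OF assms(1)] chart_at_dom[OF assms(1)] by blast+
  define b where "b u ws = \<alpha> (cinv ?c u) (map (coord_tvec A ?c (cinv ?c u)) ws)" for u ws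
  define g where "g w us = frechet_derivative (\<lambda>u. b u us) (at (cmap ?c x)) w" for w us
  have u0: "cmap ?c x \<in> crange ?c" using c by auto
  have alt: "b u \<in> alt_forms UNIV k" if "u \<in> crange ?c" for u
    unfolding b_def
    by (rule form_coord_alt_forms[OF assms(1) charts_at_cinv[OF c(2) that] diff_forms_alt[OF assms(2)]])
  have d: "((\<lambda>u. b u us) has_derivative (\<lambda>w. g w us)) (at (cmap ?c x))" for us
    unfolding g_def b_def
    by (rule smooth_on_has_derivative[OF diff_forms_smooth[OF assms(2) c(2)] u0])
  have op: "open (crange ?c)" by (rule chart_open[OF assms(1) c(2)])
  have "g w \<in> alt_forms UNIV k" for w
    unfolding alt_forms_def
  proof (intro CollectI conjI allI ballI impI)
    fix vs assume z: "vs \<notin> tuples (UNIV :: 'b set) k"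
    have "((\<lambda>u. 0) has_derivative (\<lambda>w. g w vs)) (at (cmap ?c x))"
      by (rule has_derivative_transform_within_open[OF d op u0]) (use alt_forms_off[OF alt z] in simp)
    from has_derivative_unique[OF this has_derivative_const] show "g w vs = 0" by metis
  next
    fix vs i v v' r assume z: "vs \<in> tuples (UNIV :: 'b set) k" "i < k"
    have "((\<lambda>u. r * b u (vs[i := v]) + b u (vs[i := v'])) has_derivative
        (\<lambda>w. r * g w (vs[i := v]) + g w (vs[i := v']))) (at (cmap ?c x))"
      by (intro has_derivative_add has_derivative_mult_right d)
    then have "((\<lambda>u. b u (vs[i := r *\<^sub>R v + v'])) has_derivative
        (\<lambda>w. r * g w (vs[i := v]) + g w (vs[i := v']))) (at (cmap ?c x))"
      by (rule has_derivative_transform_within_open[OF _ op u0])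
        (use alt_forms_update[OF alt z UNIV_I UNIV_I] in simp)
    from has_derivative_unique[OF d this]
    show "g w (vs[i := r *\<^sub>R v + v']) = r * g w (vs[i := v]) + g w (vs[i := v'])" by metis
  next
    fix vs assume z: "\<not> distinct (vs :: 'b list)"
    have "((\<lambda>u. 0) has_derivative (\<lambda>w. g w vs)) (at (cmap ?c x))"
      by (rule has_derivative_transform_within_open[OF d op u0]) (use alt_forms_repeat[OF alt z] in simp)
    from has_derivative_unique[OF this has_derivative_const] show "g w vs = 0" by metis
  qed
  moreover have "g (r *\<^sub>R v + w) us = r * g v us + g w us" for r v w us
    using linear_add[OF has_derivative_linear[OF d[of us]], of "r *\<^sub>R v" w]
      linear_scale[OF has_derivative_linear[OF d[of us]], of r v] by simp
  ultimately have "(\<lambda>vs. if vs \<in> tuples UNIV (Suc k) then altsum g vs else 0) \<in> alt_forms UNIV (Suc k)"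
    by (intro altsum_alt_forms) auto
  from pull_form_alt_forms[OF tvec_coord_linear_between this subspace_tangent_space[OF assms(1)], of x ?c]
  have "pull_form (tangent_space A x) (\<lambda>v. v ?c) (\<lambda>vs. if vs \<in> tuples UNIV (Suc k) then altsum g vs else 0)
    \<in> alt_forms (tangent_space A x) (Suc k)" .
  moreover have "ext_d A \<alpha> x = pull_form (tangent_space A x) (\<lambda>v. v ?c)
      (\<lambda>vs. if vs \<in> tuples UNIV (Suc k) then altsum g vs else 0)"
  proof
    fix vs
    have "altsum g (map (\<lambda>v. v ?c) vs) = 0" if "length vs \<noteq> Suc k"
    proof -
      have "g w us = 0" if "length us \<noteq> k" for w us
        using \<open>g w \<in> alt_forms UNIV k\<close> alt_forms_off that by (fastforce simp: tuples_def)
      then show ?thesis using that by (auto simp: altsum_def intro!: sum.neutral)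
    qed
    then show "ext_d A \<alpha> x vs = pull_form (tangent_space A x) (\<lambda>v. v ?c)
      (\<lambda>vs. if vs \<in> tuples UNIV (Suc k) then altsum g vs else 0) vs"
      using ext_d_altsum[of vs A x \<alpha>]
      by (auto simp: pull_form_def tuples_def g_def[abs_def] b_def ext_d_def)
  qed
  ultimately show ?thesis by simp
qed

text \<open>The formula \<open>d(\<phi> \<tau>\<^sup>*\<alpha>) = d\<phi> \<and> \<tau>\<^sup>*\<alpha> + \<phi> \<tau>\<^sup>*d\<alpha>\<close>, read in the two charts that enter the definitions of
  \<open>d\<close> at \<open>y\<close> and at \<open>\<tau> y\<close>.\<close>

lemma ext_d_scaled_pullback:
  assumes "smooth_manifold At" "smooth_manifold A" "smooth_map_on At UNIV A \<tau>"
    and "smooth_fun At \<phi>" "\<alpha> \<in> diff_forms A k" "vs \<in> tuples (tangent_space At y) (Suc k)"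
  shows "ext_d At (\<lambda>y. \<phi> y *\<^sub>R pullback At A \<tau> \<alpha> y) y vs =
    altsum (\<lambda>v us. frechet_derivative (\<phi> \<circ> cinv (chart_at At y)) (at (cmap (chart_at At y) y)) (v (chart_at At y))
       * \<alpha> (\<tau> y) (map (tangent_map At A \<tau> y) us)) vs
    + \<phi> y * ext_d A \<alpha> (\<tau> y) (map (tangent_map At A \<tau> y) vs)"
proof -
  let ?c = "chart_at At y" and ?c' = "chart_at A (\<tau> y)"
  have c: "?c \<in> charts_at At y" "?c \<in> At" "y \<in> cdom ?c"
    using chart_at_in[OF assms(1)] chart_at_dom[OF assms(1)] by blast+
  have c': "?c' \<in> charts_at A (\<tau> y)" "?c' \<in> A" "\<tau> y \<in> cdom ?c'"
    using chart_at_in[OF assms(2)] chart_at_dom[OF assms(2)] by blast+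
  let ?f = "cmap ?c' \<circ> \<tau> \<circ> cinv ?c" and ?x = "cmap ?c y"
  let ?S = "cmap ?c ` (cdom ?c \<inter> (UNIV \<inter> \<tau> -` cdom ?c'))" and ?T = "crange ?c'"
  define b where "b u ws = \<alpha> (cinv ?c' u) (map (coord_tvec A ?c' (cinv ?c' u)) ws)" for u ws
  let ?D = "\<lambda>u. frechet_derivative ?f (at u)"
  let ?p = "\<phi> \<circ> cinv ?c"
  have T: "open ?T" "open (cdom ?c')" by (rule chart_open[OF assms(2) c'(2)])+
  note S = smooth_map_rep[OF assms(1,3) open_UNIV c(2) c'(2) T(2)]
  have xS: "?x \<in> ?S" using c c' by auto
  have inv: "cinv ?c u \<in> cdom ?c" "\<tau> (cinv ?c u) \<in> cdom ?c'" "cmap ?c (cinv ?c u) = u"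
      "?c \<in> charts_at At (cinv ?c u)" "?c' \<in> charts_at A (\<tau> (cinv ?c u))" if "u \<in> ?S" for u
    using that cinv_cmap[OF assms(1) c(2)] c(2) c'(2) by (auto simp: charts_at_def)
  have cy: "cinv ?c ?x = y" "?f ?x = cmap ?c' (\<tau> y)" "cinv ?c' (?f ?x) = \<tau> y"
    using cinv_cmap[OF assms(1) c(2,3)] cinv_cmap[OF assms(2) c'(2,3)] by auto
  have alt: "b u \<in> alt_forms UNIV k" if "u \<in> ?T" for u
    unfolding b_def
    by (rule form_coord_alt_forms[OF assms(2) charts_at_cinv[OF c'(2) that] diff_forms_alt[OF assms(5)]])
  have bs: "smooth_on ?T (\<lambda>u. b u vs)" for vs unfolding b_def by (rule diff_forms_smooth[OF assms(5) c'(2)])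
  have ps: "smooth_on ?S ?p"
    using assms(4) c(2) smooth_on_subset[of "crange ?c" ?p ?S] by (auto simp: smooth_fun_def)
  have tm: "tangent_map At A \<tau> (cinv ?c u) (coord_tvec At ?c (cinv ?c u) w) = coord_tvec A ?c' (cinv ?c' (?f u)) (?D u w)"
    if "u \<in> ?S" for u w
    using tangent_map_coord[OF assms(1,2,3) open_UNIV UNIV_I inv(4,5)[OF that], of w]
      inv(2,3)[OF that] cinv_cmap[OF assms(2) c'(2)] by (simp add: chart_deriv_def)
  (* In the two charts the scaled pullback is the function to which pullback_altsum applies. *)
  have rep: "(\<phi> (cinv ?c u) *\<^sub>R pullback At A \<tau> \<alpha> (cinv ?c u)) (map (coord_tvec At ?c (cinv ?c u)) us)
      = ?p u * b (?f u) (map (?D u) us)" if "u \<in> ?S" for u us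
  proof -
    have "set (map (coord_tvec At ?c (cinv ?c u)) us) \<subseteq> tangent_space At (cinv ?c u)"
      using coord_tvec_in[OF assms(1) inv(4)[OF that]] by auto
    moreover have "map (tangent_map At A \<tau> (cinv ?c u)) (map (coord_tvec At ?c (cinv ?c u)) us)
      = map (coord_tvec A ?c' (cinv ?c' (?f u))) (map (?D u) us)" using tm[OF that] by simp
    moreover have "cinv ?c' (?f u) = \<tau> (cinv ?c u)"
      using cinv_cmap[OF assms(2) c'(2) inv(2)[OF that]] by simp
    ultimately show ?thesis
      by (simp add: scaleR_fun_def pullback_def pull_form_def b_def del: map_map)
  qed
  have fT: "?f ` ?S \<subseteq> ?T" using inv(2) by auto
  have vs: "set vs \<subseteq> tangent_space At y" "length vs = Suc k" using assms(6) by (auto simp: tuples_def)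
  let ?ws = "map (\<lambda>v. v ?c) vs"
  have lT: "linear_between (tangent_space At y) (tangent_space A (\<tau> y)) (tangent_map At A \<tau> y)"
    by (rule tangent_map_linear_between[OF assms(1,2,3) open_UNIV UNIV_I])
  have tmv: "tangent_map At A \<tau> y v ?c' = ?D ?x (v ?c)" if "v \<in> tangent_space At y" for v
    using tangent_map_apply[OF assms(1,2,3) open_UNIV UNIV_I that c(1) c'(1)] by (simp add: chart_deriv_def)
  have mp: "map (\<lambda>v. v ?c') (map (tangent_map At A \<tau> y) us) = map (?D ?x) (map (\<lambda>v. v ?c) us)"
    if "set us \<subseteq> tangent_space At y" for us using that tmv by auto
  have mps: "set (map (tangent_map At A \<tau> y) us) \<subseteq> tangent_space A (\<tau> y)"
    if "set us \<subseteq> tangent_space At y" for us using that linear_between_mem[OF lT] by auto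
  have bx: "b (?f ?x) (map (?D ?x) (map (\<lambda>v. v ?c) us)) = \<alpha> (\<tau> y) (map (tangent_map At A \<tau> y) us)"
    if "set us \<subseteq> tangent_space At y" for us
    unfolding b_def cy(3) mp[OF that, symmetric] map_coord_tvec[OF c'(1) mps[OF that]] ..
  have "ext_d At (\<lambda>y. \<phi> y *\<^sub>R pullback At A \<tau> \<alpha> y) y vs =
     altsum (\<lambda>w us. frechet_derivative (\<lambda>u. (\<phi> (cinv ?c u) *\<^sub>R pullback At A \<tau> \<alpha> (cinv ?c u))
        (map (coord_tvec At ?c (cinv ?c u)) us)) (at ?x) w) ?ws"
    by (rule ext_d_altsum[OF vs(1)])
  also have "\<dots> = altsum (\<lambda>w us. frechet_derivative (\<lambda>u. ?p u * b (?f u) (map (?D u) us)) (at ?x) w) ?ws"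
  proof -
    have "frechet_derivative (\<lambda>u. (\<phi> (cinv ?c u) *\<^sub>R pullback At A \<tau> \<alpha> (cinv ?c u))
        (map (coord_tvec At ?c (cinv ?c u)) us)) (at ?x)
      = frechet_derivative (\<lambda>u. ?p u * b (?f u) (map (?D u) us)) (at ?x)" if "length us = k" for us
    proof (rule frechet_derivative_transform_within_open[OF _ S(1) xS, symmetric])
      have "smooth_on ?S (\<lambda>u. b (?f u) (map (?D u) us))"
      proof (rule alt_form_family_smooth[OF S(1)])
        show "b (?f u) \<in> alt_forms UNIV (length us)" if "u \<in> ?S" for u
          unfolding \<open>length us = k\<close> by (rule alt[OF subsetD[OF fT imageI[OF that]]])
        show "smooth_on ?S (\<lambda>u. b (?f u) vs)" for vs
          by (rule smooth_on_compose[OF S(1) T(1) bs S(2) fT])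
        show "smooth_on ?S (\<lambda>u. ?D u w)" for w by (rule smooth_on_frechet_derivative[OF S(2)])
      qed
      then have "smooth_on ?S (\<lambda>u. ?p u * b (?f u) (map (?D u) us))"
        by (rule smooth_on_mult[OF S(1) ps])
      then show "(\<lambda>u. ?p u * b (?f u) (map (?D u) us)) differentiable at ?x"
        using smooth_on_differentiable xS by blast
    qed (use rep in simp)
    then show ?thesis using vs(2) by (simp add: altsum_def)
  qed
  also have "\<dots> = altsum (\<lambda>w us. frechet_derivative ?p (at ?x) w * b (?f ?x) (map (?D ?x) us)) ?ws
      + ?p ?x * altsum (\<lambda>w us. frechet_derivative (\<lambda>u. b u us) (at (?f ?x)) w) (map (?D ?x) ?ws)"
    by (rule pullback_altsum[OF S fT T(1) xS ps alt bs]) (use vs in auto)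
  also have "altsum (\<lambda>w us. frechet_derivative ?p (at ?x) w * b (?f ?x) (map (?D ?x) us)) ?ws =
     altsum (\<lambda>v us. frechet_derivative ?p (at ?x) (v ?c) * \<alpha> (\<tau> y) (map (tangent_map At A \<tau> y) us)) vs"
    unfolding altsum_def length_map
    by (intro sum.cong refl, subst map_remove_nth[symmetric],
        subst bx[OF order_trans[OF set_remove_nth vs(1)]]) simp
  also have "altsum (\<lambda>w us. frechet_derivative (\<lambda>u. b u us) (at (?f ?x)) w) (map (?D ?x) ?ws) =
      ext_d A \<alpha> (\<tau> y) (map (tangent_map At A \<tau> y) vs)"
    unfolding ext_d_altsum[OF mps[OF vs(1)]] mp[OF vs(1)] cy(2) b_def ..
  finally show ?thesis unfolding o_apply cy(1) .
qed

section \<open>Multivector fields in charts\<close>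

abbreviation mv_coord ::
    "('m, 'e::real_normed_vector) atlas \<Rightarrow> ('m, 'e) chart \<Rightarrow> ('m, 'e) mv_field \<Rightarrow> ('e list \<Rightarrow> real) \<Rightarrow> 'e \<Rightarrow> real"
  where "mv_coord A c X \<beta> u \<equiv> X (cinv c u) (pull_form (tangent_space A (cinv c u)) (\<lambda>v. v c) \<beta>)"

text \<open>Components are required in every chart, so that the local pieces that are glued together later may
  come from different charts.\<close>

definition mv_smooth_on :: "('m, 'e::real_normed_vector) atlas \<Rightarrow> nat \<Rightarrow> 'm set \<Rightarrow> ('m, 'e) mv_field \<Rightarrow> bool"
  where "mv_smooth_on A p N X \<longleftrightarrow> (\<forall>c\<in>A. \<forall>\<beta>\<in>alt_forms UNIV p. smooth_on (cmap c ` (cdom c \<inter> N))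
    (mv_coord A c X \<beta>))"

lemma mv_fields_iff:
  "X \<in> mv_fields A p \<longleftrightarrow> (\<forall>x. X x \<in> ext_power (tangent_space A x) p) \<and> mv_smooth_on A p UNIV X"
  by (simp add: mv_fields_def mv_smooth_on_def)

lemma mv_fields_ext_power: "X \<in> mv_fields A p \<Longrightarrow> X x \<in> ext_power (tangent_space A x) p"
  by (simp add: mv_fields_iff)

lemma mv_fields_smooth:
  assumes "X \<in> mv_fields A p" "c \<in> A" "\<beta> \<in> alt_forms UNIV p"
  shows "smooth_on (cmap c ` (cdom c \<inter> UNIV)) (mv_coord A c X \<beta>)"
  using assms by (simp add: mv_fields_def)

lemma mv_pairing_smooth:
  fixes A :: "('m::{t2_space, second_countable_topology}, 'e::euclidean_space) atlas"
    and g :: "'a::real_normed_vector \<Rightarrow> 'e"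
  assumes "smooth_manifold A" "c \<in> A" "open N"
    and "\<And>x. x \<in> N \<Longrightarrow> X x \<in> ext_power (tangent_space A x) p"
    and "\<And>\<beta>. \<beta> \<in> alt_forms UNIV p \<Longrightarrow> smooth_on (cmap c ` (cdom c \<inter> N))
       (mv_coord A c X \<beta>)"
    and "open S" "smooth_on S g" "g ` S \<subseteq> cmap c ` (cdom c \<inter> N)"
    and "\<And>u. u \<in> S \<Longrightarrow> b u \<in> alt_forms UNIV p" "\<And>vs. smooth_on S (\<lambda>u. b u vs)"
  shows "smooth_on S (\<lambda>u. mv_coord A c X (b u) (g u))"
proof -
  let ?Y = "\<lambda>u. ext_map (tangent_space A (cinv c (g u))) UNIV p (\<lambda>v. v c) (X (cinv c (g u)))"
  have "smooth_on S (\<lambda>u. ?Y u (b u))"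
  proof (rule pairing_smooth[OF assms(6) _ _ assms(9,10)])
    show "?Y u \<in> ext_power UNIV p" if "u \<in> S" for u
    proof (rule ext_map_in_ext_power[OF assms(4) tvec_coord_linear_between subspace_tangent_space[OF assms(1)]])
      show "cinv c (g u) \<in> N" using that assms(8) cinv_cmap[OF assms(1,2)] by force
    qed
    show "smooth_on S (\<lambda>u. ?Y u \<beta>)" if "\<beta> \<in> alt_forms UNIV p" for \<beta>
      using smooth_on_compose[OF assms(6) open_chart_image[OF assms(1-3)] assms(5)[OF that] assms(7,8)] that
      by (simp add: ext_map_def)
  qed
  then show ?thesis
    by (rule smooth_on_cong[OF assms(6), rotated]) (simp add: ext_map_def assms(9))
qed

text \<open>The composite \<open>u \<mapsto> \<langle>X, H(u)\<^sup>*b(u)\<rangle>\<close> at the point with coordinates \<open>g(u)\<close>; it serves both for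
  changing the chart and for pushing a field forward along a smooth family of linear maps.\<close>

lemma mv_transport_smooth:
  fixes A :: "('m::{t2_space, second_countable_topology}, 'e::euclidean_space) atlas"
    and g :: "'a::real_normed_vector \<Rightarrow> 'e" and H :: "'a \<Rightarrow> 'e \<Rightarrow> 'k::euclidean_space"
  assumes "smooth_manifold A" "c \<in> A" "open N"
    and "\<And>x. x \<in> N \<Longrightarrow> X x \<in> ext_power (tangent_space A x) p"
    and "\<And>\<beta>. \<beta> \<in> alt_forms UNIV p \<Longrightarrow> smooth_on (cmap c ` (cdom c \<inter> N)) (mv_coord A c X \<beta>)"
    and "open S" "smooth_on S g" "g ` S \<subseteq> cmap c ` (cdom c \<inter> N)"
    and "\<And>u. u \<in> S \<Longrightarrow> linear (H u)" "\<And>w. smooth_on S (\<lambda>u. H u w)"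
    and "\<And>u. u \<in> S \<Longrightarrow> b u \<in> alt_forms UNIV p" "\<And>vs. smooth_on S (\<lambda>u. b u vs)"
  shows "smooth_on S (\<lambda>u. mv_coord A c X (pull_form UNIV (H u) (b u)) (g u))"
proof (rule mv_pairing_smooth[OF assms(1-8)])
  have l: "linear_between UNIV UNIV (H u)" if "u \<in> S" for u
    using assms(9)[OF that] by (simp add: linear_between_def linear_add linear_scale)
  show alt: "pull_form UNIV (H u) (b u) \<in> alt_forms UNIV p" if "u \<in> S" for u
    by (rule pull_form_alt_forms[OF l[OF that] assms(11)[OF that] subspace_UNIV])
  show "smooth_on S (\<lambda>u. pull_form UNIV (H u) (b u) vs)" for vs
  proof (cases "length vs = p")
    case True
    have "smooth_on S (\<lambda>u. b u (map (H u) vs))"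
      by (rule alt_form_family_smooth[OF assms(6) _ assms(12,10)]) (use assms(11) True in simp)
    then show ?thesis by (simp add: pull_form_def)
  next
    case False
    show ?thesis
      by (rule smooth_on_cong[OF assms(6) _ smooth_on_const[of _ 0]])
        (use False alt_forms_off[OF alt] in \<open>simp add: tuples_def\<close>)
  qed
qed

lemma mv_change_chart:
  assumes "smooth_manifold A" "c \<in> A" "open N"
    and "\<And>x. x \<in> N \<Longrightarrow> X x \<in> ext_power (tangent_space A x) p"
    and "\<And>\<beta>. \<beta> \<in> alt_forms UNIV p \<Longrightarrow> smooth_on (cmap c ` (cdom c \<inter> N))
       (mv_coord A c X \<beta>)"
    and "c' \<in> A" "\<beta> \<in> alt_forms UNIV p"
  shows "smooth_on (cmap c' ` (cdom c' \<inter> (cdom c \<inter> N)))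
       (mv_coord A c' X \<beta>)"
proof -
  let ?S = "cmap c' ` (cdom c' \<inter> (cdom c \<inter> N))"
  let ?T = "cmap c ` (cdom c \<inter> (cdom c' \<inter> N))"
  let ?g = "cmap c \<circ> cinv c'" and ?h = "cmap c' \<circ> cinv c"
  let ?D = "\<lambda>u. frechet_derivative ?h (at (?g u))"
  have S: "open ?S" using assms(1,2,3,6) by (intro open_chart_image chart_open open_Int)
  have T: "open ?T" using assms(1,2,3,6) by (intro open_chart_image chart_open open_Int)
  have tr: "smooth_on (cmap c ` (cdom c \<inter> cdom c')) (cmap c' \<circ> cinv c)" if "c \<in> A" "c' \<in> A" for c c'
    using assms(1) that by (simp add: smooth_manifold_def)
  have gS: "smooth_on ?S ?g" by (rule smooth_on_subset[OF tr[OF assms(6,2)]]) auto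
  have hT: "smooth_on ?T ?h" by (rule smooth_on_subset[OF tr[OF assms(2,6)]]) auto
  have S_mem: "cinv c' u \<in> cdom c' \<inter> (cdom c \<inter> N)" if "u \<in> ?S" for u
    using that cinv_cmap[OF assms(1,6)] by auto
  have gT: "?g ` ?S \<subseteq> ?T" using S_mem by auto
  have gi: "cinv c (?g u) = cinv c' u" if "u \<in> ?S" for u
    using cinv_cmap[OF assms(1,2)] S_mem[OF that] by simp
  have Dt: "?D u (v c) = v c'" if "u \<in> ?S" "v \<in> tangent_space A (cinv c' u)" for u v
  proof -
    have "c \<in> charts_at A (cinv c' u)" "c' \<in> charts_at A (cinv c' u)"
      using S_mem[OF that(1)] assms(2,6) by (simp_all add: charts_at_def)
    from tangent_spaceD[OF that(2) this] show ?thesis by (simp add: chart_deriv_def)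
  qed
  have Dl: "linear (?D u)" if "u \<in> ?S" for u
    using smooth_on_differentiable[OF hT] gT that linear_frechet_derivative by blast
  have Ds: "smooth_on ?S (\<lambda>u. ?D u w)" for w
    by (rule smooth_on_compose[OF S T smooth_on_frechet_derivative[OF hT] gS gT])
  have "?g ` ?S \<subseteq> cmap c ` (cdom c \<inter> N)" using gT by auto
  from mv_transport_smooth[OF assms(1-5) S gS this Dl Ds assms(7) smooth_on_const]
  have "smooth_on ?S (\<lambda>u. mv_coord A c X (pull_form UNIV (?D u) \<beta>) (?g u))" .
  then show ?thesis
  proof (rule smooth_on_cong[OF S, rotated])
    fix u assume u: "u \<in> ?S"
    have "pull_form (tangent_space A (cinv c' u)) (\<lambda>v. v c) (pull_form UNIV (?D u) \<beta>) =
        pull_form (tangent_space A (cinv c' u)) (\<lambda>v. v c') \<beta>"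
    proof
      fix vs
      have "map (?D u) (map (\<lambda>v. v c) vs) = map (\<lambda>v. v c') vs" if "set vs \<subseteq> tangent_space A (cinv c' u)"
        using Dt[OF u] that by auto
      then show "pull_form (tangent_space A (cinv c' u)) (\<lambda>v. v c) (pull_form UNIV (?D u) \<beta>) vs =
          pull_form (tangent_space A (cinv c' u)) (\<lambda>v. v c') \<beta> vs"
        by (simp add: pull_form_def del: map_map)
    qed
    then show "mv_coord A c X (pull_form UNIV (?D u) \<beta>) (?g u) = mv_coord A c' X \<beta> u"
      by (simp only: gi[OF u])
  qed
qed

lemma mv_smooth_on_one_chart:
  assumes "smooth_manifold A" "c \<in> A" "open N" "N \<subseteq> cdom c"
    and "\<And>x. x \<in> N \<Longrightarrow> X x \<in> ext_power (tangent_space A x) p"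
    and "\<And>\<beta>. \<beta> \<in> alt_forms UNIV p \<Longrightarrow> smooth_on (cmap c ` N)
       (mv_coord A c X \<beta>)"
  shows "mv_smooth_on A p N X"
proof -
  have "cdom c \<inter> N = N" using assms(4) by auto
  then show ?thesis
    using mv_change_chart[OF assms(1-3,5)] assms(6) unfolding mv_smooth_on_def by simp
qed

lemma iota_diff_forms:
  assumes "smooth_manifold A" "X \<in> mv_fields A p" "\<Theta> \<in> diff_forms A (p + k)"
  shows "iota X \<Theta> \<in> diff_forms A k"
  unfolding diff_forms_def
proof (intro CollectI conjI allI ballI)
  show "iota X \<Theta> x \<in> alt_forms (tangent_space A x) k" for x
    unfolding iota_def
    by (rule contract_alt_forms[OF mv_fields_ext_power[OF assms(2)] diff_forms_alt[OF assms(3)]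
          subspace_tangent_space[OF assms(1)]])
  fix c ws assume c: "c \<in> A"
  let ?x = "cinv c"
  let ?E = "\<lambda>u. coord_tvec A c (?x u)"
  have op: "open (crange c)" by (rule chart_open[OF assms(1) c])
  have ch: "c \<in> charts_at A (?x u)" if "u \<in> crange c" for u using charts_at_cinv[OF c that] .
  show "smooth_on (crange c) (\<lambda>u. iota X \<Theta> (cinv c u) (map (coord_tvec A c (cinv c u)) ws))"
  proof (cases "length ws = k")
    case False
    have "iota X \<Theta> (cinv c u) (map (?E u) ws) = 0" for u
      unfolding iota_def
      by (rule contract_off[OF mv_fields_ext_power[OF assms(2)] diff_forms_alt[OF assms(3)]])
        (use False in \<open>simp add: tuples_def\<close>)
    then show ?thesis by (simp add: smooth_on_const)
  next
    case True
    define b where "b u = (\<lambda>vs. \<Theta> (?x u) (map (?E u) (vs @ ws)))" for u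
    have b_alt: "b u \<in> alt_forms UNIV p" if "u \<in> crange c" for u
      unfolding b_def
      by (rule alt_forms_append[OF form_coord_alt_forms[OF assms(1) ch[OF that] diff_forms_alt[OF assms(3)]]])
        (use True in \<open>simp add: tuples_def\<close>)
    have b_smooth: "smooth_on (crange c) (\<lambda>u. b u vs)" for vs
      unfolding b_def by (rule diff_forms_smooth[OF assms(3) c])

    have "smooth_on (crange c) (\<lambda>u. X (?x u) (pull_form (tangent_space A (?x u)) (\<lambda>v. v c) (b u)))"
      by (rule mv_pairing_smooth[OF assms(1) c open_UNIV mv_fields_ext_power[OF assms(2)] mv_fields_smooth[OF assms(2) c] op
            smooth_on_bounded_linear[OF op bounded_linear_ident] _ b_alt b_smooth]) auto
    then show ?thesis
    proof (rule smooth_on_cong[OF op, rotated])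
      fix u assume u: "u \<in> crange c"
      have "pull_form (tangent_space A (?x u)) (\<lambda>v. v c) (b u) = (\<lambda>vs. \<Theta> (?x u) (vs @ map (?E u) ws))"
      proof
        fix vs
        show "pull_form (tangent_space A (?x u)) (\<lambda>v. v c) (b u) vs = \<Theta> (?x u) (vs @ map (?E u) ws)"
        proof (cases "set vs \<subseteq> tangent_space A (?x u)")
          case True
          then show ?thesis using map_coord_tvec[OF ch[OF u] True] by (simp add: pull_form_def b_def del: map_map)
        next
          case False
          then have "vs @ map (?E u) ws \<notin> tuples (tangent_space A (?x u)) (p + k)" by (auto simp: tuples_def)
          then show ?thesis using False alt_forms_off[OF diff_forms_alt[OF assms(3)]] by (simp add: pull_form_def)
        qed
      qed
      then show "X (?x u) (pull_form (tangent_space A (?x u)) (\<lambda>v. v c) (b u)) = iota X \<Theta> (?x u) (map (?E u) ws)"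
        by (simp add: iota_def contract_def)
    qed
  qed
qed

section \<open>Partitions of unity\<close>

text \<open>The powers of \<open>1/t\<close> make the family closed under differentiation; \<open>m = 0\<close> is the usual function
  \<open>exp (-1/t)\<close>.\<close>

definition flat_exp :: "nat \<Rightarrow> real \<Rightarrow> real"
  where "flat_exp m t = (if t > 0 then inverse t ^ m / exp (inverse t) else 0)"

lemma flat_exp_tendsto_0: "(flat_exp m \<longlongrightarrow> 0) (at 0)"
proof (rule filterlim_split_at)
  show "(flat_exp m \<longlongrightarrow> 0) (at_left 0)"
    by (rule tendsto_eventually) (auto simp: flat_exp_def eventually_at_filter)
  have "((\<lambda>t. inverse t ^ m / exp (inverse t)) \<longlongrightarrow> (0::real)) (at_right 0)"
    using filterlim_compose[OF tendsto_power_div_exp_0 filterlim_inverse_at_top_right] .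
  then show "(flat_exp m \<longlongrightarrow> 0) (at_right 0)"
    by (rule Lim_transform_eventually) (auto simp: flat_exp_def eventually_at_filter)
qed

lemma flat_exp_has_derivative:
  "(flat_exp m has_real_derivative (flat_exp (m + 2) t - real m * flat_exp (m + 1) t)) (at t)"
proof -
  consider "t < 0" | "t = 0" | "t > 0" by linarith
  then show ?thesis
  proof cases
    case 1
    have "((\<lambda>_. 0) has_real_derivative 0) (at t)" by simp
    then have "(flat_exp m has_real_derivative 0) (at t)"
      by (rule DERIV_cong_ev[THEN iffD1, rotated 3])
        (use 1 eventually_nhds_in_open[of "{..<0}" t] in \<open>auto simp: flat_exp_def elim!: eventually_mono\<close>)
    then show ?thesis using 1 by (simp add: flat_exp_def)
  next
    case 2
    have "((\<lambda>h. (flat_exp m (0 + h) - flat_exp m 0) / h) \<longlongrightarrow> 0) (at 0)"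
      by (rule Lim_transform_eventually[OF flat_exp_tendsto_0[of "Suc m"]])
        (auto simp: flat_exp_def eventually_at_filter field_simps)
    then show ?thesis using 2 by (simp add: DERIV_def flat_exp_def)
  next
    case 3
    have "((\<lambda>x. x ^ m / exp x) has_real_derivative real m * x ^ (m - 1) / exp x - x ^ m / exp x) (at x)" for x :: real
      by (auto intro!: derivative_eq_intros simp: field_simps)
    from DERIV_chain2[OF this DERIV_inverse[of t UNIV]] 3
    have d: "((\<lambda>t. inverse t ^ m / exp (inverse t)) has_real_derivative
        (real m * inverse t ^ (m - 1) / exp (inverse t) - inverse t ^ m / exp (inverse t)) * - (inverse t ^ Suc (Suc 0))) (at t)"
      by simp
    have "(real m * x ^ (m - 1) / exp x - x ^ m / exp x) * - (x ^ Suc (Suc 0))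
        = x ^ (m + 2) / exp x - real m * (x ^ (m + 1) / exp x)" for x :: real
      by (cases m) (simp_all add: field_simps)
    from d[unfolded this]
    have "(flat_exp m has_real_derivative
        inverse t ^ (m + 2) / exp (inverse t) - real m * (inverse t ^ (m + 1) / exp (inverse t))) (at t)"
      by (rule DERIV_cong_ev[THEN iffD1, rotated 3])
        (use 3 eventually_nhds_in_open[of "{0<..}" t] in \<open>auto simp: flat_exp_def elim!: eventually_mono\<close>)
    then show ?thesis using 3 by (simp add: flat_exp_def)
  qed
qed

lemma smooth_on_flat_exp: "smooth_on UNIV (flat_exp m)"
proof -
  have "Ck_on k UNIV (flat_exp m)" for k
  proof (induction k arbitrary: m)
    case 0
    show ?case
      using DERIV_isCont[OF flat_exp_has_derivative] by (simp add: continuous_at_imp_continuous_on)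
  next
    case (Suc k)
    have "Ck_on k UNIV (\<lambda>t. (flat_exp (m + 2) t + (- real m) * flat_exp (m + 1) t) * v)" for v
      by (intro Ck_on_bilinear[OF _ bounded_bilinear_mult] Ck_on_add Suc.IH Ck_on_const open_UNIV)
    then have "Ck_on k UNIV (\<lambda>t. (flat_exp (m + 2) t - real m * flat_exp (m + 1) t) * v)" for v by simp
    then show ?case
      using flat_exp_has_derivative[of m] unfolding has_field_derivative_def
      by (intro Ck_on_SucI[of _ _ "\<lambda>t. (*) (flat_exp (m + 2) t - real m * flat_exp (m + 1) t)"]) auto
  qed
  then show ?thesis by (simp add: smooth_on_def)
qed

abbreviation bump :: "real \<Rightarrow> real" where "bump \<equiv> flat_exp 0"

lemma bump_pos: "t > 0 \<Longrightarrow> bump t > 0" and bump_zero: "t \<le> 0 \<Longrightarrow> bump t = 0"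
  and bump_nonneg: "bump t \<ge> 0"
  by (auto simp: flat_exp_def)



lemma smooth_fun_mult:
  "smooth_manifold A \<Longrightarrow> smooth_fun A f \<Longrightarrow> smooth_fun A g \<Longrightarrow> smooth_fun A (\<lambda>x. f x * g x)"
  unfolding smooth_fun_def o_def using chart_open(2) smooth_on_mult by blast

lemma smooth_fun_prod:
  "smooth_manifold A \<Longrightarrow> (\<And>i. i \<in> I \<Longrightarrow> smooth_fun A (f i)) \<Longrightarrow> smooth_fun A (\<lambda>x. \<Prod>i\<in>I. f i x)"
  unfolding smooth_fun_def o_def using chart_open(2) by (auto intro!: smooth_on_prod)

lemma smooth_fun_compose:
  assumes "smooth_manifold A" "smooth_fun A f" "smooth_on UNIV (h :: real \<Rightarrow> real)"
  shows "smooth_fun A (\<lambda>x. h (f x))"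
  unfolding smooth_fun_def o_def
proof
  fix c assume c: "c \<in> A"
  show "smooth_on (crange c) (\<lambda>u. h (f (cinv c u)))"
    by (rule smooth_on_compose[OF chart_open(2)[OF assms(1) c] open_UNIV assms(3)])
      (use assms(2) c in \<open>auto simp: smooth_fun_def o_def\<close>)
qed

lemma smooth_fun_continuous:
  assumes "smooth_manifold A" "smooth_fun A f"
  shows "continuous_on UNIV f"
proof (rule continuous_at_imp_continuous_on, rule ballI)
  fix x
  let ?c = "chart_at A x"
  have c: "?c \<in> A" "x \<in> cdom ?c" by (rule chart_at_dom[OF assms(1)])+
  have f: "continuous_on (crange ?c) (f \<circ> cinv ?c)"
    using assms(2) c(1) unfolding smooth_fun_def by (intro smooth_on_continuous) blast
  have "continuous_on (cdom ?c) (\<lambda>x. (f \<circ> cinv ?c) (cmap ?c x))"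
    by (rule continuous_on_compose2[OF f chart_continuous(1)[OF assms(1) c(1)]]) simp
  then have "continuous_on (cdom ?c) f"
    by (rule continuous_on_cong[THEN iffD1, rotated 2]) (use cinv_cmap[OF assms(1) c(1)] in auto)
  then show "isCont f x"
    using c(2) chart_open(1)[OF assms(1) c(1)] continuous_on_eq_continuous_at by blast
qed

lemma smooth_fun_local:
  assumes "smooth_manifold A"
    and "\<And>c x. c \<in> A \<Longrightarrow> x \<in> cdom c \<Longrightarrow> \<exists>N. open N \<and> x \<in> N \<and> smooth_on (cmap c ` (cdom c \<inter> N)) (f \<circ> cinv c)"
  shows "smooth_fun A f"
  unfolding smooth_fun_def
proof
  fix c assume c: "c \<in> A"
  show "smooth_on (crange c) (f \<circ> cinv c)"
  proof (rule smooth_on_local[OF chart_open(2)[OF assms(1) c]])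
    fix u assume u: "u \<in> crange c"
    obtain N where N: "open N" "cinv c u \<in> N" "smooth_on (cmap c ` (cdom c \<inter> N)) (f \<circ> cinv c)"
      using assms(2)[OF c cinv_in_cdom[OF u]] by blast
    have "u \<in> cmap c ` (cdom c \<inter> N)" using chart_image_eq[OF assms(1) c, of N] u N(2) by auto
    then show "\<exists>U. open U \<and> u \<in> U \<and> smooth_on (U \<inter> crange c) (f \<circ> cinv c)"
      using open_chart_image[OF assms(1) c N(1)] smooth_on_subset[OF N(3)] by blast
  qed
qed

text \<open>A function of the squared distance in a chart, extended by \<open>0\<close>. The extension is smooth since the
  support lies in the image of a compact ball, which is closed in a Hausdorff space.\<close>

lemma bump_function_exists:
  assumes "smooth_manifold A" "open N" "y \<in> N"
  shows "\<exists>f K. smooth_fun A f \<and> (\<forall>x. f x \<ge> 0) \<and> f y > 0 \<and> closed K \<and> K \<subseteq> N \<and> (\<forall>x. x \<notin> K \<longrightarrow> f x = 0)"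
proof -
  let ?c = "chart_at A y"
  have c: "?c \<in> A" "y \<in> cdom ?c" by (rule chart_at_dom[OF assms(1)])+
  let ?u = "cmap ?c y"
  have "open (cmap ?c ` (cdom ?c \<inter> N))" "?u \<in> cmap ?c ` (cdom ?c \<inter> N)"
    using open_chart_image[OF assms(1) c(1) assms(2)] c assms(3) by auto
  then obtain r where r: "r > 0" "cball ?u r \<subseteq> cmap ?c ` (cdom ?c \<inter> N)"
    using open_contains_cball by blast
  define K where "K = cinv ?c ` cball ?u r"
  define q where "q v = r\<^sup>2 - (v - ?u) \<bullet> (v - ?u)" for v
  define f where "f x = (if x \<in> cdom ?c then bump (q (cmap ?c x)) else 0)" for x
  have "continuous_on (cball ?u r) (cinv ?c)"
    by (rule continuous_on_subset[OF chart_continuous(2)[OF assms(1) c(1)]]) (use r(2) in auto)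
  then have K: "closed K"
    unfolding K_def by (intro compact_imp_closed compact_continuous_image compact_cball)
  have KN: "K \<subseteq> cdom ?c \<inter> N"
    using r(2) cinv_cmap[OF assms(1) c(1)] by (force simp: K_def)
  have f0: "f x = 0" if "x \<notin> K" for x
  proof (cases "x \<in> cdom ?c")
    case True
    then have "cmap ?c x \<notin> cball ?u r" using that cinv_cmap[OF assms(1) c(1) True] by (force simp: K_def)
    then have "r < norm (cmap ?c x - ?u)" by (simp add: dist_norm norm_minus_commute)
    then have "r\<^sup>2 < (norm (cmap ?c x - ?u))\<^sup>2" using r(1) by (intro power_strict_mono) auto
    then show ?thesis using True by (simp add: f_def q_def dot_square_norm bump_zero)
  qed (simp add: f_def)
  have q_smooth: "smooth_on S q" if "open S" for S
    unfolding q_def using that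
    by (intro smooth_on_diff smooth_on_inner smooth_on_const smooth_on_bounded_linear bounded_linear_ident)
  have "smooth_fun A f"
  proof (rule smooth_fun_local[OF assms(1)])
    fix c' x assume c': "c' \<in> A" "x \<in> cdom c'"
    show "\<exists>N. open N \<and> x \<in> N \<and> smooth_on (cmap c' ` (cdom c' \<inter> N)) (f \<circ> cinv c')"
    proof (cases "x \<in> cdom ?c")
      case False
      let ?S = "cmap c' ` (cdom c' \<inter> - K)"
      have op: "open ?S" using open_chart_image[OF assms(1) c'(1)] K by (auto simp: closed_def)
      have "smooth_on ?S (f \<circ> cinv c')"
        by (rule smooth_on_cong[OF op _ smooth_on_const[of _ 0]])
          (use f0 cinv_cmap[OF assms(1) c'(1)] in auto)
      moreover have "x \<notin> K" using KN False by auto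
      ultimately show ?thesis using K by (intro exI[of _ "- K"]) (auto simp: closed_def)
    next
      case True
      let ?S = "cmap c' ` (cdom c' \<inter> cdom ?c)"
      have op: "open ?S" using open_chart_image[OF assms(1) c'(1) chart_open(1)[OF assms(1) c(1)]] .
      have "smooth_on ?S (cmap ?c \<circ> cinv c')" using assms(1) c(1) c'(1) by (simp add: smooth_manifold_def)
      then have "smooth_on ?S (\<lambda>u. q ((cmap ?c \<circ> cinv c') u))"
        by (rule smooth_on_compose[OF op open_UNIV q_smooth[OF open_UNIV]]) simp
      then have "smooth_on ?S (\<lambda>u. bump (q ((cmap ?c \<circ> cinv c') u)))"
        by (rule smooth_on_compose[OF op open_UNIV smooth_on_flat_exp]) simp
      then have "smooth_on ?S (f \<circ> cinv c')"
        by (rule smooth_on_cong[OF op, rotated]) (use cinv_cmap[OF assms(1) c'(1)] in \<open>auto simp: f_def\<close>)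
      then show ?thesis using True chart_open(1)[OF assms(1) c(1)] by blast
    qed
  qed
  moreover have "f y > 0" using c(2) r(1) by (simp add: f_def q_def bump_pos)
  moreover have "f x \<ge> 0" for x by (simp add: f_def bump_nonneg)
  ultimately show ?thesis using K KN f0 by blast
qed

text \<open>Countably many bump functions \<open>f\<^sub>i\<close> have positivity sets that cover the manifold. Multiplying \<open>f\<^sub>i\<close>
  with functions that are positive only where \<open>f\<^sub>j < 1/(i+1)\<close>, for all \<open>j < i\<close>, makes the family
  locally finite: near a point with \<open>f\<^sub>j > a > 0\<close> all sufficiently late products vanish. Positivity
  survives at the first index \<open>i\<close> with \<open>f\<^sub>i > 0\<close>.\<close>

lemma locally_finite_bumps:
  fixes A :: "('m::{t2_space, second_countable_topology}, 'e::euclidean_space) atlas"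
  assumes "smooth_manifold A" "\<And>x. open (N x) \<and> x \<in> N x"
  shows "\<exists>(g :: nat \<Rightarrow> 'm \<Rightarrow> real) z K. (\<forall>i. smooth_fun A (g i) \<and> closed (K i) \<and> K i \<subseteq> N (z i) \<and> (\<forall>x. g i x \<ge> 0 \<and> (x \<notin> K i \<longrightarrow> g i x = 0)))
    \<and> (\<forall>x. \<exists>U m. open U \<and> x \<in> U \<and> (\<forall>i\<ge>m. \<forall>y\<in>U. g i y = 0)) \<and> (\<forall>x. \<exists>i. g i x > 0)"
proof -
  have "\<forall>y. \<exists>f K. smooth_fun A f \<and> (\<forall>x. f x \<ge> 0) \<and> f y > 0 \<and> closed K \<and> K \<subseteq> N y \<and> (\<forall>x. x \<notin> K \<longrightarrow> f x = 0)"
    using bump_function_exists[OF assms(1)] assms(2) by blast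
  then obtain F K where "\<forall>y. smooth_fun A (F y) \<and> (\<forall>x. F y x \<ge> 0) \<and> F y y > 0 \<and> closed (K y) \<and> K y \<subseteq> N y
      \<and> (\<forall>x. x \<notin> K y \<longrightarrow> F y x = 0)" by metis
  then have F: "\<And>y. smooth_fun A (F y)" "\<And>y x. F y x \<ge> 0" "\<And>y. F y y > 0"
    and K: "\<And>y. closed (K y)" "\<And>y. K y \<subseteq> N y" "\<And>y x. x \<notin> K y \<Longrightarrow> F y x = 0"
    by blast+
  have cont: "continuous_on UNIV (F y)" for y by (rule smooth_fun_continuous[OF assms(1) F(1)])
  have op: "open {x. F y x > a}" for y a
    using open_Collect_less[OF continuous_on_const cont] .
  obtain \<F> where \<F>: "\<F> \<subseteq> range (\<lambda>y. {x. F y x > 0})" "countable \<F>" "\<Union>\<F> = \<Union>(range (\<lambda>y. {x. F y x > 0}))"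
    using Lindelof[of "range (\<lambda>y. {x. F y x > 0})"] op by blast
  then obtain Z where Z: "countable Z" "\<F> = (\<lambda>y. {x. F y x > 0}) ` Z"
    by (metis countable_subset_image top_greatest)
  have cover: "\<exists>y\<in>Z. F y x > 0" for x
  proof -
    have "x \<in> \<Union>\<F>" unfolding \<F>(3) using F(3) by auto
    then show ?thesis using Z(2) by auto
  qed
  then have "Z \<noteq> {}" by blast
  define z where "z = from_nat_into Z"
  have z: "range z = Z" unfolding z_def by (rule range_from_nat_into[OF \<open>Z \<noteq> {}\<close> Z(1)])
  have coverz: "\<exists>i. F (z i) x > 0" for x using cover[of x] z by (metis imageE)
  define g where "g i x = F (z i) x * (\<Prod>j<i. bump (1 / real (Suc i) - F (z j) x))" for i x
  have "smooth_fun A (g i)" for i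
  proof -
    have "smooth_fun A (\<lambda>x. bump (1 / real (Suc i) - F (z j) x))" for j
      using smooth_fun_compose[OF assms(1) F(1)[of "z j"], of "\<lambda>t. bump (1 / real (Suc i) - t)"]
        smooth_on_compose[OF open_UNIV open_UNIV smooth_on_flat_exp[of 0],
          OF smooth_on_diff[OF open_UNIV smooth_on_const smooth_on_bounded_linear[OF open_UNIV bounded_linear_ident]]]
      by simp
    then show ?thesis unfolding g_def[abs_def]
      by (intro smooth_fun_mult smooth_fun_prod assms(1) F(1))
  qed
  moreover have "g i x \<ge> 0" for i x
    unfolding g_def by (intro mult_nonneg_nonneg prod_nonneg F(2) bump_nonneg)
  moreover have "g i x = 0" if "x \<notin> K (z i)" for i x using K(3)[OF that] by (simp add: g_def)
  moreover have "\<exists>U m. open U \<and> x \<in> U \<and> (\<forall>i\<ge>m. \<forall>y\<in>U. g i y = 0)" for x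
  proof -
    obtain j where j: "F (z j) x > 0" using coverz by blast
    let ?a = "F (z j) x / 2"
    obtain m where m: "1 / real (Suc m) < ?a"
      using reals_Archimedean[of ?a] j by (auto simp: inverse_eq_divide)
    have "g i y = 0" if "i \<ge> max m (Suc j)" "F (z j) y > ?a" for i y
    proof -
      have "1 / real (Suc i) \<le> 1 / real (Suc m)" using that(1) by (intro divide_left_mono) auto
      then have "bump (1 / real (Suc i) - F (z j) y) = 0" using m that(2) by (intro bump_zero) simp
      then have "(\<Prod>j<i. bump (1 / real (Suc i) - F (z j) y)) = 0"
        using that(1) by (intro prod_zero) auto
      then show ?thesis by (simp add: g_def)
    qed
    moreover have "x \<in> {y. F (z j) y > ?a}" using j by simp
    ultimately show ?thesis using op[of ?a "z j"] by blast
  qed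
  moreover have "\<exists>i. g i x > 0" for x
  proof -
    obtain i where i: "F (z i) x > 0" "\<forall>j<i. \<not> F (z j) x > 0"
      using exists_least_iff[of "\<lambda>i. F (z i) x > 0"] coverz by blast
    have "bump (1 / real (Suc i) - F (z j) x) > 0" if "j < i" for j
    proof (rule bump_pos)
      have "\<not> F (z j) x > 0" using i(2) that by blast
      moreover have "1 / real (Suc i) > 0" by simp
      ultimately show "1 / real (Suc i) - F (z j) x > 0" by linarith
    qed
    then have "g i x > 0" unfolding g_def using i(1) by (intro mult_pos_pos prod_pos) auto
    then show ?thesis by blast
  qed
  ultimately show ?thesis using K(1,2) by (intro exI[of _ g] exI[of _ z] exI[of _ "\<lambda>i. K (z i)"]) blast
qed

text \<open>Averaging local solutions with a partition of unity does not leave the convex sets \<open>P x\<close>, and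
  local finiteness keeps the average smooth.\<close>

lemma glue_mv_fields:
  fixes A :: "('m::{t2_space, second_countable_topology}, 'e::euclidean_space) atlas"
  assumes "smooth_manifold A" "\<And>x. convex (P x)"
    and "\<And>x. \<exists>N Y. open N \<and> x \<in> N \<and> mv_smooth_on A p N Y \<and>
      (\<forall>y\<in>N. Y y \<in> ext_power (tangent_space A y) p \<and> Y y \<in> P y)"
  shows "\<exists>X\<in>mv_fields A p. \<forall>x. X x \<in> P x"
proof -
  obtain N Y where N: "\<And>x. open (N x) \<and> x \<in> N x"
    and Y: "\<And>x. mv_smooth_on A p (N x) (Y x)"
      "\<And>x y. y \<in> N x \<Longrightarrow> Y x y \<in> ext_power (tangent_space A y) p \<and> Y x y \<in> P y"
    using assms(3) by metis
  obtain g :: "nat \<Rightarrow> 'm \<Rightarrow> real" and z K where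
      g: "\<And>i. smooth_fun A (g i)" "\<And>i x. g i x \<ge> 0" "\<And>i x. x \<notin> K i \<Longrightarrow> g i x = 0"
    and K: "\<And>i. closed (K i)" "\<And>i. K i \<subseteq> N (z i)"
    and fin: "\<And>x. \<exists>U m. open U \<and> x \<in> U \<and> (\<forall>i\<ge>m. \<forall>y\<in>U. g i y = 0)"
    and pos: "\<And>x. \<exists>i. g i x > 0"
    using locally_finite_bumps[OF assms(1) N] by metis
  define I where "I x = {i. g i x \<noteq> 0}" for x
  define G where "G x = (\<Sum>i\<in>I x. g i x)" for x
  (* Y (z i) x is meaningless outside N (z i), where g i vanishes; summing over I x only leaves the
     sensible values. *)
  define X where "X x = (\<Sum>i\<in>I x. (g i x * inverse (G x)) *\<^sub>R Y (z i) x)" for x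
  have Isub: "I y \<subseteq> {..<m}" if "\<forall>i\<ge>m. \<forall>y\<in>U. g i y = 0" "y \<in> U" for U m y
    using that by (auto simp: I_def not_le[symmetric])
  have Ifin: "finite (I x)" for x
    using fin[of x] Isub finite_subset by (metis finite_lessThan)
  have Gpos: "G x > 0" for x
  proof -
    obtain i where "g i x > 0" using pos by blast
    then show ?thesis
      unfolding G_def using Ifin g(2) by (intro sum_pos2[of _ i]) (auto simp: I_def)
  qed
  have INx: "x \<in> N (z i)" if "i \<in> I x" for i x
    using that g(3) K(2) by (auto simp: I_def)
  have "X x \<in> ext_power (tangent_space A x) p" for x
    unfolding X_def using INx Y(2) by (intro subspace_sum subspace_scale subspace_ext_power) auto
  moreover have "mv_smooth_on A p UNIV X"
    unfolding mv_smooth_on_def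
  proof (intro ballI)
    fix c and \<beta> :: "'e list \<Rightarrow> real" assume c: "c \<in> A" and \<beta>: "\<beta> \<in> alt_forms UNIV p"
    let ?b = "\<lambda>u. pull_form (tangent_space A (cinv c u)) (\<lambda>v. v c) \<beta>"
    have opc: "open (crange c)" by (rule chart_open[OF assms(1) c])
    have summand: "smooth_on (crange c) (\<lambda>u. g i (cinv c u) * Y (z i) (cinv c u) (?b u))" for i
    proof (rule smooth_on_local[OF opc])
      fix u assume u: "u \<in> crange c"
      show "\<exists>U. open U \<and> u \<in> U \<and> smooth_on (U \<inter> crange c) (\<lambda>u. g i (cinv c u) * Y (z i) (cinv c u) (?b u))"
      (* The summand is smooth on the part of N (z i) and zero off K i; the two open sets cover the
         chart. *)
      proof (cases "cinv c u \<in> N (z i)")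
        case True
        let ?U = "cmap c ` (cdom c \<inter> N (z i))"
        have U: "open ?U" using open_chart_image[OF assms(1) c] N by blast
        have gs: "smooth_on ?U (\<lambda>u. g i (cinv c u))"
          using g(1) c smooth_on_subset[of "crange c" "\<lambda>u. g i (cinv c u)" ?U]
          by (auto simp: smooth_fun_def o_def)
        have "smooth_on ?U (\<lambda>u. Y (z i) (cinv c u) (?b u))"
          using Y(1)[of "z i"] c \<beta> unfolding mv_smooth_on_def by blast
        from smooth_on_mult[OF U gs this]
        have "smooth_on (?U \<inter> crange c) (\<lambda>u. g i (cinv c u) * Y (z i) (cinv c u) (?b u))"
          by (rule smooth_on_subset) auto
        moreover have "u \<in> ?U" using chart_image_eq[OF assms(1) c, of "N (z i)"] u True by auto
        ultimately show ?thesis using U by blast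
      next
        case False
        let ?U = "cmap c ` (cdom c \<inter> - K i)"
        have U: "open ?U" using open_chart_image[OF assms(1) c] K(1) by (auto simp: closed_def)
        have "smooth_on ?U (\<lambda>u. g i (cinv c u) * Y (z i) (cinv c u) (?b u))"
          by (rule smooth_on_cong[OF U _ smooth_on_const[of _ 0]])
            (use g(3) cinv_cmap[OF assms(1) c] in auto)
        then have "smooth_on (?U \<inter> crange c) (\<lambda>u. g i (cinv c u) * Y (z i) (cinv c u) (?b u))"
          by (rule smooth_on_subset) auto
        moreover have "u \<in> ?U" using chart_image_eq[OF assms(1) c, of "- K i"] u False K(2)[of i] by auto
        ultimately show ?thesis using U by blast
      qed
    qed
    have "smooth_on (crange c) (\<lambda>u. X (cinv c u) (?b u))"
    proof (rule smooth_on_local[OF opc])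
      fix u assume u: "u \<in> crange c"
      obtain W m where W: "open W" "cinv c u \<in> W" "\<forall>i\<ge>m. \<forall>y\<in>W. g i y = 0" using fin by blast
      let ?U = "cmap c ` (cdom c \<inter> W)"
      have U: "open ?U" by (rule open_chart_image[OF assms(1) c W(1)])
      have sub: "?U \<subseteq> crange c" by auto
      have sums: "(\<Sum>i\<in>I y. h i) = (\<Sum>i<m. h i)" if "y \<in> W" "\<And>i. g i y = 0 \<Longrightarrow> h i = 0" for y and h :: "nat \<Rightarrow> real"
        by (rule sum.mono_neutral_left) (use Isub[OF W(3) that(1)] that(2) in \<open>auto simp: I_def\<close>)
      have inW: "cinv c v \<in> W" if "v \<in> ?U" for v using that cinv_cmap[OF assms(1) c] by auto
      have "smooth_on ?U (\<lambda>v. \<Sum>i<m. g i (cinv c v))"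
        using g(1) c sub by (intro smooth_on_sum U) (auto simp: smooth_fun_def o_def intro: smooth_on_subset)
      moreover have Gm: "G (cinv c v) = (\<Sum>i<m. g i (cinv c v))" if "v \<in> ?U" for v
        unfolding G_def by (rule sums[OF inW[OF that]])
      moreover have "(\<Sum>i<m. g i (cinv c v)) \<noteq> 0" if "v \<in> ?U" for v
        using Gpos[of "cinv c v"] unfolding Gm[OF that] by simp
      ultimately have "smooth_on ?U (\<lambda>v. inverse (\<Sum>i<m. g i (cinv c v)))"
        by (intro smooth_on_inverse U)
      moreover have "smooth_on ?U (\<lambda>v. \<Sum>i<m. g i (cinv c v) * Y (z i) (cinv c v) (?b v))"
        using summand sub by (intro smooth_on_sum U) (auto intro: smooth_on_subset)
      ultimately have "smooth_on ?U (\<lambda>v. inverse (\<Sum>i<m. g i (cinv c v)) * (\<Sum>i<m. g i (cinv c v) * Y (z i) (cinv c v) (?b v)))"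
        by (rule smooth_on_mult[OF U])
      then have "smooth_on ?U (\<lambda>u. X (cinv c u) (?b u))"
      proof (rule smooth_on_cong[OF U, rotated])
        fix v assume v: "v \<in> ?U"
        have "X (cinv c v) (?b v) = (\<Sum>i\<in>I (cinv c v). g i (cinv c v) * inverse (G (cinv c v)) * Y (z i) (cinv c v) (?b v))"
          by (simp add: X_def sum_fun_apply scaleR_fun_def)
        also have "\<dots> = (\<Sum>i<m. g i (cinv c v) * inverse (G (cinv c v)) * Y (z i) (cinv c v) (?b v))"
          by (rule sums[OF inW[OF v]]) simp
        finally show "inverse (\<Sum>i<m. g i (cinv c v)) * (\<Sum>i<m. g i (cinv c v) * Y (z i) (cinv c v) (?b v)) = X (cinv c v) (?b v)"
          by (simp add: Gm[OF v] sum_distrib_left algebra_simps)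
      qed
      then have "smooth_on (?U \<inter> crange c) (\<lambda>u. X (cinv c u) (?b u))" by (rule smooth_on_subset) auto
      moreover have "u \<in> ?U" using chart_image_eq[OF assms(1) c, of W] u W(2) by auto
      ultimately show "\<exists>U. open U \<and> u \<in> U \<and> smooth_on (U \<inter> crange c) (\<lambda>u. X (cinv c u) (?b u))"
        using U by blast
    qed
    then show "smooth_on (cmap c ` (cdom c \<inter> UNIV)) (\<lambda>u. X (cinv c u) (?b u))" by simp
  qed
  moreover have "X x \<in> P x" for x
    unfolding X_def
  proof (rule convex_sum[OF Ifin assms(2)])
    show "(\<Sum>i\<in>I x. g i x * inverse (G x)) = 1"
      using Gpos[of x] by (simp add: sum_distrib_right[symmetric] G_def[symmetric])
    show "0 \<le> g i x * inverse (G x)" for i using Gpos[of x] g(2) by simp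
    show "Y (z i) x \<in> P x" if "i \<in> I x" for i using INx[OF that] Y(2) by blast
  qed
  ultimately show ?thesis using mv_fields_iff by blast
qed

section \<open>The lift of a multivector at one point\<close>

lemma altsum_Cons:
  "altsum g (v # us) = g v us - altsum (\<lambda>x ws. g x (v # ws)) us"
  unfolding altsum_def length_Cons sum.lessThan_Suc_shift
  by (simp add: remove_nth_def sum_negf[symmetric])

text \<open>If \<open>a\<close> vanishes on \<open>us\<close>, inserting \<open>us\<close> first into \<open>a \<and> \<theta>\<close> amounts to \<open>a \<and> \<iota>\<theta>\<close> up to the sign for
  moving \<open>a\<close> past \<open>us\<close>.\<close>

lemma altsum_append_kernel:
  assumes "\<And>v ws. v \<in> set us \<Longrightarrow> g v ws = 0"
  shows "altsum g (us @ vs) = (-1) ^ length us * altsum (\<lambda>x ws. g x (us @ ws)) vs"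
  using assms
proof (induction us arbitrary: g)
  case (Cons u us)
  have "altsum g ((u # us) @ vs) = - altsum (\<lambda>x ws. g x (u # ws)) (us @ vs)"
    using Cons.prems[of u] by (simp add: altsum_Cons)
  also have "\<dots> = - ((-1) ^ length us * altsum (\<lambda>x ws. g x (u # us @ ws)) vs)"
    by (subst Cons.IH) (use Cons.prems in auto)
  finally show ?case by simp
qed simp

text \<open>Every term except the one in which \<open>a\<close> eats \<open>\<delta>\<close> contains \<open>L \<delta> = 0\<close> as an argument of \<open>\<theta>\<close> or \<open>\<eta>\<close>.\<close>

lemma vertical_contraction:
  fixes L :: "'v::real_vector \<Rightarrow> 'w::real_vector"
  assumes "linear_between V W L" "subspace W" "\<theta> \<in> alt_forms W n" "\<eta> \<in> alt_forms W (Suc n)"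
    and "L \<delta> = 0" "length us = n"
  shows "altsum (\<lambda>v us. a v * \<theta> (map L us)) (\<delta> # us) + r * \<eta> (map L (\<delta> # us)) = a \<delta> * \<theta> (map L us)"
proof -
  have 0: "0 \<in> W" using assms(2) by (rule subspace_0)
  have "\<theta> (0 # ws) = 0" "\<eta> (0 # ws) = 0" for ws
    using alt_forms_zero[OF assms(3) 0, of "[]"] alt_forms_zero[OF assms(4) 0, of "[]"] by auto
  then show ?thesis by (simp add: altsum_Cons assms(5)) (simp add: altsum_def)
qed

lemma ext_map_section:
  assumes "X \<in> ext_power W p" "linear_between W V H" "linear_between V W L" "subspace V" "\<And>w. w \<in> W \<Longrightarrow> L (H w) = w"
  shows "ext_map V W p L (ext_map W V p H X) = X"
proof
  fix \<beta>
  show "ext_map V W p L (ext_map W V p H X) \<beta> = X \<beta>"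
  proof (cases "\<beta> \<in> alt_forms W p")
    case True
    have "pull_form W H (pull_form V L \<beta>) = \<beta>"
    proof
      fix vs
      show "pull_form W H (pull_form V L \<beta>) vs = \<beta> vs"
      proof (cases "set vs \<subseteq> W")
        case True
        then have "map L (map H vs) = vs" "set (map H vs) \<subseteq> V"
          using assms(5) linear_between_mem[OF assms(2)] by (auto intro!: map_idI)
        then show ?thesis using True by (simp add: pull_form_def del: map_map)
      next
        case False
        then show ?thesis using alt_forms_off[OF \<open>\<beta> \<in> _\<close>, of vs] by (auto simp: pull_form_def tuples_def)
      qed
    qed
    then show ?thesis
      using pull_form_alt_forms[OF assms(3) True assms(4)] True by (simp add: ext_map_def)
  next
    case False
    then show ?thesis using multivec_off[OF assms(1)] by (simp add: ext_map_def)
  qed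
qed

text \<open>The situation at one point \<open>y\<close>, as pure linear algebra: \<open>V = T\<^sub>y\<close> upstairs, \<open>W = T\<^bsub>\<tau> y\<^esub>\<close> downstairs,
  \<open>L = d\<tau>\<close>, \<open>H\<close> a right inverse of \<open>L\<close> into the kernel of \<open>a = d\<phi>\<close>, \<open>\<delta>\<close> the Liouville vector,
  \<open>r = \<phi>(y)\<close>, \<open>\<theta> = \<Theta>\<close>, \<open>\<eta> = d\<Theta>\<close>, and \<open>\<omega> = d\<Upsilon> = a \<and> L\<^sup>*\<theta> + r L\<^sup>*\<eta>\<close>. The degree of \<open>X\<close> is written
  \<open>q + 1\<close> and that of \<open>\<theta>\<close> is \<open>q + 1 + k\<close>, which avoids subtraction on natural numbers.\<close>

locale lifting_data =
  fixes V :: "'v::real_vector set" and W :: "'w::real_vector set"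
    and L :: "'v \<Rightarrow> 'w" and H :: "'w \<Rightarrow> 'v" and a :: "'v \<Rightarrow> real" and \<delta> :: 'v and r :: real
    and q k :: nat and \<theta> \<eta> :: "'w list \<Rightarrow> real" and \<omega> :: "'v list \<Rightarrow> real"
    and X Q :: "'w multivec"
  assumes V: "subspace V" and W: "subspace W"
    and L: "linear_between V W L" and H: "linear_between W V H"
    and LH: "\<And>w. w \<in> W \<Longrightarrow> L (H w) = w" and aH: "\<And>w. w \<in> W \<Longrightarrow> a (H w) = 0"
    and \<delta>: "\<delta> \<in> V" "L \<delta> = 0" "a \<delta> = r"
    and \<theta>: "\<theta> \<in> alt_forms W (Suc q + k)" and \<eta>: "\<eta> \<in> alt_forms W (Suc (Suc q + k))"
    and \<omega>: "\<omega> \<in> alt_forms V (Suc (Suc q + k))"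
    and \<omega>_eq: "\<And>vs. vs \<in> tuples V (Suc (Suc q + k)) \<Longrightarrow>
      \<omega> vs = altsum (\<lambda>v us. a v * \<theta> (map L us)) vs + r * \<eta> (map L vs)"
    and X: "X \<in> ext_power W (Suc q)" and Q: "Q \<in> ext_power W q"
begin

definition lift :: "'v multivec"
  where "lift = (-1) ^ Suc q *\<^sub>R wedge_cons V q \<delta> (ext_map W V q H Q) + ext_map W V (Suc q) H X"

lemma lift_in_ext_power: "lift \<in> ext_power V (Suc q)"
  unfolding lift_def
  by (intro subspace_lincomb[OF subspace_ext_power] wedge_cons_in_ext_power ext_map_in_ext_power X Q H W \<delta>)

lemma ext_map_lift: "ext_map V W (Suc q) L lift = X"
proof -
  have "ext_map V W (Suc q) L (wedge_cons V q \<delta> (ext_map W V q H Q)) = 0"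
    by (rule ext_map_wedge_cons_zero[OF ext_map_in_ext_power[OF Q H W] L V subspace_0[OF W] \<delta>(1,2)])
  moreover have "ext_map V W (Suc q) L (ext_map W V (Suc q) H X) = X"
    by (rule ext_map_section[OF X H L V LH])
  ultimately show ?thesis unfolding lift_def ext_map_lincomb by simp
qed

lemma map_LH: "set vs \<subseteq> W \<Longrightarrow> map L (map H vs) = vs"
  using LH by (auto intro!: map_idI)

lemma contract_ext_map_H:
  assumes "ws \<in> tuples V (Suc k)"
  shows "contract (ext_map W V (Suc q) H X) \<omega> ws =
    (-1) ^ Suc q * altsum (\<lambda>v us. a v * contract X \<theta> (map L us)) ws + r * contract X \<eta> (map L ws)"
proof -
  let ?p = "Suc q"
  have len: "length ws = Suc k" and ws: "set ws \<subseteq> V" using assms by (auto simp: tuples_def)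
  let ?\<alpha> = "\<lambda>j vs. \<theta> (vs @ map L (remove_nth j ws))" and ?c = "\<lambda>j. (-1) ^ ?p * ((-1) ^ j * a (ws ! j))"
  have \<omega>ws: "(\<lambda>vs. \<omega> (vs @ ws)) \<in> alt_forms V ?p"
    by (rule alt_forms_append[OF _ assms]) (use \<omega> in simp)
  have \<alpha>: "?\<alpha> j \<in> alt_forms W ?p" if "j \<in> {..<Suc k}" for j
    by (rule alt_forms_append[OF \<theta> linear_between_tuples[OF L remove_nth_tuples[OF assms]]]) (use that in simp)
  have \<beta>: "(\<lambda>vs. \<eta> (vs @ map L ws)) \<in> alt_forms W ?p"
    by (rule alt_forms_append[OF _ linear_between_tuples[OF L assms]]) (use \<eta> in simp)
  (* As a vanishes on the image of H, it can only take an entry of ws; what remains is a linear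
     combination of forms in vs, on which X is linear. *)
  have "pull_form W H (\<lambda>vs. \<omega> (vs @ ws)) = (\<lambda>vs. (\<Sum>j<Suc k. ?c j * ?\<alpha> j vs) + r * \<eta> (vs @ map L ws))"
  proof (rule alt_forms_eqI)
    show "pull_form W H (\<lambda>vs. \<omega> (vs @ ws)) \<in> alt_forms W ?p"
      by (rule pull_form_alt_forms[OF H \<omega>ws W])
    have "(\<lambda>vs. \<Sum>j<Suc k. ?c j * ?\<alpha> j vs) + (\<lambda>vs. r * \<eta> (vs @ map L ws)) \<in> alt_forms W ?p"
      by (intro subspace_add subspace_alt_forms alt_forms_lincomb alt_forms_cmult \<alpha> \<beta>)
    then show "(\<lambda>vs. (\<Sum>j<Suc k. ?c j * ?\<alpha> j vs) + r * \<eta> (vs @ map L ws)) \<in> alt_forms W ?p"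
      by (simp add: plus_fun_def)
    fix vs assume vs: "vs \<in> tuples W ?p"
    have vsW: "set vs \<subseteq> W" "length vs = ?p" using vs by (auto simp: tuples_def)
    have "map H vs @ ws \<in> tuples V (Suc (Suc q + k))"
      using linear_between_tuples[OF H vs] assms by (auto simp: tuples_def)
    then have "\<omega> (map H vs @ ws) = altsum (\<lambda>v us. a v * \<theta> (map L us)) (map H vs @ ws) + r * \<eta> (vs @ map L ws)"
      using map_LH[OF vsW(1)] by (simp add: \<omega>_eq del: map_map)
    also have "altsum (\<lambda>v us. a v * \<theta> (map L us)) (map H vs @ ws) =
        (-1) ^ ?p * altsum (\<lambda>v us. a v * \<theta> (vs @ map L us)) ws"
      using altsum_append_kernel[of "map H vs" "\<lambda>v us. a v * \<theta> (map L us)" ws] aH vsW map_LH[OF vsW(1)]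
      by (auto simp del: map_map)
    also have "\<dots> = (\<Sum>j<Suc k. ?c j * ?\<alpha> j vs)"
      by (simp add: altsum_def len sum_distrib_left algebra_simps)
    finally show "pull_form W H (\<lambda>vs. \<omega> (vs @ ws)) vs = (\<Sum>j<Suc k. ?c j * ?\<alpha> j vs) + r * \<eta> (vs @ map L ws)"
      using vsW by (simp add: pull_form_def)
  qed
  then have "contract (ext_map W V ?p H X) \<omega> ws = X (\<lambda>vs. (\<Sum>j<Suc k. ?c j * ?\<alpha> j vs) + r * \<eta> (vs @ map L ws))"
    using \<omega>ws by (simp add: contract_def ext_map_def)
  also have "\<dots> = X (\<lambda>vs. \<Sum>j<Suc k. ?c j * ?\<alpha> j vs) + X (\<lambda>vs. r * \<eta> (vs @ map L ws))"
    by (rule multivec_add[OF X alt_forms_lincomb[OF \<alpha>] alt_forms_cmult[OF \<beta>]])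
  also have "\<dots> = (\<Sum>j<Suc k. ?c j * X (?\<alpha> j)) + r * X (\<lambda>vs. \<eta> (vs @ map L ws))"
    by (simp only: multivec_lincomb[OF X \<alpha>] multivec_cmult[OF X \<beta>])
  also have "(\<Sum>j<Suc k. ?c j * X (?\<alpha> j)) = (-1) ^ ?p * altsum (\<lambda>v us. a v * contract X \<theta> (map L us)) ws"
    by (simp add: altsum_def len sum_distrib_left contract_def algebra_simps)
  finally show ?thesis by (simp add: contract_def)
qed

lemma contract_wedge_cons_H:
  assumes "ws \<in> tuples V (Suc k)"
  shows "contract (wedge_cons V q \<delta> (ext_map W V q H Q)) \<omega> ws = r * contract Q \<theta> (map L ws)"
proof -
  have len: "length ws = Suc k" and ws: "set ws \<subseteq> V" using assms by (auto simp: tuples_def)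
  have \<omega>': "\<omega> \<in> alt_forms V (Suc q + Suc k)" using \<omega> by simp
  have \<omega>ws: "(\<lambda>vs. \<omega> (\<delta> # vs @ ws)) \<in> alt_forms V q"
    using alt_forms_Cons[OF alt_forms_append[OF \<omega>' assms] \<delta>(1)] by simp
  have \<theta>ws: "(\<lambda>vs. \<theta> (vs @ map L ws)) \<in> alt_forms W q"
    by (rule alt_forms_append[OF _ linear_between_tuples[OF L assms]]) (use \<theta> in simp)
  have "pull_form W H (\<lambda>vs. \<omega> (\<delta> # vs @ ws)) = (\<lambda>vs. r * \<theta> (vs @ map L ws))"
  proof (rule alt_forms_eqI[OF pull_form_alt_forms[OF H \<omega>ws W] alt_forms_cmult[OF \<theta>ws]])
    fix vs assume vs: "vs \<in> tuples W q"
    have vsW: "set vs \<subseteq> W" "length vs = q" using vs by (auto simp: tuples_def)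
    have "\<delta> # map H vs @ ws \<in> tuples V (Suc (Suc q + k))"
      using linear_between_tuples[OF H vs] assms \<delta>(1) by (auto simp: tuples_def)
    then have "\<omega> (\<delta> # map H vs @ ws) = r * \<theta> (map L (map H vs @ ws))"
      using vertical_contraction[OF L W \<theta> \<eta> \<delta>(2), of "map H vs @ ws" a r] vsW len \<delta>(3) by (simp add: \<omega>_eq)
    then show "pull_form W H (\<lambda>vs. \<omega> (\<delta> # vs @ ws)) vs = r * \<theta> (vs @ map L ws)"
      using vsW map_LH[OF vsW(1)] by (simp add: pull_form_def del: map_map)
  qed
  then have "ext_map W V q H Q (\<lambda>vs. \<omega> (\<delta> # vs @ ws)) = Q (\<lambda>vs. r * \<theta> (vs @ map L ws))"
    using \<omega>ws by (simp add: ext_map_def)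
  also have "\<dots> = r * contract Q \<theta> (map L ws)" by (simp add: multivec_cmult[OF Q \<theta>ws] contract_def)
  finally show ?thesis
    using contract_wedge_cons[OF ext_map_in_ext_power[OF Q H W] \<omega>' assms] by (simp add: contract_def)
qed

text \<open>If the bracket multiplying \<open>r\<close> is the pullback of \<open>d(\<iota>\<^bsub>X\<^esub>\<Theta>)\<close>, the right-hand side is
  \<open>(-1)\<^sup>p d(\<phi> \<tau>\<^sup>*(\<iota>\<^bsub>X\<^esub>\<Theta>))\<close>, with \<open>p = q + 1\<close>.\<close>

lemma contract_lift:
  assumes "ws \<in> tuples V (Suc k)"
  shows "contract lift \<omega> ws = (-1) ^ Suc q *
    (altsum (\<lambda>v us. a v * contract X \<theta> (map L us)) ws
      + r * ((-1) ^ Suc q * contract X \<eta> (map L ws) + contract Q \<theta> (map L ws)))"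
proof -
  have "contract lift \<omega> ws = (-1) ^ Suc q * contract (wedge_cons V q \<delta> (ext_map W V q H Q)) \<omega> ws
      + contract (ext_map W V (Suc q) H X) \<omega> ws"
    by (simp add: lift_def contract_def scaleR_fun_def)
  moreover have "(-1) ^ Suc q * ((-1) ^ Suc q * x) = (x::real)" for x
    by (simp add: power_add[symmetric] mult.assoc[symmetric])
  ultimately show ?thesis
    unfolding contract_ext_map_H[OF assms] contract_wedge_cons_H[OF assms]
    by (simp only: distrib_left mult.left_commute[of _ r])
qed

end

section \<open>Differentials of functions\<close>

definition differential :: "('m, 'e::real_normed_vector) atlas \<Rightarrow> ('m \<Rightarrow> real) \<Rightarrow> 'm \<Rightarrow> ('m, 'e) tvec \<Rightarrow> real"
  where "differential A f x v = frechet_derivative (f \<circ> cinv (chart_at A x)) (at (cmap (chart_at A x) x)) (v (chart_at A x))"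

lemma smooth_fun_rep_has_derivative:
  assumes "smooth_manifold A" "smooth_fun A f" "c \<in> charts_at A x"
  shows "((f \<circ> cinv c) has_derivative frechet_derivative (f \<circ> cinv c) (at (cmap c x))) (at (cmap c x))"
proof (rule smooth_on_has_derivative)
  show "smooth_on (crange c) (f \<circ> cinv c)"
    using assms(2) charts_atD(1)[OF assms(3)] unfolding smooth_fun_def by blast
  show "cmap c x \<in> crange c" using charts_atD(2)[OF assms(3)] by blast
qed

text \<open>The real line with its identity chart makes this an instance of the chain rule for maps in charts.\<close>

lemma differential_apply:
  assumes "smooth_manifold A" "smooth_fun A f" "c \<in> charts_at A x" "v \<in> tangent_space A x"
  shows "differential A f x v = frechet_derivative (f \<circ> cinv c) (at (cmap c x)) (v c)"
proof -
  let ?d = "chart_at A x" and ?r = "(UNIV, id) :: (real, real) chart"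
  have d: "?d \<in> charts_at A x" by (rule chart_at_in[OF assms(1)])
  have e: "chart_deriv c ?r f x = frechet_derivative (f \<circ> cinv c) (at (cmap c x))" for c
    by (simp add: chart_deriv_def)
  have "((cmap ?d \<circ> id \<circ> cinv c) has_derivative chart_deriv c ?d id x) (at (cmap c x))"
    by (rule smooth_map_rep_has_derivative[OF assms(1) smooth_map_on_id[OF assms(1)] open_UNIV UNIV_I assms(3) _ assms(1)])
      (use d in simp)
  moreover have "((cmap ?r \<circ> f \<circ> cinv ?d) has_derivative chart_deriv ?d ?r f (id x)) (at (cmap ?d (id x)))"
    unfolding e id_apply snd_conv id_comp by (rule smooth_fun_rep_has_derivative[OF assms(1,2) d])
  ultimately have "chart_deriv c ?r (f \<circ> id) x (v c) = chart_deriv ?d ?r f (id x) (chart_deriv c ?d id x (v c))"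
    by (intro chart_deriv_chain[OF assms(1,1,3) _ open_UNIV UNIV_I continuous_on_id']) (use d in simp_all)
  then show ?thesis
    using tangent_spaceD[OF assms(4,3) d] by (simp add: e differential_def)
qed

lemma differential_lincomb:
  assumes "smooth_manifold A" "smooth_fun A f"
  shows "differential A f x (r *\<^sub>R v + w) = r * differential A f x v + differential A f x w"
proof -
  note l = has_derivative_linear[OF smooth_fun_rep_has_derivative[OF assms chart_at_in[OF assms(1)]]]
  show ?thesis
    by (simp only: differential_def plus_fun_apply scaleR_fun_def linear_add[OF l] linear_scale[OF l] real_scaleR_def)
qed

section \<open>Vector fields as multivector fields of degree one\<close>

lemma inner_alt_forms: "(\<lambda>vs. if length vs = 1 then hd vs \<bullet> e else 0) \<in> alt_forms (UNIV :: 'e::real_inner set) (Suc 0)"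
  unfolding alt_forms_def
  by (auto simp: tuples_def length_Suc_conv inner_add_left)

text \<open>Pairing with the coordinate one-forms shows that the components of \<open>\<delta>\<close> are smooth.\<close>

lemma mv_field_1_vector:
  fixes A :: "('m::{t2_space, second_countable_topology}, 'e::euclidean_space) atlas"
  assumes "smooth_manifold A" "\<Delta> \<in> mv_fields A 1"
  shows "\<exists>\<delta>. (\<forall>x. \<delta> x \<in> tangent_space A x \<and> \<Delta> x = wedge (tangent_space A x) [\<delta> x]) \<and>
    (\<forall>c\<in>A. smooth_on (crange c) (\<lambda>u. \<delta> (cinv c u) c))"
proof -
  have "\<forall>x. \<exists>v. v \<in> tangent_space A x \<and> \<Delta> x = wedge (tangent_space A x) [v]"
    using ext_power_1[OF _ subspace_tangent_space[OF assms(1)]] mv_fields_ext_power[OF assms(2)] by (metis One_nat_def)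
  then obtain \<delta> where \<delta>: "\<And>x. \<delta> x \<in> tangent_space A x" "\<And>x. \<Delta> x = wedge (tangent_space A x) [\<delta> x]" by metis
  have "smooth_on (crange c) (\<lambda>u. \<delta> (cinv c u) c)" if c: "c \<in> A" for c
  proof (rule smooth_on_components[OF chart_open(2)[OF assms(1) c]])
    fix e :: 'e
    let ?\<beta> = "\<lambda>vs. if length vs = 1 then hd vs \<bullet> e else 0"
    have "smooth_on (crange c) (\<lambda>u. \<Delta> (cinv c u) (pull_form (tangent_space A (cinv c u)) (\<lambda>v. v c) ?\<beta>))"
      using assms(2) c inner_alt_forms[of e] unfolding mv_fields_def One_nat_def by blast
    moreover have "\<Delta> x (pull_form (tangent_space A x) (\<lambda>v. v c) ?\<beta>) = \<delta> x c \<bullet> e" for x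
      using pull_form_alt_forms[OF tvec_coord_linear_between inner_alt_forms subspace_tangent_space[OF assms(1)], of x c e]
        \<delta>(1)[of x] by (simp add: \<delta>(2) wedge_def pull_form_def)
    ultimately show "smooth_on (crange c) (\<lambda>u. \<delta> (cinv c u) c \<bullet> e)" by simp
  qed
  then show ?thesis using \<delta> by blast
qed

lemma wedge_zero_tvec:
  assumes "smooth_manifold A" "v \<in> tangent_space A x" "wedge (tangent_space A x) [v] = 0"
  shows "v = 0"
proof (rule tvec_eqI[OF chart_at_in[OF assms(1)] assms(2) subspace_0[OF subspace_tangent_space[OF assms(1)]]])
  let ?c = "chart_at A x"
  have "v ?c \<bullet> e = 0" for e
  proof -
    let ?\<beta> = "pull_form (tangent_space A x) (\<lambda>v. v ?c) (\<lambda>vs. if length vs = 1 then hd vs \<bullet> e else 0)"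
    have "?\<beta> \<in> alt_forms (tangent_space A x) (Suc 0)"
      by (rule pull_form_alt_forms[OF tvec_coord_linear_between inner_alt_forms subspace_tangent_space[OF assms(1)]])
    then have "wedge (tangent_space A x) [v] ?\<beta> = v ?c \<bullet> e"
      using assms(2) by (simp add: wedge_def pull_form_def)
    then show ?thesis using assms(3) by simp
  qed
  then show "v ?c = 0 ?c" using inner_eq_zero_iff by force
qed

section \<open>Local right inverses of a bundle projection\<close>

lemma inj_image_Int_eq_vimage:
  assumes "inj_on f D"
  shows "f ` (D \<inter> T) = f ` D \<inter> inv_into D f -` T"
  using inv_into_f_f[OF assms] by (force simp: image_iff)

text \<open>In a local trivialisation \<open>h\<close> the projection is \<open>(x, f) \<mapsto> x\<close>, so \<open>w \<mapsto> Dh\<^sup>-\<^sup>1(w, 0)\<close> is a right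
  inverse of \<open>d\<tau>\<close>; it is written in the charts \<open>c\<close> of the total space and \<open>c'\<close> of the base. Its
  smooth dependence on the point comes from the smoothness of \<open>h\<^sup>-\<^sup>1\<close>.\<close>

lemma bundle_local_right_inverse:
  fixes A :: "('m::{t2_space, second_countable_topology}, 'e::euclidean_space) atlas"
    and At :: "('t::{t2_space, second_countable_topology}, 'k::euclidean_space) atlas"
    and F :: "('f::{t2_space, second_countable_topology}, 'g::euclidean_space) atlas"
  assumes mA: "smooth_manifold A" and mt: "smooth_manifold At" and mF: "smooth_manifold F"
    and fb: "fiber_bundle At A F \<tau>"
  shows "\<exists>N c c' R. open N \<and> y0 \<in> N \<and> c \<in> At \<and> c' \<in> A \<and> N \<subseteq> cdom c \<and> \<tau> ` N \<subseteq> cdom c' \<and>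
    (\<forall>u\<in>cmap c ` N. linear (R u)) \<and> (\<forall>w. smooth_on (cmap c ` N) (\<lambda>u. R u w)) \<and>
    (\<forall>y\<in>N. \<forall>w. chart_deriv c c' \<tau> y (R (cmap c y) w) = w)"
proof -
  have sm: "smooth_map_on At UNIV A \<tau>" using fb by (simp add: fiber_bundle_def)
  obtain W h where W: "open W" "\<tau> y0 \<in> W" "diffeo_on At (\<tau> -` W) (prod_atlas A F) (W \<times> UNIV) h"
    and h\<tau>: "\<And>y. y \<in> \<tau> -` W \<Longrightarrow> fst (h y) = \<tau> y"
    using fb unfolding fiber_bundle_def by metis
  let ?P = "\<tau> -` W"
  let ?hi = "inv_into ?P h"
  have h: "bij_betw h ?P (W \<times> UNIV)" "smooth_map_on At ?P (prod_atlas A F) h"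
    "smooth_map_on (prod_atlas A F) (W \<times> UNIV) At ?hi" using W(3) by (auto simp: diffeo_on_def)
  have "continuous_on UNIV \<tau>" using sm by (simp add: smooth_map_on_def)
  then have P: "open ?P" using W(1) by (simp add: open_vimage)
  let ?c = "chart_at At y0" and ?c' = "chart_at A (\<tau> y0)" and ?d = "chart_at F (snd (h y0))"
  have c: "?c \<in> At" "y0 \<in> cdom ?c" by (rule chart_at_dom[OF mt])+
  have c': "?c' \<in> A" "\<tau> y0 \<in> cdom ?c'" by (rule chart_at_dom[OF mA])+
  have d: "?d \<in> F" "snd (h y0) \<in> cdom ?d" by (rule chart_at_dom[OF mF])+
  let ?pc = "(cdom ?c' \<times> cdom ?d, map_prod (cmap ?c') (cmap ?d))"
  have pc: "?pc \<in> prod_atlas A F" using c'(1) d(1) by (force simp: prod_atlas_def)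
  have op: "open (cdom ?c' \<times> cdom ?d)" by (intro open_Times chart_open(1)[OF mA c'(1)] chart_open(1)[OF mF d(1)])
  have injp: "inj_on (cmap ?pc) (cdom ?pc)"
    using chart_inj[OF mA c'(1)] chart_inj[OF mF d(1)] by (auto simp: inj_on_def)
  have rangep: "crange ?pc = crange ?c' \<times> crange ?d" by force
  have cinvp: "cinv ?pc w = (cinv ?c' (fst w), cinv ?d (snd w))" if "w \<in> crange ?pc" for w
  proof (rule inv_into_f_eq[OF injp])
    show "(cinv ?c' (fst w), cinv ?d (snd w)) \<in> cdom ?pc"
      using that unfolding rangep by (auto intro!: inv_into_into)
    show "cmap ?pc (cinv ?c' (fst w), cinv ?d (snd w)) = w"
      using that unfolding rangep by (auto simp: f_inv_into_f)
  qed
  define N where "N = cdom ?c \<inter> (?P \<inter> h -` cdom ?pc)"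
  have hcont: "continuous_on ?P h" using h(2) by (simp add: smooth_map_on_def)
  have Ph: "open (?P \<inter> h -` cdom ?pc)" using open_preimage_on[OF P hcont] op by simp
  have N: "open N" unfolding N_def using chart_open(1)[OF mt c(1)] Ph by (rule open_Int)
  have y0: "y0 \<in> N"
    using c(2) c'(2) d(2) W(2) h\<tau>[of y0] by (auto simp: N_def mem_Times_iff)
  have \<tau>N: "\<tau> y \<in> cdom ?c'" if "y \<in> N" for y
    using that h\<tau>[of y] by (auto simp: N_def mem_Times_iff)
  let ?S = "cmap ?c ` N"
  have S: "open ?S" unfolding N_def by (rule open_chart_image[OF mt c(1) Ph])
  let ?K = "cmap ?pc \<circ> h \<circ> cinv ?c"
  have K: "smooth_on ?S ?K"
    using h(2) c(1) pc unfolding smooth_map_on_def N_def Int_assoc by blast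
  let ?G = "cmap ?c \<circ> ?hi \<circ> cinv ?pc"
  let ?S2 = "cmap ?pc ` (cdom ?pc \<inter> (W \<times> UNIV) \<inter> ?hi -` cdom ?c)"
  have G: "smooth_on ?S2 ?G" using h(3) c(1) pc unfolding smooth_map_on_def by blast
  have cip: "cinv ?pc (cmap ?pc z) = z" if "z \<in> cdom ?pc" for z by (rule inv_into_f_f[OF injp that])
  (* Openness in the product chart is derived from the charts of the two factors. *)
  have S2: "open ?S2"
  proof -
    have "continuous_on (crange ?c' \<times> crange ?d) (\<lambda>w. cinv ?c' (fst w))"
      by (rule continuous_on_compose2[OF chart_continuous(2)[OF mA c'(1)] continuous_on_fst[OF continuous_on_id]])
        (simp add: image_subset_iff)
    moreover have "continuous_on (crange ?c' \<times> crange ?d) (\<lambda>w. cinv ?d (snd w))"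
      by (rule continuous_on_compose2[OF chart_continuous(2)[OF mF d(1)] continuous_on_snd[OF continuous_on_id]])
        (simp add: image_subset_iff)
    ultimately have "continuous_on (crange ?pc) (\<lambda>w. (cinv ?c' (fst w), cinv ?d (snd w)))"
      unfolding rangep by (rule continuous_on_Pair)
    then have 1: "continuous_on (crange ?pc) (cinv ?pc)"
      by (rule continuous_on_cong[OF refl, THEN iffD1, rotated]) (rule cinvp[symmetric])
    have 2: "open (crange ?pc)"
      unfolding rangep by (intro open_Times chart_open(2)[OF mA c'(1)] chart_open(2)[OF mF d(1)])
    have "continuous_on (W \<times> UNIV) ?hi" using h(3) by (simp add: smooth_map_on_def)
    then have 3: "open ((W \<times> UNIV) \<inter> ?hi -` cdom ?c)"
      by (intro open_preimage_on chart_open(1)[OF mt c(1)]) (simp_all add: W(1) open_Times)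
    have "?S2 = crange ?pc \<inter> cinv ?pc -` ((W \<times> UNIV) \<inter> ?hi -` cdom ?c)"
      unfolding Int_assoc by (rule inj_image_Int_eq_vimage[OF injp])
    then show ?thesis using open_preimage_on[OF 2 1 3] by simp
  qed
  have hih: "?hi (h y) = y" if "y \<in> ?P" for y using h(1) that by (simp add: bij_betw_def)
  have hhi: "h (?hi z) = z" "?hi z \<in> ?P" if "z \<in> W \<times> UNIV" for z
  proof -
    have "z \<in> h ` ?P" using bij_betw_imp_surj_on[OF h(1)] that by simp
    then show "h (?hi z) = z" "?hi z \<in> ?P" by (rule f_inv_into_f, rule inv_into_into)
  qed
  have yN: "y \<in> cdom ?c" "y \<in> ?P" "h y \<in> cdom ?pc" if "y \<in> N" for y using that by (auto simp: N_def)
  have Kc: "?K (cmap ?c y) = cmap ?pc (h y)" if "y \<in> N" for y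
    using cinv_cmap[OF mt c(1) yN(1)[OF that]] by simp
  have KS: "?K (cmap ?c y) \<in> ?S2" if "y \<in> N" for y
  proof -
    have "h y \<in> W \<times> UNIV" using h(1) yN(2)[OF that] by (auto simp: bij_betw_def)
    then have "h y \<in> cdom ?pc \<inter> (W \<times> UNIV) \<inter> ?hi -` cdom ?c"
      using yN[OF that] hih[OF yN(2)[OF that]] by simp
    then show ?thesis unfolding Kc[OF that] by (rule imageI)
  qed
  have GK: "?G (?K (cmap ?c y)) = cmap ?c y" if "y \<in> N" for y
    unfolding Kc[OF that] using cip[OF yN(3)[OF that]] hih[OF yN(2)[OF that]] by (simp only: o_apply)
  (* In these coordinates the projection composed with the inverse trivialisation G is fst;
     differentiating this identity shows that R is a right inverse. *)
  have fG: "(cmap ?c' \<circ> \<tau> \<circ> cinv ?c) (?G w) = fst w" if w: "w \<in> ?S2" for w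
  proof -
    obtain z where z: "z \<in> cdom ?pc" "z \<in> W \<times> UNIV" "?hi z \<in> cdom ?c" "w = cmap ?pc z" using w by blast
    have "\<tau> (?hi z) = fst z" using h\<tau>[OF hhi(2)[OF z(2)]] hhi(1)[OF z(2)] by simp
    then have "cmap ?c' (\<tau> (?hi z)) = fst w" using z(4) by (cases z) simp
    moreover have "?G w = cmap ?c (?hi z)" unfolding z(4) o_apply cip[OF z(1)] ..
    ultimately show ?thesis using cinv_cmap[OF mt c(1) z(3)] by (simp only: o_apply)
  qed
  define R where "R u w = frechet_derivative ?G (at (?K u)) (w, 0)" for u w
  have Gd: "(?G has_derivative frechet_derivative ?G (at (?K (cmap ?c y)))) (at (?K (cmap ?c y)))" if "y \<in> N" for y
    by (rule smooth_on_has_derivative[OF G KS[OF that]])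
  have "linear (R u)" if u: "u \<in> ?S" for u
  proof -
    obtain y where y: "y \<in> N" "u = cmap ?c y" using u by blast
    have l: "linear (frechet_derivative ?G (at (?K u)))"
      using has_derivative_linear[OF Gd[OF y(1)]] y(2) by simp
    show ?thesis
    proof
      show "R u (x + x') = R u x + R u x'" for x x'
        unfolding R_def using linear_add[OF l, of "(x, 0)" "(x', 0)"] by simp
      show "R u (s *\<^sub>R x) = s *\<^sub>R R u x" for s x
        unfolding R_def using linear_scale[OF l, of s "(x, 0)"] by simp
    qed
  qed
  moreover have "smooth_on ?S (\<lambda>u. R u w)" for w
    unfolding R_def
    by (rule smooth_on_compose[OF S S2 smooth_on_frechet_derivative[OF G] K]) (use KS in blast)
  moreover have "chart_deriv ?c ?c' \<tau> y (R (cmap ?c y) w) = w" if y: "y \<in> N" for y w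
  proof -
    let ?w = "?K (cmap ?c y)"
    have "?c \<in> charts_at At y" "?c' \<in> charts_at A (\<tau> y)"
      using c(1) c'(1) yN(1)[OF y] \<tau>N[OF y] by (simp_all add: charts_at_def)
    then have "((cmap ?c' \<circ> \<tau> \<circ> cinv ?c) has_derivative chart_deriv ?c ?c' \<tau> y) (at (?G ?w))"
      unfolding GK[OF y] by (rule smooth_map_rep_has_derivative[OF mt sm open_UNIV UNIV_I _ _ mA])
    from has_derivative_compose[OF Gd[OF y] this]
    have "((\<lambda>w. (cmap ?c' \<circ> \<tau> \<circ> cinv ?c) (?G w)) has_derivative
        (\<lambda>v. chart_deriv ?c ?c' \<tau> y (frechet_derivative ?G (at ?w) v))) (at ?w)" .
    then have "(fst has_derivative (\<lambda>v. chart_deriv ?c ?c' \<tau> y (frechet_derivative ?G (at ?w) v))) (at ?w)"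
      by (rule has_derivative_transform_within_open[OF _ S2 KS[OF y]]) (rule fG)
    moreover have "(fst has_derivative fst) (at ?w)"
      by (rule bounded_linear_imp_has_derivative[OF bounded_linear_fst])
    ultimately have "(\<lambda>v. chart_deriv ?c ?c' \<tau> y (frechet_derivative ?G (at ?w) v)) = fst"
      by (rule has_derivative_unique)
    from fun_cong[OF this, of "(w, 0)"] show ?thesis by (simp add: R_def)
  qed
  ultimately show ?thesis
    using N y0 c(1) c'(1) yN(1) \<tau>N by (intro exI[of _ N] exI[of _ ?c] exI[of _ ?c'] exI[of _ R]) blast
qed

section \<open>Lifting infinitesimal conformal transformations\<close>

text \<open>With a wrong number of arguments the function that is differentiated vanishes identically.\<close>

lemma ext_d_off:
  assumes "\<And>x. \<kappa> x \<in> alt_forms (tangent_space A x) k" "vs \<notin> tuples (tangent_space A y) (Suc k)"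
  shows "ext_d A \<kappa> y vs = 0"
proof (cases "set vs \<subseteq> tangent_space A y")
  case True
  then have "length vs \<noteq> Suc k" using assms(2) by (auto simp: tuples_def)
  then have "\<kappa> x (map f (remove_nth i us)) = 0" if "i < length us" "length us = length vs" for x f i and us :: "'b list"
  proof -
    have "length vs - 1 \<noteq> k" using \<open>length vs \<noteq> Suc k\<close> that by arith
    then show ?thesis using that alt_forms_off[OF assms(1), of "map f (remove_nth i us)" x] by (simp add: tuples_def)
  qed
  then show ?thesis unfolding ext_d_altsum[OF True] altsum_def by (intro sum.neutral ballI) simp
qed (auto simp: ext_d_def)

text \<open>The hypotheses of the theorem with the existential quantifiers opened: \<open>\<Delta>\<close> is a vertical Liouville
  field and \<open>Q\<close> witnesses that \<open>X\<close> is conformal. Again \<open>p = q + 1\<close> and \<open>n = p + k\<close>.\<close>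

locale conformal_lifting =
  fixes A :: "('m::{t2_space, second_countable_topology}, 'e::euclidean_space) atlas"
    and At :: "('t::{t2_space, second_countable_topology}, 'k::euclidean_space) atlas"
    and F :: "('f::{t2_space, second_countable_topology}, 'g::euclidean_space) atlas"
    and \<Theta> :: "('m, 'e) form_field" and \<Upsilon> :: "('t, 'k) form_field"
    and \<tau> :: "'t \<Rightarrow> 'm" and \<phi> :: "'t \<Rightarrow> real" and \<Delta> :: "('t, 'k) mv_field"
    and X Q :: "('m, 'e) mv_field" and q k :: nat
  assumes mA: "smooth_manifold A" and mt: "smooth_manifold At" and mF: "smooth_manifold F"
    and \<Theta>: "\<Theta> \<in> diff_forms A (Suc q + k)" and \<Theta>_nz: "\<And>x. \<Theta> x \<noteq> 0"
    and fb: "fiber_bundle At A F \<tau>"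
    and \<phi>: "smooth_fun At \<phi>" and \<phi>_nz: "\<And>y. \<phi> y \<noteq> 0"
    and \<Upsilon>: "\<Upsilon> \<in> diff_forms At (Suc q + k)" and \<Upsilon>_eq: "\<Upsilon> = (\<lambda>y. \<phi> y *\<^sub>R pullback At A \<tau> \<Theta> y)"
    and \<Delta>: "liouville At \<Upsilon> \<Delta>" and \<Delta>_vert: "related At A \<tau> 1 \<Delta> 0"
    and X: "X \<in> mv_fields A (Suc q)" and Q: "Q \<in> mv_fields A q"
    and lie: "lie_derivative A (Suc q) X \<Theta> = iota Q \<Theta>"
begin

abbreviation V where "V \<equiv> tangent_space At"
abbreviation W where "W y \<equiv> tangent_space A (\<tau> y)"
abbreviation L where "L \<equiv> tangent_map At A \<tau>"
abbreviation \<kappa> where "\<kappa> \<equiv> \<lambda>y. \<phi> y *\<^sub>R pullback At A \<tau> (iota X \<Theta>) y"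

lemma smooth_map_\<tau>: "smooth_map_on At UNIV A \<tau>"
  using fb by (simp add: fiber_bundle_def)

lemma L_lin: "linear_between (V y) (W y) (L y)"
  by (rule tangent_map_linear_between[OF mt mA smooth_map_\<tau> open_UNIV UNIV_I])

lemma contraction_diff_forms: "iota X \<Theta> \<in> diff_forms A k"
  by (rule iota_diff_forms[OF mA X \<Theta>])

lemma ext_d_\<Upsilon>_alt_forms: "ext_d At \<Upsilon> y \<in> alt_forms (V y) (Suc (Suc q + k))"
  by (rule ext_d_alt_forms[OF mt \<Upsilon>])

lemma ext_d_\<Upsilon>:
  assumes "vs \<in> tuples (V y) (Suc (Suc q + k))"
  shows "ext_d At \<Upsilon> y vs = altsum (\<lambda>v us. differential At \<phi> y v * \<Theta> (\<tau> y) (map (L y) us)) vs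
    + \<phi> y * ext_d A \<Theta> (\<tau> y) (map (L y) vs)"
  unfolding \<Upsilon>_eq differential_def by (rule ext_d_scaled_pullback[OF mt mA smooth_map_\<tau> \<phi> \<Theta> assms])

lemma \<kappa>_alt_forms: "\<kappa> y \<in> alt_forms (V y) k"
  unfolding pullback_def
  by (intro subspace_scale[OF subspace_alt_forms] pull_form_alt_forms[OF L_lin diff_forms_alt[OF contraction_diff_forms]]
      subspace_tangent_space[OF mt])

lemma contract_\<Upsilon>:
  assumes "U \<in> ext_power (V y) (Suc q)" "ext_map (V y) (W y) (Suc q) (L y) U = X (\<tau> y)"
  shows "contract U (\<Upsilon> y) = \<kappa> y"
proof
  fix ws
  show "contract U (\<Upsilon> y) ws = \<kappa> y ws"
  proof (cases "ws \<in> tuples (V y) k")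
    case True
    have alt: "pull_form (V y) (L y) (\<Theta> (\<tau> y)) \<in> alt_forms (V y) (Suc q + k)"
      by (rule pull_form_alt_forms[OF L_lin diff_forms_alt[OF \<Theta>] subspace_tangent_space[OF mt]])
    have "contract U (\<Upsilon> y) ws = \<phi> y * contract U (pull_form (V y) (L y) (\<Theta> (\<tau> y))) ws"
      using multivec_cmult[OF assms(1) alt_forms_append[OF alt True]]
      by (simp add: \<Upsilon>_eq contract_def scaleR_fun_def pullback_def)
    also have "contract U (pull_form (V y) (L y) (\<Theta> (\<tau> y))) ws = contract (X (\<tau> y)) (\<Theta> (\<tau> y)) (map (L y) ws)"
      unfolding contract_pull_form[OF assms(1) L_lin diff_forms_alt[OF \<Theta>] True] assms(2) ..
    finally show ?thesis
      using True by (simp add: iota_def pullback_def pull_form_def scaleR_fun_def tuples_def)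
  next
    case False
    show ?thesis
      using contract_off[OF assms(1) diff_forms_alt[OF \<Upsilon>] False] alt_forms_off[OF \<kappa>_alt_forms False] by simp
  qed
qed

lemma L_surj:
  assumes "w \<in> W y"
  shows "\<exists>v\<in>V y. L y v = w"
proof -
  obtain N c c' and R :: "'k \<Rightarrow> 'e \<Rightarrow> 'k" where N: "y \<in> N" "c \<in> At" "c' \<in> A" "N \<subseteq> cdom c" "\<tau> ` N \<subseteq> cdom c'"
    and R: "\<forall>y\<in>N. \<forall>w. chart_deriv c c' \<tau> y (R (cmap c y) w) = w"
    using bundle_local_right_inverse[OF mA mt mF fb, of y] by metis
  have c: "c \<in> charts_at At y" "c' \<in> charts_at A (\<tau> y)" using N by (auto simp: charts_at_def)
  let ?v = "coord_tvec At c y (R (cmap c y) (w c'))"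
  have "L y ?v = coord_tvec A c' (\<tau> y) (w c')"
    unfolding tangent_map_coord[OF mt mA smooth_map_\<tau> open_UNIV UNIV_I c] using R N(1) by simp
  also have "\<dots> = w" by (rule coord_tvec_of_tvec[OF c(2) assms])
  finally show ?thesis using coord_tvec_in[OF mt c(1)] by blast
qed

text \<open>Both sides of \<open>\<iota>\<^bsub>\<Delta>\<^esub>d\<Upsilon> = \<Upsilon>\<close> are multiples of \<open>\<tau>\<^sup>*\<Theta>\<close>, by \<open>d\<phi>(\<delta>)\<close> and by \<open>\<phi>\<close>. The factors agree because
  \<open>\<tau>\<^sup>*\<Theta>\<close> is nonzero, \<open>d\<tau>\<close> being surjective.\<close>

lemma liouville_vector:
  assumes "\<delta> \<in> V y" "\<Delta> y = wedge (V y) [\<delta>]"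
  shows "L y \<delta> = 0" "differential At \<phi> y \<delta> = \<phi> y"
proof -
  have d1: "[\<delta>] \<in> tuples (V y) 1" using assms(1) by (simp add: tuples_def)
  have "ext_map (V y) (W y) 1 (L y) (\<Delta> y) = 0" using \<Delta>_vert by (simp add: related_def)
  then have "wedge (W y) [L y \<delta>] = 0"
    using ext_map_wedge[OF L_lin subspace_tangent_space[OF mt] d1] by (simp add: assms(2))
  then show L\<delta>: "L y \<delta> = 0"
    by (rule wedge_zero_tvec[OF mA linear_between_mem[OF L_lin assms(1)]])
  have "\<exists>ws. \<Theta> (\<tau> y) ws \<noteq> 0" using \<Theta>_nz[of "\<tau> y"] by (auto simp: fun_eq_iff)
  then obtain ws where ws: "\<Theta> (\<tau> y) ws \<noteq> 0" by blast
  then have wsW: "ws \<in> tuples (W y) (Suc q + k)" using alt_forms_off[OF diff_forms_alt[OF \<Theta>]] by blast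
  have "\<forall>w\<in>W y. \<exists>v. v \<in> V y \<and> L y v = w" using L_surj by blast
  (* Lift a tuple on which Theta does not vanish through the surjective differential. *)
  from bchoice[OF this] obtain s where s: "\<forall>w\<in>W y. s w \<in> V y \<and> L y (s w) = w" by blast
  let ?us = "map s ws"
  have us: "?us \<in> tuples (V y) (Suc q + k)" "map (L y) ?us = ws"
    using wsW s by (fastforce simp: tuples_def intro!: map_idI)+
  have d: "\<delta> # ?us \<in> tuples (V y) (Suc (Suc q + k))" using us(1) assms(1) by (auto simp: tuples_def)
  have "- ext_d At \<Upsilon> y \<in> alt_forms (V y) (Suc (Suc q + k))"
    by (rule subspace_neg[OF subspace_alt_forms ext_d_\<Upsilon>_alt_forms])
  then have alt: "(- ext_d At \<Upsilon>) y \<in> alt_forms (V y) (1 + (Suc q + k))" by simp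
  have "contract (\<Delta> y) ((- ext_d At \<Upsilon>) y) = (- \<Upsilon>) y"
    using \<Delta> unfolding liouville_def iota_def by metis
  then have "contract (wedge (V y) [\<delta>]) ((- ext_d At \<Upsilon>) y) ?us = - \<Upsilon> y ?us" by (simp add: assms(2))
  then have "ext_d At \<Upsilon> y (\<delta> # ?us) = \<Upsilon> y ?us"
    using contract_wedge[OF alt d1 us(1)] by simp
  also have "\<dots> = \<phi> y * \<Theta> (\<tau> y) ws"
    using us by (simp add: \<Upsilon>_eq pullback_def pull_form_def scaleR_fun_def tuples_def del: map_map)
  finally have "\<phi> y * \<Theta> (\<tau> y) ws = ext_d At \<Upsilon> y (\<delta> # ?us)" ..
  also have "\<dots> = differential At \<phi> y \<delta> * \<Theta> (\<tau> y) ws"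
    unfolding ext_d_\<Upsilon>[OF d]
    using vertical_contraction[where \<delta> = \<delta> and us = ?us and a = "differential At \<phi> y" and r = "\<phi> y",
        OF L_lin subspace_tangent_space[OF mA] diff_forms_alt[OF \<Theta>] ext_d_alt_forms[OF mA \<Theta>] L\<delta>] us
    by (simp add: tuples_def del: map_map)
  finally show "differential At \<phi> y \<delta> = \<phi> y" using ws by simp
qed

text \<open>The conditions of the theorem at the single point \<open>y\<close>. The exterior derivative is taken of
  \<open>\<kappa> = \<phi> \<tau>\<^sup>*(\<iota>\<^bsub>X\<^esub>\<Theta>)\<close>, which is \<open>\<iota>\<^bsub>X'\<^esub>\<Upsilon>\<close> for every lift \<open>X'\<close> of \<open>X\<close>, so this is an affine condition on one
  multivector.\<close>

definition solutions :: "'t \<Rightarrow> ('t, 'k) tvec multivec set"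
  where "solutions y = {U. ext_map (V y) (W y) (Suc q) (L y) U = X (\<tau> y) \<and>
    contract U (ext_d At \<Upsilon> y) = (-1) ^ Suc q *\<^sub>R ext_d At \<kappa> y}"

lemma convex_solutions: "convex (solutions y)"
  unfolding convex_def
proof (intro ballI allI impI)
  fix U U' and s t :: real assume U: "U \<in> solutions y" "U' \<in> solutions y" "0 \<le> s" "0 \<le> t" "s + t = 1"
  have st: "s *\<^sub>R x + t *\<^sub>R x = x" for x :: "'z::real_vector"
    using U(5) by (simp add: scaleR_add_left[symmetric])
  have "ext_map (V y) (W y) (Suc q) (L y) (s *\<^sub>R U + t *\<^sub>R U') =
     s *\<^sub>R ext_map (V y) (W y) (Suc q) (L y) U + t *\<^sub>R ext_map (V y) (W y) (Suc q) (L y) U'"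
    by (auto simp: ext_map_def scaleR_fun_def fun_eq_iff)
  moreover have "contract (s *\<^sub>R U + t *\<^sub>R U') (ext_d At \<Upsilon> y) =
      s *\<^sub>R contract U (ext_d At \<Upsilon> y) + t *\<^sub>R contract U' (ext_d At \<Upsilon> y)"
    by (auto simp: contract_def scaleR_fun_def fun_eq_iff)
  ultimately show "s *\<^sub>R U + t *\<^sub>R U' \<in> solutions y"
    using U(1,2) unfolding solutions_def mem_Collect_eq by (simp only: st)
qed

lemma lift_solution:
  assumes "lifting_data (V y) (W y) (L y) H (differential At \<phi> y) \<delta> (\<phi> y) q k (\<Theta> (\<tau> y)) (ext_d A \<Theta> (\<tau> y))
    (ext_d At \<Upsilon> y) (X (\<tau> y)) (Q (\<tau> y))"
  defines "U \<equiv> lifting_data.lift (V y) (W y) H \<delta> q (X (\<tau> y)) (Q (\<tau> y))"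
  shows "U \<in> ext_power (V y) (Suc q)" "U \<in> solutions y"
proof -
  interpret lifting_data "V y" "W y" "L y" H "differential At \<phi> y" \<delta> "\<phi> y" q k "\<Theta> (\<tau> y)" "ext_d A \<Theta> (\<tau> y)"
    "ext_d At \<Upsilon> y" "X (\<tau> y)" "Q (\<tau> y)" by (rule assms(1))
  show U: "U \<in> ext_power (V y) (Suc q)" unfolding U_def by (rule lift_in_ext_power)
  have "contract U (ext_d At \<Upsilon> y) ws = (-1) ^ Suc q * ext_d At \<kappa> y ws" for ws
  proof (cases "ws \<in> tuples (V y) (Suc k)")
    case True
    have "ext_d A (iota X \<Theta>) x us = (-1) ^ Suc q * contract (X x) (ext_d A \<Theta> x) us + contract (Q x) (\<Theta> x) us" for x us
    proof -
      have "lie_derivative A (Suc q) X \<Theta> x us = iota Q \<Theta> x us" using lie by simp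
      then show ?thesis by (simp add: lie_derivative_def iota_def scaleR_fun_def)
    qed
    then show ?thesis
      using contract_lift[OF True] ext_d_scaled_pullback[OF mt mA smooth_map_\<tau> \<phi> contraction_diff_forms True]
      by (simp add: U_def differential_def iota_def)
  next
    case False
    have "contract U (ext_d At \<Upsilon> y) ws = 0"
      by (rule contract_off[OF U _ False]) (use ext_d_\<Upsilon>_alt_forms in simp)
    then show ?thesis using ext_d_off[OF \<kappa>_alt_forms False] by simp
  qed
  then have "contract U (ext_d At \<Upsilon> y) = (-1) ^ Suc q *\<^sub>R ext_d At \<kappa> y"
    by (simp add: fun_eq_iff scaleR_fun_def)
  then show "U \<in> solutions y"
    using ext_map_lift unfolding solutions_def U_def by blast
qed

text \<open>Since \<open>d\<phi>(\<delta>) = \<phi> \<noteq> 0\<close>, subtracting a multiple of the Liouville vector moves the values of \<open>R\<close> into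
  the kernel of \<open>d\<phi>\<close>; as \<open>d\<tau>(\<delta>) = 0\<close>, the result is still a right inverse of \<open>d\<tau>\<close>.\<close>

lemma horizontal_lifting_data:
  assumes R: "linear_between (W y) (V y) R" "\<And>w. w \<in> W y \<Longrightarrow> L y (R w) = w"
    and \<delta>: "\<delta> \<in> V y" "\<Delta> y = wedge (V y) [\<delta>]"
  defines "H \<equiv> \<lambda>w. R w - (differential At \<phi> y (R w) * inverse (\<phi> y)) *\<^sub>R \<delta>"
  shows "lifting_data (V y) (W y) (L y) H (differential At \<phi> y) \<delta> (\<phi> y) q k (\<Theta> (\<tau> y)) (ext_d A \<Theta> (\<tau> y))
    (ext_d At \<Upsilon> y) (X (\<tau> y)) (Q (\<tau> y))"
proof
  note V = subspace_tangent_space[OF mt, of y]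
  note d = differential_lincomb[OF mt \<phi>]
  have H: "H w = (- (differential At \<phi> y (R w) * inverse (\<phi> y))) *\<^sub>R \<delta> + R w" for w
    by (simp only: H_def scaleR_minus_left diff_conv_add_uminus add.commute)
  have R_in: "w \<in> W y \<Longrightarrow> R w \<in> V y" for w using linear_between_mem[OF R(1)] .
  have L\<delta>: "L y (s *\<^sub>R \<delta> + v) = s *\<^sub>R L y \<delta> + L y v" if "v \<in> V y" for s v
    using L_lin[of y] \<delta>(1) that by (simp only: linear_between_def)
  show \<delta>': "L y \<delta> = 0" "differential At \<phi> y \<delta> = \<phi> y" by (rule liouville_vector[OF \<delta>])+
  show "linear_between (W y) (V y) H"
    unfolding linear_between_def
  proof (intro conjI ballI allI)
    show "H ` W y \<subseteq> V y"
      unfolding H using subspace_lincomb[OF V \<delta>(1) R_in] by blast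
    show "H (s *\<^sub>R v + w) = s *\<^sub>R H v + H w" if "v \<in> W y" "w \<in> W y" for v w s
    proof -
      have "R (s *\<^sub>R v + w) = s *\<^sub>R R v + R w" using R(1) that unfolding linear_between_def by blast
      then show ?thesis
        by (simp only: H d) (simp add: fun_eq_iff scaleR_fun_def algebra_simps)
    qed
  qed
  show "L y (H w) = w" if "w \<in> W y" for w
    unfolding H L\<delta>[OF R_in[OF that]] \<delta>'(1) R(2)[OF that] by (simp only: scaleR_zero_right add_0)
  show "differential At \<phi> y (H w) = 0" for w
    unfolding H d \<delta>'(2) using \<phi>_nz[of y] by simp
qed (fact \<delta>(1) subspace_tangent_space[OF mA] L_lin diff_forms_alt[OF \<Theta>] ext_d_alt_forms[OF mA \<Theta>] ext_d_\<Upsilon>_alt_forms ext_d_\<Upsilon>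
    mv_fields_ext_power[OF X] mv_fields_ext_power[OF Q] subspace_tangent_space[OF mt])+

text \<open>The pointwise lift along \<open>H\<close> depends smoothly on the point: in the charts \<open>c\<close> and \<open>c'\<close> the map \<open>H\<close>
  is given by the smooth family \<open>Hc\<close>.\<close>

lemma local_solution:
  "\<exists>N Y. open N \<and> y0 \<in> N \<and> mv_smooth_on At (Suc q) N Y \<and>
      (\<forall>y\<in>N. Y y \<in> ext_power (V y) (Suc q) \<and> Y y \<in> solutions y)"
proof -
  obtain N c c' and R :: "'k \<Rightarrow> 'e \<Rightarrow> 'k" where N: "open N" "y0 \<in> N" "c \<in> At" "c' \<in> A" "N \<subseteq> cdom c" "\<tau> ` N \<subseteq> cdom c'"
    and R_lin: "\<forall>u\<in>cmap c ` N. linear (R u)" and R_smooth: "\<forall>w. smooth_on (cmap c ` N) (\<lambda>u. R u w)"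
    and R: "\<forall>y\<in>N. \<forall>w. chart_deriv c c' \<tau> y (R (cmap c y) w) = w"
    using bundle_local_right_inverse[OF mA mt mF fb, of y0] by metis
  have "\<Delta> \<in> mv_fields At 1" using \<Delta> by (simp add: liouville_def)
  then obtain \<delta> where \<delta>: "\<And>y. \<delta> y \<in> V y" "\<And>y. \<Delta> y = wedge (V y) [\<delta> y]"
    and \<delta>_smooth: "smooth_on (crange c) (\<lambda>u. \<delta> (cinv c u) c)"
    using mv_field_1_vector[OF mt] N(3) by metis
  let ?S = "cmap c ` N"
  have Nc: "cdom c \<inter> N = N" using N(5) by blast
  have S: "open ?S" using open_chart_image[OF mt N(3,1)] unfolding Nc .
  have Ssub: "?S \<subseteq> crange c" using N(5) by blast
  have c: "c \<in> charts_at At y" "c' \<in> charts_at A (\<tau> y)" "cinv c (cmap c y) = y" "cinv c' (cmap c' (\<tau> y)) = \<tau> y"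
    if "y \<in> N" for y
    using that N cinv_cmap[OF mt N(3)] cinv_cmap[OF mA N(4)] by (auto simp: charts_at_def)
  define D where "D u = frechet_derivative (\<phi> \<circ> cinv c) (at u)" for u
  define \<delta>c where "\<delta>c u = \<delta> (cinv c u) c" for u
  define Hc where "Hc u w = R u w - (D u (R u w) * inverse (\<phi> (cinv c u))) *\<^sub>R \<delta>c u" for u w
  define r where "r y w = coord_tvec At c y (R (cmap c y) (w c'))" for y and w :: "('m, 'e) tvec"
  define H where "H y w = r y w - (differential At \<phi> y (r y w) * inverse (\<phi> y)) *\<^sub>R \<delta> y" for y w
  define Y where "Y y = lifting_data.lift (V y) (W y) (H y) (\<delta> y) q (X (\<tau> y)) (Q (\<tau> y))" for y
  have \<phi>c: "smooth_on ?S (\<phi> \<circ> cinv c)"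
    using \<phi> N(3) Ssub smooth_on_subset unfolding smooth_fun_def by blast
  have \<delta>c_smooth: "smooth_on ?S \<delta>c"
    using smooth_on_subset[OF \<delta>_smooth Ssub] unfolding \<delta>c_def .
  have D_lin: "linear (D u)" if "u \<in> ?S" for u
    unfolding D_def using smooth_on_differentiable[OF \<phi>c that] linear_frechet_derivative by blast
  have Hc_lin: "linear (Hc u)" if u: "u \<in> ?S" for u
  proof
    have l: "linear (R u)" "linear (D u)" using R_lin D_lin u by auto
    show "Hc u (x + x') = Hc u x + Hc u x'" for x x'
      using linear_add[OF l(1)] linear_add[OF l(2)] by (simp add: Hc_def algebra_simps)
    show "Hc u (s *\<^sub>R x) = s *\<^sub>R Hc u x" for s x
      using linear_scale[OF l(1)] linear_scale[OF l(2)] by (simp add: Hc_def algebra_simps)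
  qed
  have Hc_smooth: "smooth_on ?S (\<lambda>u. Hc u w)" for w
  proof -
    have r: "smooth_on ?S (\<lambda>u. R u w)" using R_smooth by blast
    have "smooth_on ?S (\<lambda>u. D u (R u w))"
      unfolding D_def by (rule smooth_on_frechet_derivative_field[OF S \<phi>c r])
    moreover have "smooth_on ?S (\<lambda>u. inverse (\<phi> (cinv c u)))"
      using smooth_on_inverse[OF S \<phi>c] \<phi>_nz by simp
    ultimately show ?thesis
      unfolding Hc_def by (intro smooth_on_diff[OF S r] smooth_on_scaleR[OF S] smooth_on_mult[OF S] \<delta>c_smooth)
  qed
  have ld: "lifting_data (V y) (W y) (L y) (H y) (differential At \<phi> y) (\<delta> y) (\<phi> y) q k (\<Theta> (\<tau> y)) (ext_d A \<Theta> (\<tau> y))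
      (ext_d At \<Upsilon> y) (X (\<tau> y)) (Q (\<tau> y))" if y: "y \<in> N" for y
    unfolding H_def
  proof (rule horizontal_lifting_data[OF _ _ \<delta>])
    have l: "linear (R (cmap c y))" using R_lin y by blast
    have cl: "linear_between UNIV (V y) (coord_tvec At c y)" by (rule coord_tvec_linear_between[OF mt c(1)[OF y]])
    show "linear_between (W y) (V y) (r y)"
      unfolding linear_between_def r_def
    proof (intro conjI ballI allI)
      show "(\<lambda>w. coord_tvec At c y (R (cmap c y) (w c'))) ` W y \<subseteq> V y"
        using coord_tvec_in[OF mt c(1)[OF y]] by blast
      fix v w and s :: real
      have "R (cmap c y) ((s *\<^sub>R v + w) c') = s *\<^sub>R R (cmap c y) (v c') + R (cmap c y) (w c')"
        using linear_add[OF l] linear_scale[OF l] by (simp add: scaleR_fun_def)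
      then show "coord_tvec At c y (R (cmap c y) ((s *\<^sub>R v + w) c')) =
          s *\<^sub>R coord_tvec At c y (R (cmap c y) (v c')) + coord_tvec At c y (R (cmap c y) (w c'))"
        using cl unfolding linear_between_def by (simp only: UNIV_I ball_simps)
    qed
    show "L y (r y w) = w" if "w \<in> W y" for w
      unfolding r_def tangent_map_coord[OF mt mA smooth_map_\<tau> open_UNIV UNIV_I c(1,2)[OF y]]
      using R y coord_tvec_of_tvec[OF c(2)[OF y] that] by simp
  qed
  have H_coord: "H y w c = Hc (cmap c y) (w c')" if y: "y \<in> N" for y w
    using differential_apply[OF mt \<phi> c(1)[OF y] coord_tvec_in[OF mt c(1)[OF y]]] coord_tvec_same[OF mt c(1)[OF y]] c(3)[OF y]
    by (simp add: H_def Hc_def r_def D_def \<delta>c_def scaleR_fun_def)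
  note sol = lift_solution[OF ld, folded Y_def]
  have "mv_smooth_on At (Suc q) N Y"
  proof (rule mv_smooth_on_one_chart[OF mt N(3,1,5) sol(1)])
    fix \<beta> :: "'k list \<Rightarrow> real" assume \<beta>: "\<beta> \<in> alt_forms UNIV (Suc q)"
    let ?f = "cmap c' \<circ> \<tau> \<circ> cinv c"
    let ?tr = "\<lambda>Z u \<gamma>. mv_coord A c' Z (pull_form UNIV (Hc u) \<gamma>) (?f u)"
    have f: "smooth_on ?S ?f"
      by (rule smooth_on_subset[OF smooth_map_rep(2)[OF mt smooth_map_\<tau> open_UNIV N(3,4) chart_open(1)[OF mA N(4)]]])
        (use N(5,6) in blast)
    have fT: "?f ` ?S \<subseteq> cmap c' ` (cdom c' \<inter> UNIV)" using N(6) c(3) by auto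
    have \<beta>\<delta>: "(\<lambda>vs. \<beta> (\<delta>c u # vs)) \<in> alt_forms UNIV q" for u by (rule alt_forms_Cons[OF \<beta> UNIV_I])
    have \<beta>\<delta>_smooth: "smooth_on ?S (\<lambda>u. \<beta> (\<delta>c u # vs))" for vs
    proof (cases "length vs = q")
      case True
      have "smooth_on ?S (\<lambda>u. \<beta> (map (\<lambda>g. g u) (\<delta>c # map (\<lambda>v _. v) vs)))"
        by (rule alt_form_field_smooth[OF S _ smooth_on_const])
          (use \<beta> True \<delta>c_smooth smooth_on_const in auto)
      moreover have "map (\<lambda>g. g u) (map (\<lambda>v _. v) vs) = vs" for u :: 'k by (induction vs) auto
      ultimately show ?thesis by (simp del: map_map)
    next
      case False
      then have "\<beta> (\<delta>c u # vs) = 0" for u using alt_forms_off[OF \<beta>\<delta>, of vs] by (simp add: tuples_def)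
      then show ?thesis by (simp add: smooth_on_const)
    qed
    have "smooth_on ?S (\<lambda>u. ?tr X u \<beta>)"
      by (rule mv_transport_smooth[OF mA N(4) open_UNIV mv_fields_ext_power[OF X] mv_fields_smooth[OF X N(4)]
            S f fT Hc_lin Hc_smooth \<beta> smooth_on_const])
    moreover have "smooth_on ?S (\<lambda>u. ?tr Q u (\<lambda>vs. \<beta> (\<delta>c u # vs)))"
      by (rule mv_transport_smooth[OF mA N(4) open_UNIV mv_fields_ext_power[OF Q] mv_fields_smooth[OF Q N(4)]
            S f fT Hc_lin Hc_smooth \<beta>\<delta> \<beta>\<delta>_smooth])
    ultimately have "smooth_on ?S (\<lambda>u. (-1) ^ Suc q * ?tr Q u (\<lambda>vs. \<beta> (\<delta>c u # vs)) + ?tr X u \<beta>)"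
      by (intro smooth_on_add[OF S] smooth_on_mult[OF S smooth_on_const])
    then show "smooth_on ?S (\<lambda>u. Y (cinv c u) (pull_form (V (cinv c u)) (\<lambda>v. v c) \<beta>))"
    proof (rule smooth_on_cong[OF S, rotated])
      fix u assume "u \<in> ?S"
      then obtain y where y: "y \<in> N" "u = cmap c y" by blast
      have cy: "cinv c u = y" "cinv c' (?f u) = \<tau> y" using c[OF y(1)] y(2) by auto
      (* Reading a coordinate form through H in the chart of the base amounts to pulling it back along
         Hc, a smooth family of linear maps between fixed spaces. *)
      have pf: "pull_form (W y) (H y) (pull_form (V y) (\<lambda>v. v c) \<gamma>) = pull_form (W y) (\<lambda>v. v c') (pull_form UNIV (Hc u) \<gamma>)" for \<gamma>
      proof
        fix vs
        have "map (\<lambda>v. v c) (map (H y) vs) = map (Hc u) (map (\<lambda>v. v c') vs)"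
          by (simp add: H_coord[OF y(1)] y(2))
        moreover have "set (map (H y) vs) \<subseteq> V y" if "set vs \<subseteq> W y"
          using that linear_between_mem[OF lifting_data.H[OF ld[OF y(1)]]] by auto
        ultimately show "pull_form (W y) (H y) (pull_form (V y) (\<lambda>v. v c) \<gamma>) vs = pull_form (W y) (\<lambda>v. v c') (pull_form UNIV (Hc u) \<gamma>) vs"
          by (simp add: pull_form_def del: map_map set_map)
      qed
      have alt: "pull_form (V y) (\<lambda>v. v c) \<beta> \<in> alt_forms (V y) (Suc q)"
        by (rule pull_form_alt_forms[OF tvec_coord_linear_between \<beta> subspace_tangent_space[OF mt]])
      have "(\<lambda>vs. pull_form (V y) (\<lambda>v. v c) \<beta> (\<delta> y # vs)) = pull_form (V y) (\<lambda>v. v c) (\<lambda>vs. \<beta> (\<delta>c u # vs))"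
        using \<delta>(1)[of y] by (auto simp: pull_form_def fun_eq_iff \<delta>c_def cy)
      moreover have "(\<lambda>vs. pull_form (V y) (\<lambda>v. v c) \<beta> (\<delta> y # vs)) \<in> alt_forms (V y) q"
        by (rule alt_forms_Cons[OF alt \<delta>(1)])
      ultimately have "wedge_cons (V y) q (\<delta> y) (ext_map (W y) (V y) q (H y) (Q (\<tau> y))) (pull_form (V y) (\<lambda>v. v c) \<beta>)
          = ?tr Q u (\<lambda>vs. \<beta> (\<delta>c u # vs))"
        using alt by (simp only: wedge_cons_def ext_map_def if_True pf cy)
      moreover have "ext_map (W y) (V y) (Suc q) (H y) (X (\<tau> y)) (pull_form (V y) (\<lambda>v. v c) \<beta>) = ?tr X u \<beta>"
        using alt by (simp only: ext_map_def if_True pf cy)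
      ultimately show "(-1) ^ Suc q * ?tr Q u (\<lambda>vs. \<beta> (\<delta>c u # vs)) + ?tr X u \<beta> =
          Y (cinv c u) (pull_form (V (cinv c u)) (\<lambda>v. v c) \<beta>)"
        unfolding cy(1) Y_def lifting_data.lift_def[OF ld[OF y(1)]] by (simp only: plus_fun_apply scaleR_fun_def real_scaleR_def)
    qed
  qed
  then show ?thesis using N(1,2) sol by blast
qed

lemma lift_exists:
  "\<exists>Xt\<in>mv_fields At (Suc q). lie_derivative At (Suc q) Xt \<Upsilon> = 0 \<and> related At A \<tau> (Suc q) Xt X"
proof -
  obtain Xt where Xt: "Xt \<in> mv_fields At (Suc q)" "\<And>y. Xt y \<in> solutions y"
    using glue_mv_fields[OF mt convex_solutions local_solution] by blast
  have rel: "ext_map (V y) (W y) (Suc q) (L y) (Xt y) = X (\<tau> y)"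
    and eq: "contract (Xt y) (ext_d At \<Upsilon> y) = (-1) ^ Suc q *\<^sub>R ext_d At \<kappa> y" for y
    using Xt(2)[of y] by (simp_all only: solutions_def mem_Collect_eq)
  have "iota Xt \<Upsilon> = \<kappa>"
    unfolding iota_def[of Xt \<Upsilon>] by (rule ext) (rule contract_\<Upsilon>[OF mv_fields_ext_power[OF Xt(1)] rel])
  moreover have "(-1) ^ Suc q *\<^sub>R iota Xt (ext_d At \<Upsilon>) = ext_d At \<kappa>"
    unfolding iota_def eq
    by (simp add: scaleR_fun_def fun_eq_iff mult.assoc[symmetric] power_add[symmetric])
  ultimately have "lie_derivative At (Suc q) Xt \<Upsilon> = 0"
    unfolding lie_derivative_def by (simp only: diff_self)
  moreover have "related At A \<tau> (Suc q) Xt X" unfolding related_def using rel by blast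
  ultimately show ?thesis using Xt(1) by blast
qed

lemma contract_eq_of_solution:
  assumes "Xt \<in> mv_fields At (Suc q)" "lie_derivative At (Suc q) Xt \<Upsilon> = 0" "related At A \<tau> (Suc q) Xt X"
  shows "contract (Xt y) (ext_d At \<Upsilon> y) ws = (-1) ^ Suc q * ext_d At \<kappa> y ws"
proof -
  have rel: "ext_map (V y) (W y) (Suc q) (L y) (Xt y) = X (\<tau> y)" for y
    using assms(3) unfolding related_def by blast
  have "iota Xt \<Upsilon> = \<kappa>"
    unfolding iota_def[of Xt \<Upsilon>] by (rule ext) (rule contract_\<Upsilon>[OF mv_fields_ext_power[OF assms(1)] rel])
  then have "lie_derivative At (Suc q) Xt \<Upsilon> y ws = ext_d At \<kappa> y ws - (-1) ^ Suc q * contract (Xt y) (ext_d At \<Upsilon> y) ws"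
    unfolding lie_derivative_def by (simp add: iota_def scaleR_fun_def)
  then have "ext_d At \<kappa> y ws = (-1) ^ Suc q * contract (Xt y) (ext_d At \<Upsilon> y) ws" using assms(2) by simp
  then show ?thesis by (simp add: mult.assoc[symmetric] power_add[symmetric])
qed

lemma lift_unique:
  assumes "Xt \<in> mv_fields At (Suc q)" "lie_derivative At (Suc q) Xt \<Upsilon> = 0" "related At A \<tau> (Suc q) Xt X"
    and "Xt' \<in> mv_fields At (Suc q)" "lie_derivative At (Suc q) Xt' \<Upsilon> = 0" "related At A \<tau> (Suc q) Xt' X"
  shows "Xt y - Xt' y \<in> kernel_at At (Suc q) (ext_d At \<Upsilon>) y"
proof -
  have "contract (Xt y - Xt' y) (ext_d At \<Upsilon> y) ws = 0" for ws
    using contract_eq_of_solution[OF assms(1-3), of y ws] contract_eq_of_solution[OF assms(4-6), of y ws]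
    by (simp add: contract_def)
  then have "contract (Xt y - Xt' y) (ext_d At \<Upsilon> y) = 0" by (simp add: fun_eq_iff)
  moreover have "Xt y - Xt' y \<in> ext_power (V y) (Suc q)"
    by (intro subspace_diff[OF subspace_ext_power] mv_fields_ext_power assms(1,4))
  ultimately show ?thesis by (simp only: kernel_at_def mem_Collect_eq)
qed

end

theorem theorem3p8:
  fixes A :: "('m::{t2_space, second_countable_topology}, 'e::euclidean_space) atlas"
    and At :: "('t::{t2_space, second_countable_topology}, 'k::euclidean_space) atlas"
    and F :: "('f::{t2_space, second_countable_topology}, 'g::euclidean_space) atlas"
    and \<Theta> :: "('m, 'e) form_field"
    and \<Upsilon> :: "('t, 'k) form_field"
    and \<tau> :: "'t \<Rightarrow> 'm"
    and \<phi> :: "'t \<Rightarrow> real"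
    and X :: "('m, 'e) mv_field"
    and n p :: nat
  assumes "smooth_manifold A" and "smooth_manifold At" and "smooth_manifold F"
    and "\<Theta> \<in> diff_forms A n" and "\<forall>x. \<Theta> x \<noteq> 0"
    and "pre_multisymplectization n At A F \<Theta> \<tau> \<Upsilon> \<phi> \<or> multisymplectization n At A F \<Theta> \<tau> \<Upsilon> \<phi>"
    and "1 \<le> p" and "p \<le> n"
    and "inf_conformal A p \<Theta> X"
  shows "(\<exists>Xt\<in>mv_fields At p. lie_derivative At p Xt \<Upsilon> = 0 \<and> related At A \<tau> p Xt X) \<and>
    (\<forall>Xt\<in>mv_fields At p. \<forall>Xt'\<in>mv_fields At p.
       lie_derivative At p Xt \<Upsilon> = 0 \<and> related At A \<tau> p Xt X \<and>
       lie_derivative At p Xt' \<Upsilon> = 0 \<and> related At A \<tau> p Xt' X \<longrightarrow>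
       (\<forall>y. Xt y - Xt' y \<in> kernel_at At p (ext_d At \<Upsilon>) y))"
proof -
  obtain q where p: "p = Suc q" using assms(7) by (cases p) auto
  obtain k where n: "n = Suc q + k" using assms(8) p le_Suc_ex by blast
  have \<Upsilon>: "\<Upsilon> \<in> diff_forms At n" and cb: "conformal_bundle At A F \<Theta> \<tau> \<Upsilon> \<phi>"
    using assms(6)
    by (auto simp: pre_multisymplectization_def multisymplectization_def
        homogeneous_pre_multisymplectic_def homogeneous_multisymplectic_def)
  obtain \<Delta> where \<Delta>: "liouville At \<Upsilon> \<Delta>" "related At A \<tau> 1 \<Delta> 0"
    using cb unfolding conformal_bundle_def by blast
  obtain Q where X: "X \<in> mv_fields A p" and Q: "Q \<in> mv_fields A (p - 1)" "lie_derivative A p X \<Theta> = iota Q \<Theta>"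
    using assms(9) unfolding inf_conformal_def by blast
  interpret conformal_lifting A At F \<Theta> \<Upsilon> \<tau> \<phi> \<Delta> X Q q k
  proof
    show "fiber_bundle At A F \<tau>" "smooth_fun At \<phi>" "\<And>y. \<phi> y \<noteq> 0" "\<Upsilon> = (\<lambda>y. \<phi> y *\<^sub>R pullback At A \<tau> \<Theta> y)"
      using cb unfolding conformal_bundle_def by blast+
    show "Q \<in> mv_fields A q" using Q(1) p by simp
    show "\<Theta> \<in> diff_forms A (Suc q + k)" "\<Upsilon> \<in> diff_forms At (Suc q + k)"
      using assms(4) \<Upsilon> unfolding n .
    show "X \<in> mv_fields A (Suc q)" "lie_derivative A (Suc q) X \<Theta> = iota Q \<Theta>"
      using X Q(2) unfolding p .
    show "\<Theta> x \<noteq> 0" for x using assms(5) by blast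
  qed (fact assms(1-3) \<Delta>)+
  show ?thesis unfolding p using lift_exists lift_unique by blast
qed

end
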